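(* Let $p$ be an odd prime, $K$ a finite unramified extension of $\mathbb{Q}_p$, $I$ the inertia subgroup of $\mathrm{Gal}(\overline{K}/K)$, and $I(1)$ the subgroup of $I$ fixing the $p$-th roots of unity in $\overline{K}$. Let $M$ be a finite $\mathbb{Z}[I]$-module which is ordinary semistable and almost unramified. Then (1) $I(1)$ acts trivially on $M$; (2) if $p \geq 5$ and $M$ is ordinary good, then $I$ acts trivially on $M$.
   Context: Let $\chi: I \to \hat{\mathbb{Z}}^*$ be the cyclotomic character; a torsion $I$-module $N$ is cyclotomic if $\sigma n = \chi(\sigma)n$ for all $\sigma \in I$, $n\in N$. A finite $\mathbb{Z}[I]$-module $M$ is ordinary semistable if there is an exact sequence of $\mathbb{Z}[I]$-modules $0 \to M' \to M \to M'' \to 0$ with $I$ acting on $M'$ cyclotomically and trivially on $M''$. Writing $M = M_p \oplus M_{\text{non-}p}$ ($p$-power order part and prime-to-$p$ part), $M$ is ordinary good if it is ordinary semistable and $I$ acts trivially on $M_{\text{non-}p}$. $M$ is almost unramified if whenever $g,h \in I$ satisfy $(g+h-2)M = 0$, one has $(g-1)M = (h-1)M = 0$. *)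

theory Defs
  imports Complex_Main "HOL-Computational_Algebra.Primes" "HOL-Algebra.Algebra"
begin

section \<open>The field of \<open>p\<close>-adic numbers\<close>

definition padic_abs :: "nat \<Rightarrow> rat \<Rightarrow> real" where
  "padic_abs p r = (if r = 0 then 0 else
     (case quotient_of r of (a, b) \<Rightarrow>
       real p powi (int (multiplicity (int p) b) - int (multiplicity (int p) a))))"

definition rat_embed :: "('a, 'b) ring_scheme \<Rightarrow> rat \<Rightarrow> 'a" where
  "rat_embed L r = (case quotient_of r of (a, b) \<Rightarrow>
     ([a] \<cdot>\<^bsub>L\<^esub> \<one>\<^bsub>L\<^esub>) \<otimes>\<^bsub>L\<^esub> inv\<^bsub>L\<^esub> ([b] \<cdot>\<^bsub>L\<^esub> \<one>\<^bsub>L\<^esub>))"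

text \<open>
  The subfield \<open>Q\<close> of \<open>L\<close>, with absolute value \<open>av\<close>, is a completion of the rational numbers
  with respect to the \<open>p\<close>-adic absolute value. This determines \<open>(Q, av)\<close> up to unique
  isomorphism. The values of \<open>av\<close> outside \<open>Q\<close> are irrelevant.
\<close>

locale padic_numbers = field L + subfield Q L for L (structure) and Q +
  fixes p :: nat and av :: "'a \<Rightarrow> real"
  assumes av_nonneg: "x \<in> Q \<Longrightarrow> 0 \<le> av x"
    and av_eq_0: "x \<in> Q \<Longrightarrow> av x = 0 \<longleftrightarrow> x = \<zero>"
    and av_mult: "\<lbrakk> x \<in> Q; y \<in> Q \<rbrakk> \<Longrightarrow> av (x \<otimes> y) = av x * av y"
    and av_triangle: "\<lbrakk> x \<in> Q; y \<in> Q \<rbrakk> \<Longrightarrow> av (x \<oplus> y) \<le> av x + av y"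
    and av_rat: "av (rat_embed L r) = padic_abs p r"
    and rat_dense: "\<lbrakk> x \<in> Q; 0 < e \<rbrakk> \<Longrightarrow> \<exists>r. av (x \<ominus> rat_embed L r) < e"
    and av_complete: "\<lbrakk> \<And>n. s n \<in> Q;
        \<And>e. 0 < e \<Longrightarrow> \<exists>N. \<forall>m\<ge>N. \<forall>n\<ge>N. av (s m \<ominus> s n) < e \<rbrakk>
      \<Longrightarrow> \<exists>x\<in>Q. (\<lambda>n::nat. av (s n \<ominus> x)) \<longlonglongrightarrow> 0"

section \<open>Rings of integers, unramified extensions, inertia\<close>

definition padic_integers :: "'a set \<Rightarrow> ('a \<Rightarrow> real) \<Rightarrow> 'a set" where
  "padic_integers Q av = {x \<in> Q. av x \<le> 1}"

text \<open>Polynomials are lists of coefficients, leading coefficient first.\<close>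

definition integral_closure :: "('a, 'b) ring_scheme \<Rightarrow> 'a set \<Rightarrow> 'a set \<Rightarrow> 'a set" where
  "integral_closure L A E =
     {x \<in> E. \<exists>f \<in> carrier (A[X]\<^bsub>L\<^esub>). f \<noteq> [] \<and> lead_coeff f = \<one>\<^bsub>L\<^esub> \<and> ring.eval L f x = \<zero>\<^bsub>L\<^esub>}"

text \<open>The non-units of a subring \<open>A\<close> of \<open>L\<close>; if \<open>A\<close> is local, this is its maximal ideal.\<close>

definition nonunits :: "('a, 'b) ring_scheme \<Rightarrow> 'a set \<Rightarrow> 'a set" where
  "nonunits L A = A - Units (L\<lparr>carrier := A\<rparr>)"

abbreviation ring_of_integers ::
    "('a, 'b) ring_scheme \<Rightarrow> 'a set \<Rightarrow> ('a \<Rightarrow> real) \<Rightarrow> 'a set \<Rightarrow> 'a set" where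
  "ring_of_integers L Q av E \<equiv> integral_closure L (padic_integers Q av) E"

text \<open>
  The maximal ideal of the \<open>p\<close>-adic integers generates the maximal ideal of the ring of integers
  of \<open>K\<close>, that is, the ramification index is 1. (The residue fields are finite, so the residue
  field extension is automatically separable.)
\<close>

definition unramified :: "('a, 'b) ring_scheme \<Rightarrow> 'a set \<Rightarrow> ('a \<Rightarrow> real) \<Rightarrow> 'a set \<Rightarrow> bool" where
  "unramified L Q av K \<longleftrightarrow>
     genideal (L\<lparr>carrier := ring_of_integers L Q av K\<rparr>) (nonunits L (padic_integers Q av))
       = nonunits L (ring_of_integers L Q av K)"

locale finite_unramified_extension = padic_numbers L Q p av + K?: subfield K L
  for L (structure) and Q and p and av and K +
  assumes base_subset: "Q \<subseteq> K"
    and finite_ext: "finite_dimension Q K"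
    and unram: "unramified L Q av K"

definition galois_group :: "('a, 'b) ring_scheme \<Rightarrow> 'a set \<Rightarrow> ('a \<Rightarrow> 'a) monoid" where
  "galois_group L K = (BijGroup (carrier L))
     \<lparr>carrier := {\<sigma> \<in> Bij (carrier L). \<sigma> \<in> ring_hom L L \<and> (\<forall>x\<in>K. \<sigma> x = x)}\<rparr>"

text \<open>The automorphisms acting trivially on the residue field of \<open>L\<close>.\<close>

definition inertia_group ::
    "('a, 'b) ring_scheme \<Rightarrow> 'a set \<Rightarrow> ('a \<Rightarrow> real) \<Rightarrow> 'a set \<Rightarrow> ('a \<Rightarrow> 'a) monoid" where
  "inertia_group L Q av K = (galois_group L K)
     \<lparr>carrier := {\<sigma> \<in> carrier (galois_group L K).
        \<forall>x \<in> ring_of_integers L Q av (carrier L).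
          \<sigma> x \<ominus>\<^bsub>L\<^esub> x \<in> nonunits L (ring_of_integers L Q av (carrier L))}\<rparr>"

definition fixing_roots_of_unity ::
    "('a, 'b) ring_scheme \<Rightarrow> nat \<Rightarrow> ('a \<Rightarrow> 'a) set \<Rightarrow> ('a \<Rightarrow> 'a) set" where
  "fixing_roots_of_unity L n S =
     {\<sigma> \<in> S. \<forall>\<zeta> \<in> carrier L. \<zeta> [^]\<^bsub>L\<^esub> n = \<one>\<^bsub>L\<^esub> \<longrightarrow> \<sigma> \<zeta> = \<zeta>}"

section \<open>The cyclotomic character\<close>

text \<open>
  The profinite completion of the integers: an element \<open>a\<close> is the compatible family of its residues
  \<open>a n < n\<close> modulo \<open>n > 0\<close>. The unused component \<open>a 0\<close> is normalised to \<open>0\<close>.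
\<close>

definition Zhat :: "(nat \<Rightarrow> nat) ring" where
  "Zhat = \<lparr>carrier = {a. a 0 = 0 \<and> (\<forall>n>0. a n < n) \<and> (\<forall>m>0. \<forall>n>0. m dvd n \<longrightarrow> a n mod m = a m)},
     monoid.mult = (\<lambda>a b n. (a n * b n) mod n),
     monoid.one = (\<lambda>n. if n = 0 then 0 else 1 mod n),
     ring.zero = (\<lambda>n. 0),
     ring.add = (\<lambda>a b n. (a n + b n) mod n)\<rparr>"

definition cyclotomic_character :: "('a, 'b) ring_scheme \<Rightarrow> ('a \<Rightarrow> 'a) \<Rightarrow> (nat \<Rightarrow> nat)" where
  "cyclotomic_character L \<sigma> = (THE a. a \<in> Units Zhat \<and>
     (\<forall>n>0. \<forall>\<zeta> \<in> carrier L. \<zeta> [^]\<^bsub>L\<^esub> n = \<one>\<^bsub>L\<^esub> \<longrightarrow> \<sigma> \<zeta> = \<zeta> [^]\<^bsub>L\<^esub> (a n)))"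

section \<open>Modules over the integral group ring of a group\<close>

text \<open>
  The record \<open>module\<close> is used with \<open>smult\<close> as the action of group elements; its multiplicative
  fields \<open>mult\<close> and \<open>one\<close> play no role.
\<close>

locale group_module = G?: group G + M?: abelian_group M
  for G :: "('g, 'c) monoid_scheme" (structure) and M :: "('g, 'm, 'd) module_scheme" (structure) +
  assumes act_closed: "\<lbrakk> g \<in> carrier G; x \<in> carrier M \<rbrakk> \<Longrightarrow> g \<odot>\<^bsub>M\<^esub> x \<in> carrier M"
    and act_add: "\<lbrakk> g \<in> carrier G; x \<in> carrier M; y \<in> carrier M \<rbrakk> \<Longrightarrow>
      g \<odot>\<^bsub>M\<^esub> (x \<oplus>\<^bsub>M\<^esub> y) = g \<odot>\<^bsub>M\<^esub> x \<oplus>\<^bsub>M\<^esub> g \<odot>\<^bsub>M\<^esub> y"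
    and act_mult: "\<lbrakk> g \<in> carrier G; h \<in> carrier G; x \<in> carrier M \<rbrakk> \<Longrightarrow>
      (g \<otimes>\<^bsub>G\<^esub> h) \<odot>\<^bsub>M\<^esub> x = g \<odot>\<^bsub>M\<^esub> (h \<odot>\<^bsub>M\<^esub> x)"
    and act_one: "x \<in> carrier M \<Longrightarrow> \<one>\<^bsub>G\<^esub> \<odot>\<^bsub>M\<^esub> x = x"

definition gmod_hom :: "('g, 'c) monoid_scheme \<Rightarrow> ('g, 'm, 'd) module_scheme \<Rightarrow>
    ('g, 'n, 'e) module_scheme \<Rightarrow> ('m \<Rightarrow> 'n) set" where
  "gmod_hom G M N = {f \<in> hom (add_monoid M) (add_monoid N).
     \<forall>g \<in> carrier G. \<forall>x \<in> carrier M. f (g \<odot>\<^bsub>M\<^esub> x) = g \<odot>\<^bsub>N\<^esub> f x}"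

definition short_exact :: "('g, 'c) monoid_scheme \<Rightarrow> ('g, 'l, 'd) module_scheme \<Rightarrow> ('l \<Rightarrow> 'm) \<Rightarrow>
    ('g, 'm, 'e) module_scheme \<Rightarrow> ('m \<Rightarrow> 'n) \<Rightarrow> ('g, 'n, 'f) module_scheme \<Rightarrow> bool" where
  "short_exact G M' i M q M'' \<longleftrightarrow>
     group_module G M' \<and> group_module G M \<and> group_module G M'' \<and>
     i \<in> gmod_hom G M' M \<and> q \<in> gmod_hom G M M'' \<and>
     inj_on i (carrier M') \<and> i ` carrier M' = a_kernel M M'' q \<and> q ` carrier M = carrier M''"

abbreviation add_ord :: "('m, 'd) ring_scheme \<Rightarrow> 'm \<Rightarrow> nat" where
  "add_ord M x \<equiv> group.ord (add_monoid M) x"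

text \<open>
  Scalar multiplication of a torsion element \<open>x\<close> by \<open>a\<close> in \<^const>\<open>Zhat\<close>: the residue of \<open>a\<close> modulo
  any \<open>n > 0\<close> with \<open>n x = 0\<close> gives the same result, in particular \<open>n\<close> the order of \<open>x\<close>.
\<close>

definition Zhat_smult :: "('m, 'd) ring_scheme \<Rightarrow> (nat \<Rightarrow> nat) \<Rightarrow> 'm \<Rightarrow> 'm" where
  "Zhat_smult M a x = [a (add_ord M x)] \<cdot>\<^bsub>M\<^esub> x"

definition torsion_module :: "('m, 'd) ring_scheme \<Rightarrow> bool" where
  "torsion_module M \<longleftrightarrow> (\<forall>x \<in> carrier M. \<exists>n::nat. n > 0 \<and> [n] \<cdot>\<^bsub>M\<^esub> x = \<zero>\<^bsub>M\<^esub>)"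

definition cyclotomic_module ::
    "('a, 'b) ring_scheme \<Rightarrow> ('a \<Rightarrow> 'a, 'c) monoid_scheme \<Rightarrow> ('a \<Rightarrow> 'a, 'm, 'd) module_scheme \<Rightarrow> bool"
  where
  "cyclotomic_module L I N \<longleftrightarrow> torsion_module N \<and>
     (\<forall>\<sigma> \<in> carrier I. \<forall>x \<in> carrier N. \<sigma> \<odot>\<^bsub>N\<^esub> x = Zhat_smult N (cyclotomic_character L \<sigma>) x)"

definition acts_trivially :: "'g set \<Rightarrow> ('g, 'm, 'd) module_scheme \<Rightarrow> 'm set \<Rightarrow> bool" where
  "acts_trivially S M Y \<longleftrightarrow> (\<forall>\<sigma> \<in> S. \<forall>x \<in> Y. \<sigma> \<odot>\<^bsub>M\<^esub> x = x)"

text \<open>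
  Requiring the outer terms of the exact sequence to live on the same type as \<open>M\<close> is no
  restriction, as they embed into (the set underlying) \<open>M\<close>: see \<open>ordinary_semistableI\<close> below.
\<close>

definition ordinary_semistable ::
    "('a, 'b) ring_scheme \<Rightarrow> ('a \<Rightarrow> 'a, 'c) monoid_scheme \<Rightarrow> ('a \<Rightarrow> 'a, 'm) module \<Rightarrow> bool" where
  "ordinary_semistable L I M \<longleftrightarrow>
     (\<exists>(M' :: ('a \<Rightarrow> 'a, 'm) module) (M'' :: ('a \<Rightarrow> 'a, 'm) module) i q.
        short_exact I M' i M q M'' \<and> cyclotomic_module L I M' \<and>
        acts_trivially (carrier I) M'' (carrier M''))"

definition prime_to_part :: "nat \<Rightarrow> ('m, 'd) ring_scheme \<Rightarrow> 'm set" where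
  "prime_to_part p M = {x \<in> carrier M. coprime p (add_ord M x)}"

definition ordinary_good ::
    "('a, 'b) ring_scheme \<Rightarrow> ('a \<Rightarrow> 'a, 'c) monoid_scheme \<Rightarrow> nat \<Rightarrow> ('a \<Rightarrow> 'a, 'm) module \<Rightarrow> bool"
  where
  "ordinary_good L I p M \<longleftrightarrow>
     ordinary_semistable L I M \<and> acts_trivially (carrier I) M (prime_to_part p M)"

definition almost_unramified :: "('g, 'c) monoid_scheme \<Rightarrow> ('g, 'm, 'd) module_scheme \<Rightarrow> bool" where
  "almost_unramified I M \<longleftrightarrow> (\<forall>g \<in> carrier I. \<forall>h \<in> carrier I.
     (\<forall>x \<in> carrier M. (g \<odot>\<^bsub>M\<^esub> x \<oplus>\<^bsub>M\<^esub> h \<odot>\<^bsub>M\<^esub> x) \<ominus>\<^bsub>M\<^esub> ([(2::nat)] \<cdot>\<^bsub>M\<^esub> x) = \<zero>\<^bsub>M\<^esub>) \<longrightarrow>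
     (\<forall>x \<in> carrier M. g \<odot>\<^bsub>M\<^esub> x \<ominus>\<^bsub>M\<^esub> x = \<zero>\<^bsub>M\<^esub>) \<and>
     (\<forall>x \<in> carrier M. h \<odot>\<^bsub>M\<^esub> x \<ominus>\<^bsub>M\<^esub> x = \<zero>\<^bsub>M\<^esub>))"

section \<open>Independence of the types of the outer terms\<close>

text \<open>Transport of a module along an injection \<open>f\<close> of its carrier.\<close>

definition transport ::
    "('n \<Rightarrow> 'm) \<Rightarrow> ('g, 'n, 'd) module_scheme \<Rightarrow> ('g, 'm) module" where
  "transport f N = (let k = inv_into (carrier N) f in
     \<lparr>carrier = f ` carrier N, monoid.mult = (\<lambda>x y. x), monoid.one = f \<zero>\<^bsub>N\<^esub>, ring.zero = f \<zero>\<^bsub>N\<^esub>,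
      ring.add = (\<lambda>x y. f (k x \<oplus>\<^bsub>N\<^esub> k y)), smult = (\<lambda>g x. f (g \<odot>\<^bsub>N\<^esub> k x))\<rparr>)"

lemma transport_group_module:
  assumes "group_module G N" and inj: "inj_on f (carrier N)"
  shows "group_module G (transport f N)"
proof -
  interpret N: group_module G N by fact
  have k: "inv_into (carrier N) f (f x) = x" if "x \<in> carrier N" for x
    using that inj by simp
  have ab: "abelian_group (transport f N)"
  proof (rule abelian_groupI)
    fix x assume "x \<in> carrier (transport f N)"
    then obtain u where u: "u \<in> carrier N" "x = f u" by (auto simp: transport_def Let_def)
    show "\<exists>y\<in>carrier (transport f N). y \<oplus>\<^bsub>transport f N\<^esub> x = \<zero>\<^bsub>transport f N\<^esub>"
      by (rule bexI[of _ "f (\<ominus>\<^bsub>N\<^esub> u)"]) (use u in \<open>auto simp: transport_def Let_def k N.l_neg\<close>)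
  qed (auto simp: transport_def Let_def k N.a_ac)
  show ?thesis
    by (intro group_module.intro group_module_axioms.intro ab N.group_axioms)
      (auto simp: transport_def Let_def k N.act_closed N.act_add N.act_mult N.act_one)
qed

lemma transport_add_pow:
  assumes "group_module G N" and inj: "inj_on f (carrier N)" and x: "x \<in> carrier N"
  shows "[(n::nat)] \<cdot>\<^bsub>transport f N\<^esub> (f x) = f ([n] \<cdot>\<^bsub>N\<^esub> x)"
proof -
  interpret N: group_module G N by fact
  interpret T: group_module G "transport f N"
    by (rule transport_group_module) fact+
  show ?thesis
  proof (induction n)
    case 0
    show ?case by simp (simp add: transport_def Let_def)
  next
    case (Suc n)
    then show ?case
      using x inj N.add.nat_pow_closed[OF x, of n]
      by (simp add: N.add.nat_pow_Suc T.add.nat_pow_Suc) (simp add: transport_def Let_def)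
  qed
qed

lemma transport_add_ord:
  assumes "group_module G N" and inj: "inj_on f (carrier N)" and x: "x \<in> carrier N"
  shows "add_ord (transport f N) (f x) = add_ord N x"
proof -
  interpret N: group_module G N by fact
  interpret T: group_module G "transport f N"
    by (rule transport_group_module) fact+
  have "[n] \<cdot>\<^bsub>transport f N\<^esub> (f x) = \<zero>\<^bsub>transport f N\<^esub> \<longleftrightarrow> [n] \<cdot>\<^bsub>N\<^esub> x = \<zero>\<^bsub>N\<^esub>" for n :: nat
    using inj_on_eq_iff[OF inj, of "[n] \<cdot>\<^bsub>N\<^esub> x" "\<zero>\<^bsub>N\<^esub>"] N.add.nat_pow_closed[OF x, of n]
    unfolding transport_add_pow[OF assms] by (simp add: transport_def Let_def)
  then show ?thesis
    unfolding group.ord_def[OF N.a_group] group.ord_def[OF T.a_group]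
    by (simp add: add_pow_def)
qed

lemma ordinary_semistableI:
  fixes M :: "('a \<Rightarrow> 'a, 'm) module"
    and N' :: "('a \<Rightarrow> 'a, 'n, 'c) module_scheme" and N'' :: "('a \<Rightarrow> 'a, 'l, 'd) module_scheme"
  assumes ex: "short_exact I N' i M q N''"
    and cyc: "cyclotomic_module L I N'"
    and triv: "acts_trivially (carrier I) N'' (carrier N'')"
  shows "ordinary_semistable L I M"
proof -
  interpret N': group_module I N' using ex by (simp add: short_exact_def)
  interpret M: group_module I M using ex by (simp add: short_exact_def)
  interpret N'': group_module I N'' using ex by (simp add: short_exact_def)
  have inj: "inj_on i (carrier N')" and im: "i ` carrier N' = a_kernel M N'' q"
    and surj: "q ` carrier M = carrier N''"
    and i: "i \<in> gmod_hom I N' M" and q: "q \<in> gmod_hom I M N''"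
    using ex by (auto simp: short_exact_def)
  define s where "s = inv_into (carrier M) q"
  have injs: "inj_on s (carrier N'')"
    unfolding s_def using surj by (metis inj_on_inv_into order_refl)
  have ks: "inv_into (carrier N'') s (s y) = y" if "y \<in> carrier N''" for y
    using that injs by simp
  have ki: "inv_into (carrier N') i (i y) = y" if "y \<in> carrier N'" for y
    using that inj by simp
  have qc: "q x \<in> carrier N''" if "x \<in> carrier M" for x using that surj by blast
  define M1 where "M1 = transport i N'"
  define M2 where "M2 = transport s N''"
  have m1: "group_module I M1" unfolding M1_def by (rule transport_group_module) (fact N'.group_module_axioms inj)+
  have m2: "group_module I M2" unfolding M2_def by (rule transport_group_module) (fact N''.group_module_axioms injs)+
  have id: "id \<in> gmod_hom I M1 M"
    using i by (auto simp: gmod_hom_def hom_def M1_def transport_def Let_def ki Pi_iff)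
  have q2: "s \<circ> q \<in> gmod_hom I M M2"
    using q by (auto simp: gmod_hom_def hom_def M2_def transport_def Let_def ks qc Pi_iff)
  have "carrier M1 = a_kernel M N'' q"
    using im by (simp add: M1_def transport_def Let_def)
  also have "\<dots> = a_kernel M M2 (s \<circ> q)"
    using inj_on_eq_iff[OF injs qc N''.zero_closed]
    by (auto simp: a_kernel_def kernel_def M2_def transport_def Let_def)
  finally have ker: "id ` carrier M1 = a_kernel M M2 (s \<circ> q)" by simp
  have surj2: "(s \<circ> q) ` carrier M = carrier M2"
    using surj by (simp add: M2_def transport_def Let_def flip: image_image)
  have "short_exact I M1 id M (s \<circ> q) M2"
    unfolding short_exact_def using m1 m2 M.group_module_axioms id q2 ker surj2 by simp
  moreover have "acts_trivially (carrier I) M2 (carrier M2)"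
    using triv by (auto simp: acts_trivially_def M2_def transport_def Let_def ks)
  moreover have "cyclotomic_module L I M1"
    unfolding cyclotomic_module_def
  proof (intro conjI ballI)
    note pw = transport_add_pow[OF N'.group_module_axioms inj]
    have "\<exists>n::nat. n > 0 \<and> [n] \<cdot>\<^bsub>M1\<^esub> i x = \<zero>\<^bsub>M1\<^esub>" if x: "x \<in> carrier N'" for x
    proof -
      obtain n :: nat where "n > 0" "[n] \<cdot>\<^bsub>N'\<^esub> x = \<zero>\<^bsub>N'\<^esub>"
        using cyc x by (auto simp: cyclotomic_module_def torsion_module_def)
      then have "[n] \<cdot>\<^bsub>M1\<^esub> i x = \<zero>\<^bsub>M1\<^esub>"
        using pw[OF x, of n] by (simp add: M1_def) (simp add: transport_def Let_def)
      with \<open>n > 0\<close> show ?thesis by blast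
    qed
    then show "torsion_module M1"
      by (auto simp: torsion_module_def M1_def transport_def Let_def)
    fix \<sigma> y assume \<sigma>: "\<sigma> \<in> carrier I" and "y \<in> carrier M1"
    then obtain x where x: "x \<in> carrier N'" and y: "y = i x"
      by (auto simp: M1_def transport_def Let_def)
    have "\<sigma> \<odot>\<^bsub>M1\<^esub> y = i (\<sigma> \<odot>\<^bsub>N'\<^esub> x)"
      using x y by (simp add: M1_def transport_def Let_def ki)
    also have "\<dots> = i (Zhat_smult N' (cyclotomic_character L \<sigma>) x)"
      using cyc \<sigma> x by (simp add: cyclotomic_module_def)
    also have "\<dots> = Zhat_smult M1 (cyclotomic_character L \<sigma>) y"
      using pw[OF x] transport_add_ord[OF N'.group_module_axioms inj x]
      by (simp add: Zhat_smult_def M1_def y)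
    finally show "\<sigma> \<odot>\<^bsub>M1\<^esub> y = Zhat_smult M1 (cyclotomic_character L \<sigma>) y" .
  qed
  ultimately show ?thesis unfolding ordinary_semistable_def by blast
qed

end

theory Submission
  imports Defs "HOL-Computational_Algebra.Polynomial"
begin

text \<open>
  Let \<open>c\<close> be the cyclotomic character modulo the exponent \<open>N = p\<^sup>n m\<close> of \<open>M\<close>, with \<open>m\<close> prime to
  \<open>p\<close>. For \<open>s \<in> I\<close> the map \<open>s - 1\<close> sends \<open>M\<close> into the cyclotomic submodule, so
  \<open>st - 1 = c(s) (t - 1) + (s - 1)\<close>. If \<open>c(s) = 1\<close> then \<open>s + s\<^sup>-\<^sup>1 - 2\<close> kills \<open>M\<close>, so \<open>s\<close> acts
  trivially. Hence the action is abelian and \<open>(c(s) - 1)(t - 1) = (c(t) - 1)(s - 1)\<close>. The character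
  is trivial modulo \<open>m\<close> and surjects onto the units modulo \<open>p\<^sup>n\<close>. For \<open>s \<in> I(1)\<close> one chooses \<open>t\<close> with
  \<open>c(s) + c(t) = 2\<close> and compares with an element of character \<open>2\<close> modulo \<open>p\<^sup>n\<close> to see that \<open>s + t - 2\<close>
  kills \<open>M\<close>. For \<open>p \<ge> 5\<close> the same works with \<open>c(s) = -1\<close> and \<open>c(t) = 3\<close>, and then
  \<open>c(s) - 1 = -2\<close> is invertible modulo \<open>p\<^sup>n\<close>.

  Surjectivity is Eisenstein's criterion over the maximal unramified extension \<open>K(\<mu>)\<close>, where \<open>\<mu>\<close> is
  the group of roots of unity of order prime to \<open>p\<close>. An automorphism fixing \<open>K(\<mu>)\<close> is in the inertia
  group because the ring of integers of \<open>L\<close> is local and each of its elements is congruent to an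
  element of \<open>\<mu> \<union> {0}\<close>. Locality holds since an idempotent modulo \<open>p\<close> of \<open>\<int>\<^sub>p[x]\<close> lifts, by
  completeness, to an idempotent of the field \<open>L\<close>.
\<close>

section \<open>Commutative rings\<close>

text \<open>No valuation on \<open>L\<close> is at hand: \<open>av\<close> is meaningful on
  \<open>Q\<close> only. Its role on integral elements is taken by the nonunits of \<open>OL\<close>
  and by divisibility by \<open>P\<close>. Each element of \<open>OL\<close> lies in an order, a
  ring spanned by finitely many elements over the p-adic integers. Completeness is used in the
  coordinates there, and an element divisible by all powers of \<open>P\<close> is 0, so limits in
  \<open>L\<close> reduce to congruences. That \<open>K\<close> is unramified enters once, in the
  form that nonunits in \<open>OK\<close> are multiples of \<open>P\<close>. Frobenius congruences
  modulo \<open>P\<close> carry this over to the ring generated by \<open>OK\<close> and the roots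
  of unity of order prime to p. On the module side, \<open>M\<close> may have a part of order prime
  to p, where c - 1 vanishes and the commutation relation is empty. For I(1) that part is controlled
  by raising s to the power p^n; for the second claim it is controlled by goodness. The bound p >= 5
  makes 3 a unit, so that 2 = -1 + 3 is a sum of two values of the character.\<close>

abbreviation of_integer :: "('a, 'b) ring_scheme \<Rightarrow> int \<Rightarrow> 'a" (\<open>\<iota>\<index>\<close>) where
  "\<iota>\<^bsub>R\<^esub> k \<equiv> [k] \<cdot>\<^bsub>R\<^esub> \<one>\<^bsub>R\<^esub>"

context cring
begin

lemma of_integer_closed [simp]: "\<iota> k \<in> carrier R"
  by simp

lemma of_integer_0 [simp]: "\<iota> 0 = \<zero>" and of_integer_1 [simp]: "\<iota> 1 = \<one>"
  by (simp_all add: add_pow_int_ge)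

lemma of_integer_add: "\<iota> (a + b) = \<iota> a \<oplus> \<iota> b"
  by (simp add: add.int_pow_mult)

lemma of_integer_neg: "\<iota> (- a) = \<ominus> \<iota> a"
  by (simp add: add.int_pow_neg)

lemma of_integer_diff: "\<iota> (a - b) = \<iota> a \<ominus> \<iota> b"
  using of_integer_add[of a "- b"] by (simp add: of_integer_neg a_minus_def)

lemma add_pow_eq_of_integer_mult: "x \<in> carrier R \<Longrightarrow> [(k::int)] \<cdot> x = \<iota> k \<otimes> x"
  by (simp add: add_pow_ldistr_int)

lemma of_integer_mult: "\<iota> (a * b) = \<iota> a \<otimes> \<iota> b"
  by (metis add.int_pow_pow add_pow_eq_of_integer_mult mult.commute of_integer_closed one_closed)

lemma subring_of_integer: "subring S R \<Longrightarrow> \<iota> k \<in> S"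
proof -
  assume S: "subring S R"
  have *: "\<iota> (int n) \<in> S" for n
    by (induction n) (auto simp: of_integer_add subringE[OF S])
  show ?thesis
    by (cases k rule: int_cases2) (auto simp: * of_integer_neg subringE(5)[OF S])
qed

lemma subring_pow: "subring S R \<Longrightarrow> x \<in> S \<Longrightarrow> x [^] (n::nat) \<in> S"
  by (induction n) (auto simp: subringE)

lemma subring_minus: "subring S R \<Longrightarrow> x \<in> S \<Longrightarrow> y \<in> S \<Longrightarrow> x \<ominus> y \<in> S"
  by (simp add: a_minus_def subringE)

lemma subring_finsum:
  assumes S: "subring S R" and "finite I" and "\<And>i. i \<in> I \<Longrightarrow> f i \<in> S"
  shows "(\<Oplus>i\<in>I. f i) \<in> S"
  using assms(2,3)
proof (induction I)
  case (insert i I)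
  have "f \<in> insert i I \<rightarrow> carrier R"
    using insert.prems subringE(1)[OF S] by blast
  then show ?case
    using insert by (simp add: subringE(7)[OF S])
qed (simp add: subringE(2)[OF S])

lemma binomial_expansion:
  assumes [simp]: "a \<in> carrier R" "b \<in> carrier R"
  shows "(a \<oplus> b) [^] n = (\<Oplus>k\<in>{..n}. \<iota> (int (n choose k)) \<otimes> (a [^] k \<otimes> b [^] (n - k)))"
proof (induction n)
  case (Suc n)
  let ?t = "\<lambda>k. a [^] Suc k \<otimes> b [^] (n - k)"
  let ?c = "\<lambda>n k. \<iota> (int (n choose k))"
  have "(\<Oplus>k\<in>{..Suc n}. ?c (Suc n) k \<otimes> (a [^] k \<otimes> b [^] (Suc n - k)))
      = (\<Oplus>k\<in>{..n}. ?c (Suc n) (Suc k) \<otimes> ?t k) \<oplus> b [^] Suc n"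
    by (subst finsum_Suc2) auto
  also have "(\<Oplus>k\<in>{..n}. ?c (Suc n) (Suc k) \<otimes> ?t k)
      = (\<Oplus>k\<in>{..n}. ?c n k \<otimes> ?t k \<oplus> ?c n (Suc k) \<otimes> ?t k)"
    by (intro finsum_cong') (auto simp: of_integer_add l_distr)
  also have "\<dots> = (\<Oplus>k\<in>{..n}. ?c n k \<otimes> ?t k) \<oplus> (\<Oplus>k\<in>{..n}. ?c n (Suc k) \<otimes> ?t k)"
    by (intro finsum_addf) auto
  also have "(\<Oplus>k\<in>{..n}. ?c n k \<otimes> ?t k)
      = (\<Oplus>k\<in>{..n}. a \<otimes> (?c n k \<otimes> (a [^] k \<otimes> b [^] (n - k))))"
    by (intro finsum_cong') (auto simp: m_ac)
  also have "\<dots> = a \<otimes> (a \<oplus> b) [^] n"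
    by (subst finsum_rdistr[symmetric]) (auto simp: Suc)
  finally have 1: "(\<Oplus>k\<in>{..Suc n}. ?c (Suc n) k \<otimes> (a [^] k \<otimes> b [^] (Suc n - k)))
      = a \<otimes> (a \<oplus> b) [^] n \<oplus> (\<Oplus>k\<in>{..n}. ?c n (Suc k) \<otimes> ?t k) \<oplus> b [^] Suc n" .
  have "b \<otimes> (a \<oplus> b) [^] n = (\<Oplus>k\<in>{..n}. b \<otimes> (?c n k \<otimes> (a [^] k \<otimes> b [^] (n - k))))"
    by (subst finsum_rdistr[symmetric]) (auto simp: Suc)
  also have "\<dots> = (\<Oplus>k\<in>{..n}. ?c n k \<otimes> (a [^] k \<otimes> b [^] (Suc n - k)))"
    by (intro finsum_cong') (auto simp: m_ac Suc_diff_le)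
  also have "\<dots> = (\<Oplus>k\<in>{..Suc n}. ?c n k \<otimes> (a [^] k \<otimes> b [^] (Suc n - k)))"
    by (subst finsum_Suc) (auto simp: binomial_eq_0)
  also have "\<dots> = (\<Oplus>k\<in>{..n}. ?c n (Suc k) \<otimes> ?t k) \<oplus> b [^] Suc n"
    by (subst finsum_Suc2) auto
  finally have 2: "b \<otimes> (a \<oplus> b) [^] n = (\<Oplus>k\<in>{..n}. ?c n (Suc k) \<otimes> ?t k) \<oplus> b [^] Suc n" .
  have "(a \<oplus> b) [^] Suc n = a \<otimes> (a \<oplus> b) [^] n \<oplus> b \<otimes> (a \<oplus> b) [^] n"
    by (simp add: l_distr m_comm)
  then show ?case
    unfolding 1 2 by (simp add: a_assoc)
qed simp

text \<open>The inner binomial coefficients are divisible by p. The error term is kept inside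
  \<open>S\<close>, which is later \<open>OL\<close> or \<open>RU\<close>, because divisibility by p
  has to be measured in that ring and means nothing in the field \<open>L\<close>.\<close>

lemma frobenius_add:
  assumes p: "Factorial_Ring.prime (p::nat)" and S: "subring S R" and a: "a \<in> S" and b: "b \<in> S"
  shows "\<exists>s\<in>S. (a \<oplus> b) [^] p = a [^] p \<oplus> b [^] p \<oplus> \<iota> (int p) \<otimes> s"
proof -
  have [simp]: "a \<in> carrier R" "b \<in> carrier R"
    using a b subringE(1)[OF S] by auto
  obtain q where q: "p = Suc (Suc q)"
    using prime_ge_2_nat[OF p] by (metis add_2_eq_Suc le_Suc_ex)
  let ?f = "\<lambda>k. \<iota> (int (p choose k)) \<otimes> (a [^] k \<otimes> b [^] (p - k))"
  \<comment> \<open>\<open>?f (Suc k)\<close> with the factor p divided out of its binomial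
    coefficient. The shift drops the index 0, and the index p = q + 2 is dropped by summing only up
    to q.\<close>
  let ?g = "\<lambda>k. \<iota> (int ((p choose Suc k) div p)) \<otimes> (a [^] Suc k \<otimes> b [^] (p - Suc k))"
  have gS: "?g k \<in> S" for k
    by (intro subringE(6)[OF S] subring_of_integer[OF S] subring_pow[OF S] a b)
  have "(a \<oplus> b) [^] p = (\<Oplus>k\<in>{..Suc (Suc q)}. ?f k)"
    using binomial_expansion[of a b p] q by simp
  also have "\<dots> = ?f (Suc (Suc q)) \<oplus> ((\<Oplus>k\<in>{..q}. ?f (Suc k)) \<oplus> ?f 0)"
    by (subst finsum_Suc, simp, subst finsum_Suc2) auto
  also have "?f (Suc (Suc q)) = a [^] p"
    using q by auto
  also have "?f 0 = b [^] p"
    by auto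
  also have "(\<Oplus>k\<in>{..q}. ?f (Suc k)) = (\<Oplus>k\<in>{..q}. \<iota> (int p) \<otimes> ?g k)"
  proof (intro finsum_cong')
    fix k assume "k \<in> {..q}"
    then have "p dvd (p choose Suc k)"
      using p q by (intro dvd_choose_prime) auto
    then have "int (p choose Suc k) = int p * int ((p choose Suc k) div p)"
      by (metis dvd_mult_div_cancel of_nat_mult)
    then show "?f (Suc k) = \<iota> (int p) \<otimes> ?g k"
      by (simp add: of_integer_mult m_assoc)
  qed auto
  also have "\<dots> = \<iota> (int p) \<otimes> (\<Oplus>k\<in>{..q}. ?g k)"
    by (subst finsum_rdistr) auto
  finally have "(a \<oplus> b) [^] p = a [^] p \<oplus> b [^] p \<oplus> \<iota> (int p) \<otimes> (\<Oplus>k\<in>{..q}. ?g k)"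
    by (simp add: a_ac)
  moreover have "(\<Oplus>k\<in>{..q}. ?g k) \<in> S"
    using gS by (intro subring_finsum[OF S]) auto
  ultimately show ?thesis by blast
qed

end

lemma (in domain) pow_nonzero: "x \<in> carrier R \<Longrightarrow> x \<noteq> \<zero> \<Longrightarrow> x [^] (n::nat) \<noteq> \<zero>"
  by (induction n) (auto simp: integral_iff)

section \<open>The ring of \<open>p\<close>-adic integers\<close>

locale padic_prime = padic_numbers L Q p av for L (structure) and Q and p and av +
  assumes prime_p: "Factorial_Ring.prime p"
begin

abbreviation A where "A \<equiv> padic_integers Q av"

abbreviation P where "P \<equiv> \<iota> (int p)"

lemma p_ge_2: "real p \<ge> 2"
  using prime_ge_2_nat[OF prime_p] by simp

lemma Q_subfield: "subfield Q L"
  by (rule subfield_axioms)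

lemma Q_subring: "subring Q L"
  using subfieldE(1)[OF subfield_axioms] .

lemmas Q_closed = subringE(2,3,5,6,7)[OF Q_subring]

lemma Q_carrier: "x \<in> Q \<Longrightarrow> x \<in> carrier L"
  using subringE(1)[OF Q_subring] by blast

lemma Q_minus: "x \<in> Q \<Longrightarrow> y \<in> Q \<Longrightarrow> x \<ominus> y \<in> Q"
  by (rule subring_minus[OF Q_subring])

lemma Q_inv: "x \<in> Q \<Longrightarrow> x \<noteq> \<zero> \<Longrightarrow> inv x \<in> Q"
  using subfield_m_inv(1)[OF subfield_axioms, of x] by simp

lemma Q_int: "\<iota> k \<in> Q"
  by (rule subring_of_integer[OF Q_subring])

lemma rat_embed_of_int: "rat_embed L (of_int k) = \<iota> k"
  by (simp add: rat_embed_def)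

lemma av_int_powi: "k \<noteq> 0 \<Longrightarrow> av (\<iota> k) = real p powi (- int (multiplicity (int p) k))"
  using av_rat[of "of_int k"] by (simp add: rat_embed_of_int padic_abs_def)

lemma av_int: "k \<noteq> 0 \<Longrightarrow> av (\<iota> k) = (1 / real p) ^ multiplicity (int p) k"
  by (simp add: av_int_powi power_int_minus power_one_over divide_inverse power_inverse)

lemma av_0 [simp]: "av \<zero> = 0"
  using av_eq_0[of \<zero>] Q_closed(1) by simp

text \<open>A nonzero integer has a power of 1/p as absolute value, so \<open>L\<close> has
  characteristic 0.\<close>

lemma of_integer_eq_0_iff [simp]: "\<iota> k = \<zero> \<longleftrightarrow> k = 0"
proof
  assume *: "\<iota> k = \<zero>"
  show "k = 0"
  proof (rule ccontr)
    assume "k \<noteq> 0"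
    with av_int[of k] * p_ge_2 show False by simp
  qed
qed simp

lemma av_1 [simp]: "av \<one> = 1"
  using av_int[of 1] by simp

lemma av_minus_one: "av (\<ominus> \<one>) = 1"
proof -
  have "av (\<ominus> \<one>) * av (\<ominus> \<one>) = 1"
    using av_mult[of "\<ominus> \<one>" "\<ominus> \<one>"] Q_closed by (simp add: l_minus)
  then show ?thesis
    using av_nonneg[of "\<ominus> \<one>"] Q_closed by (simp add: square_eq_1_iff)
qed

lemma av_neg: "x \<in> Q \<Longrightarrow> av (\<ominus> x) = av x"
  using av_mult[of "\<ominus> \<one>" x] av_minus_one Q_closed Q_carrier[of x] by (simp add: l_minus)

lemma av_minus_commute: "x \<in> Q \<Longrightarrow> y \<in> Q \<Longrightarrow> av (x \<ominus> y) = av (y \<ominus> x)"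
  using av_neg[of "x \<ominus> y"] Q_minus[of x y] Q_carrier[of x] Q_carrier[of y]
  by (simp add: minus_add a_minus_def a_comm)

lemma av_inv: "x \<in> Q \<Longrightarrow> x \<noteq> \<zero> \<Longrightarrow> av (inv x) = inverse (av x)"
proof -
  assume x: "x \<in> Q" "x \<noteq> \<zero>"
  then have "x \<otimes> inv x = \<one>"
    using subfield_m_inv(2)[OF subfield_axioms, of x] by simp
  then have "av x * av (inv x) = 1"
    using av_mult[OF x(1) Q_inv[OF x]] by simp
  then show ?thesis
    by (metis inverse_unique)
qed

text \<open>Only the triangle inequality is assumed of \<open>av\<close>. The ultrametric inequality
  is recovered from \<open>av_rat\<close> in three stages: integers here, by divisibility by a power
  of p; then fractions over a common denominator; then all of \<open>Q\<close> by density.\<close>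

lemma av_int_add: "av (\<iota> (a + b)) \<le> max (av (\<iota> a)) (av (\<iota> b))"
proof (cases "a = 0 \<or> b = 0 \<or> a + b = 0")
  case True
  then show ?thesis
    using av_nonneg[OF Q_int[of a]] by (elim disjE) (auto simp: max_def)
next
  case False
  let ?v = "multiplicity (int p)"
  define m where "m = min (?v a) (?v b)"
  have "int p ^ m dvd a" "int p ^ m dvd b"
    by (auto simp: m_def intro: multiplicity_dvd')
  then have "int p ^ m dvd a + b"
    by simp
  then have "m \<le> ?v (a + b)"
    using False prime_gt_1_nat[OF prime_p] by (intro multiplicity_geI) auto
  then have "(1 / real p) ^ ?v (a + b) \<le> (1 / real p) ^ m"
    using p_ge_2 by (intro power_decreasing) auto
  also have "\<dots> \<le> max ((1 / real p) ^ ?v a) ((1 / real p) ^ ?v b)"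
    by (auto simp: m_def min_def)
  finally show ?thesis
    using False by (simp add: av_int)
qed

lemma rat_embed_obtain:
  obtains a b where "quotient_of r = (a, b)" "b > 0" "coprime a b"
    "rat_embed L r = \<iota> a \<otimes> inv (\<iota> b)" "rat_embed L r \<in> Q" "rat_embed L r \<otimes> \<iota> b = \<iota> a"
proof -
  obtain a b where ab: "quotient_of r = (a, b)" by fastforce
  then have b: "b > 0" "coprime a b"
    using quotient_of_denom_pos quotient_of_coprime by auto
  then have "\<iota> b \<noteq> \<zero>" by simp
  then have i: "inv (\<iota> b) \<in> Q" "inv (\<iota> b) \<otimes> \<iota> b = \<one>"
    using Q_inv[OF Q_int] subfield_m_inv(3)[OF subfield_axioms, of "\<iota> b"] Q_int by auto
  have "rat_embed L r = \<iota> a \<otimes> inv (\<iota> b)"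
    using ab by (simp add: rat_embed_def)
  moreover from this have "rat_embed L r \<in> Q"
    using i Q_int Q_closed by simp
  moreover have "\<iota> a \<otimes> inv (\<iota> b) \<otimes> \<iota> b = \<iota> a"
    using i by (simp add: m_assoc Q_carrier)
  ultimately show ?thesis
    using that ab b by simp
qed

lemma rat_embed_Q: "rat_embed L r \<in> Q"
  by (rule rat_embed_obtain[of r]) simp

lemma av_rat_embed_add:
  "av (rat_embed L r \<oplus> rat_embed L s) \<le> max (av (rat_embed L r)) (av (rat_embed L s))"
proof -
  obtain a b where ab: "b > 0" "rat_embed L r \<in> Q" "rat_embed L r \<otimes> \<iota> b = \<iota> a"
    using rat_embed_obtain[of r] by metis
  obtain c d where cd: "d > 0" "rat_embed L s \<in> Q" "rat_embed L s \<otimes> \<iota> d = \<iota> c"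
    using rat_embed_obtain[of s] by metis
  let ?X = "rat_embed L r" and ?Y = "rat_embed L s"
  have [simp]: "?X \<in> carrier L" "?Y \<in> carrier L"
    using ab cd Q_carrier by auto
  have X: "?X \<otimes> \<iota> (b * d) = \<iota> (a * d)"
    using ab(3) by (simp add: of_integer_mult m_assoc[symmetric])
  have Y: "?Y \<otimes> \<iota> (b * d) = \<iota> (c * b)"
    using cd(3) by (simp add: of_integer_mult m_comm[of "\<iota> b"] m_assoc[symmetric])
  have XY: "(?X \<oplus> ?Y) \<otimes> \<iota> (b * d) = \<iota> (a * d + c * b)"
    by (simp add: l_distr X Y of_integer_add del: of_integer_mult)
  have pos: "av (\<iota> (b * d)) > 0"
    using ab(1) cd(1) av_nonneg[OF Q_int, of "b * d"] av_eq_0[OF Q_int, of "b * d"]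
    by (simp add: order_le_less)
  have "av (?X \<oplus> ?Y) * av (\<iota> (b * d)) = av (\<iota> (a * d + c * b))"
    using av_mult[of "?X \<oplus> ?Y" "\<iota> (b * d)"] ab cd Q_int Q_closed XY by simp
  also have "\<dots> \<le> max (av (\<iota> (a * d))) (av (\<iota> (c * b)))"
    by (rule av_int_add)
  also have "av (\<iota> (a * d)) = av ?X * av (\<iota> (b * d))"
    using av_mult[OF ab(2) Q_int, of "b * d"] X by simp
  also have "av (\<iota> (c * b)) = av ?Y * av (\<iota> (b * d))"
    using av_mult[OF cd(2) Q_int, of "b * d"] Y by simp
  finally have "av (?X \<oplus> ?Y) * av (\<iota> (b * d)) \<le> max (av ?X) (av ?Y) * av (\<iota> (b * d))"
    using pos by (auto simp: max_def split: if_splits)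
  then show ?thesis
    using pos by simp
qed

lemma av_ultrametric:
  assumes x: "x \<in> Q" and y: "y \<in> Q"
  shows "av (x \<oplus> y) \<le> max (av x) (av y)"
proof (rule field_le_epsilon)
  fix e :: real assume "e > 0"
  \<comment> \<open>Two thirds pay for the two approximation errors, the last third for passing from
    the absolute values of the approximants back to those of x and y.\<close>
  then have e: "e / 3 > 0" by simp
  obtain r where r: "av (x \<ominus> rat_embed L r) < e / 3" using rat_dense[OF x e] by blast
  obtain s where s: "av (y \<ominus> rat_embed L s) < e / 3" using rat_dense[OF y e] by blast
  let ?X = "rat_embed L r" and ?Y = "rat_embed L s"
  have XY: "?X \<in> Q" "?Y \<in> Q" by (rule rat_embed_Q)+
  have c: "x \<in> carrier L" "y \<in> carrier L" "?X \<in> carrier L" "?Y \<in> carrier L"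
    using x y XY Q_carrier by auto
  have "?X = x \<oplus> (?X \<ominus> x)" "?Y = y \<oplus> (?Y \<ominus> y)"
    using c by algebra+
  then have "av ?X \<le> av x + av (?X \<ominus> x)" "av ?Y \<le> av y + av (?Y \<ominus> y)"
    using av_triangle[OF x Q_minus[OF XY(1) x]] av_triangle[OF y Q_minus[OF XY(2) y]] by auto
  then have le: "av ?X \<le> av x + e / 3" "av ?Y \<le> av y + e / 3"
    using r s av_minus_commute x y XY by auto
  have "x \<oplus> y = ((x \<ominus> ?X) \<oplus> (y \<ominus> ?Y)) \<oplus> (?X \<oplus> ?Y)"
    using c by algebra
  then have "av (x \<oplus> y) \<le> av ((x \<ominus> ?X) \<oplus> (y \<ominus> ?Y)) + av (?X \<oplus> ?Y)"
    using av_triangle Q_closed(5) Q_minus x y XY by simp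
  also have "av ((x \<ominus> ?X) \<oplus> (y \<ominus> ?Y)) \<le> av (x \<ominus> ?X) + av (y \<ominus> ?Y)"
    using av_triangle Q_minus x y XY by simp
  finally show "av (x \<oplus> y) \<le> max (av x) (av y) + e"
    using r s av_rat_embed_add[of r s] le by linarith
qed

lemma av_ultrametric_minus:
  "x \<in> Q \<Longrightarrow> y \<in> Q \<Longrightarrow> av (x \<ominus> y) \<le> max (av x) (av y)"
  using av_ultrametric[of x "\<ominus> y"] Q_closed(3)[of y] by (simp add: a_minus_def av_neg)

text \<open>A rational approximation with error smaller than \<open>av x\<close> has exactly the
  absolute value of x by the ultrametric inequality, so the completion adds no new values.\<close>

lemma av_value: 
  assumes x: "x \<in> Q" and "x \<noteq> \<zero>"
  shows "\<exists>k. av x = real p powi k"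
proof -
  have pos: "av x > 0"
    using assms av_nonneg[OF x] av_eq_0[OF x] by simp
  obtain r where r: "av (x \<ominus> rat_embed L r) < av x" using rat_dense[OF x pos] by blast
  let ?X = "rat_embed L r"
  have X: "?X \<in> Q" by (rule rat_embed_Q)
  have c: "x \<in> carrier L" "?X \<in> carrier L" using x X Q_carrier by auto
  have "x = (x \<ominus> ?X) \<oplus> ?X" "?X = x \<ominus> (x \<ominus> ?X)" using c by algebra+
  then have "av x \<le> max (av (x \<ominus> ?X)) (av ?X)" "av ?X \<le> max (av x) (av (x \<ominus> ?X))"
    using av_ultrametric[OF Q_minus[OF x X] X] av_ultrametric_minus[OF x Q_minus[OF x X]] by auto
  then have eq: "av x = av ?X" using r by linarith
  then have "r \<noteq> 0" using pos av_rat[of r] by (auto simp: padic_abs_def)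
  then show ?thesis
    using eq av_rat[of r] by (auto simp: padic_abs_def split: prod.splits)
qed

text \<open>The nonzero values are integral powers of p, so nothing lies strictly between 1/p and 1.
  This gap is what makes \<open>P\<close> a generator of the maximal ideal of
  \<open>A\<close>.\<close>

lemma av_less_1: "x \<in> Q \<Longrightarrow> av x < 1 \<Longrightarrow> av x \<le> 1 / real p"
proof (cases "x = \<zero>")
  case False
  assume x: "x \<in> Q" "av x < 1"
  obtain k where k: "av x = real p powi k" using av_value x False by blast
  have "k \<le> -1"
  proof (rule ccontr)
    assume "\<not> k \<le> -1"
    then have "real p powi k \<ge> 1" using p_ge_2 by (intro one_le_power_int) auto
    with x k show False by simp
  qed
  then have "real p powi k \<le> real p powi (-1)"
    using p_ge_2 by (intro power_int_increasing) auto
  then show ?thesis using k by (simp add: power_int_minus divide_inverse)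
qed simp

lemma av_P [simp]: "av P = 1 / real p"
  using av_int[of "int p"] prime_gt_1_nat[OF prime_p] by (simp add: multiplicity_self)

lemma P_nonzero [simp]: "P \<noteq> \<zero>"
  using prime_gt_0_nat[OF prime_p] by simp

lemma A_iff: "x \<in> A \<longleftrightarrow> x \<in> Q \<and> av x \<le> 1"
  by (simp add: padic_integers_def)

lemma A_subring: "subring A L"
proof (rule subringI)
  fix x y assume "x \<in> A" "y \<in> A"
  then have *: "x \<in> Q" "y \<in> Q" "av x \<le> 1" "av y \<le> 1" by (auto simp: A_iff)
  show "x \<otimes> y \<in> A"
    using * av_nonneg[of x] av_nonneg[of y] Q_closed(4) by (simp add: A_iff av_mult mult_le_one)
  show "x \<oplus> y \<in> A"
    using * av_ultrametric[of x y] Q_closed(5) by (simp add: A_iff)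
qed (auto simp: A_iff Q_carrier Q_closed av_neg)

lemmas A_closed = subringE(2,3,5,6,7)[OF A_subring]

lemma A_carrier: "x \<in> A \<Longrightarrow> x \<in> carrier L"
  using subringE(1)[OF A_subring] by blast

lemma A_divide:
  assumes "x \<in> Q" "y \<in> Q" "y \<noteq> \<zero>" "av x \<le> av y"
  shows "\<exists>c\<in>A. x = c \<otimes> y"
proof
  have i: "inv y \<in> Q" "inv y \<otimes> y = \<one>"
    using Q_inv subfield_m_inv(3)[OF subfield_axioms, of y] assms by auto
  have pos: "av y > 0"
    using assms av_nonneg[of y] av_eq_0[of y] by simp
  show "x \<otimes> inv y \<in> A"
    using assms i pos Q_closed(4) by (simp add: A_iff av_mult av_inv field_simps)
  show "x = x \<otimes> inv y \<otimes> y"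
    using assms i Q_carrier by (simp add: m_assoc)
qed

lemma A_divide_P: "x \<in> Q \<Longrightarrow> av x < 1 \<Longrightarrow> \<exists>c\<in>A. x = c \<otimes> P"
  using A_divide[of x P] av_less_1[of x] Q_int prime_gt_0_nat[OF prime_p] by simp

text \<open>Discreteness of the values again: x and the power of \<open>P\<close> with the same
  absolute value divide each other in \<open>A\<close>.\<close>

lemma A_P_power:
  assumes "x \<in> A" "x \<noteq> \<zero>"
  shows "\<exists>n c d. c \<in> A \<and> d \<in> A \<and> x = c \<otimes> P [^] (n::nat) \<and> P [^] n = d \<otimes> x"
proof -
  have x: "x \<in> Q" "av x \<le> 1" using assms by (auto simp: A_iff)
  obtain k where k: "av x = real p powi k" using av_value x assms by blast
  have "k \<le> 0"
  proof (rule ccontr)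
    assume "\<not> k \<le> 0"
    then have "real p powi 1 \<le> real p powi k" using p_ge_2 by (intro power_int_increasing) auto
    with x k p_ge_2 show False by simp
  qed
  then have "av x = (1 / real p) ^ nat (- k)"
    using k by (simp add: power_int_def power_one_over divide_inverse)
  moreover have "av (P [^] n) = (1 / real p) ^ n" for n
    by (induction n) (use Q_int Q_closed in \<open>simp_all add: av_mult subring_pow[OF Q_subring]\<close>)
  ultimately have "av x = av (P [^] nat (- k))" by simp
  then have "\<exists>c\<in>A. x = c \<otimes> P [^] nat (- k)" "\<exists>d\<in>A. P [^] nat (- k) = d \<otimes> x"
    using x assms(2) subring_pow[OF Q_subring Q_int] pow_nonzero[OF _ P_nonzero]
    by (auto intro!: A_divide)
  then show ?thesis by blast
qed

lemma av_P_pow: "av (P [^] (n::nat)) = (1 / real p) ^ n"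
  by (induction n) (use Q_int Q_closed in \<open>simp_all add: av_mult subring_pow[OF Q_subring]\<close>)

text \<open>Provides the pivot for elimination over a discrete valuation ring: a term of smallest
  valuation divides all others, and it exists because valuations of elements of \<open>A\<close> are
  natural numbers.\<close>

lemma A_common_divisor:
  assumes a: "\<And>j::nat. a j \<in> A"
  shows "\<exists>i. \<forall>j. \<exists>c\<in>A. a j = c \<otimes> a i"
proof (cases "\<forall>i. a i = \<zero>")
  case True
  then show ?thesis using A_closed(2) by (auto intro!: bexI[of _ \<one>])
next
  case False
  then obtain i0 where i0: "a i0 \<noteq> \<zero>" by blast
  have val: "\<exists>n. av (a i) = (1 / real p) ^ n" if nz: "a i \<noteq> \<zero>" for i
  proof -
    obtain n c d where *: "c \<in> A" "d \<in> A" "a i = c \<otimes> P [^] (n::nat)" "P [^] n = d \<otimes> a i"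
      using A_P_power[OF a nz] by blast
    have Pn: "P [^] n \<in> Q" by (rule subring_pow[OF Q_subring Q_int])
    have q: "c \<in> Q" "d \<in> Q" "a i \<in> Q" "av c \<le> 1" "av d \<le> 1" using * a by (auto simp: A_iff)
    have "av (a i) = av c * av (P [^] n)" "av (P [^] n) = av d * av (a i)"
      using av_mult q Pn * by metis+
    moreover have "av c * av (P [^] n) \<le> av (P [^] n)" "av d * av (a i) \<le> av (a i)"
      using q av_nonneg[OF Pn] av_nonneg[OF q(3)] by (auto intro: mult_left_le_one_le av_nonneg)
    ultimately have "av (a i) = av (P [^] n)" by linarith
    then show ?thesis by (auto simp: av_P_pow)
  qed
  \<comment> \<open>\<open>Z n\<close> says that n is the valuation of some nonzero term; its least
    instance yields the pivot.\<close>
  define Z where "Z = (\<lambda>n. \<exists>i. a i \<noteq> \<zero> \<and> av (a i) = (1 / real p) ^ n)"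
  have "\<exists>n. Z n" using val[OF i0] i0 by (auto simp: Z_def)
  then have "Z (LEAST n. Z n)" by (metis LeastI)
  then obtain i where i: "a i \<noteq> \<zero>" "av (a i) = (1 / real p) ^ (LEAST n. Z n)"
    by (auto simp: Z_def)
  have "\<exists>c\<in>A. a j = c \<otimes> a i" for j
  proof (cases "a j = \<zero>")
    case True
    then show ?thesis using A_closed(1) A_carrier[OF a] by (intro bexI[of _ \<zero>]) auto
  next
    case False
    then obtain n where n: "av (a j) = (1 / real p) ^ n" using val by blast
    then have "Z n" using False by (auto simp: Z_def)
    then have "(LEAST n. Z n) \<le> n" by (rule Least_le)
    then have "av (a j) \<le> av (a i)"
      unfolding n i using p_ge_2 by (intro power_decreasing) auto
    then show ?thesis using a i by (intro A_divide) (auto simp: A_iff)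
  qed
  then show ?thesis by blast
qed

text \<open>The residue field has p elements: a rational close to a has a denominator prime to p,
  and Bezout turns its residue into an integer.\<close>

lemma A_residue:
  assumes a: "a \<in> A"
  shows "\<exists>k<p. \<exists>c\<in>A. a = \<iota> (int k) \<oplus> P \<otimes> c"
proof -
  have aQ: "a \<in> Q" "av a \<le> 1" using a by (auto simp: A_iff)
  obtain r where r: "av (a \<ominus> rat_embed L r) < 1" using rat_dense[OF aQ(1)] by force
  let ?X = "rat_embed L r"
  obtain m l where ml: "l > 0" "coprime m l" "?X \<in> Q" "?X \<otimes> \<iota> l = \<iota> m"
    using rat_embed_obtain[of r] by metis
  have c: "a \<in> carrier L" "?X \<in> carrier L" using aQ ml Q_carrier by auto
  have "?X = a \<ominus> (a \<ominus> ?X)" using c by algebra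
  then have X1: "av ?X \<le> 1"
    using av_ultrametric_minus[OF aQ(1) Q_minus[OF aQ(1) ml(3)]] r aQ by auto
  have Xl: "av ?X * av (\<iota> l) = av (\<iota> m)"
    using av_mult[OF ml(3) Q_int, of l] ml(4) by simp
  \<comment> \<open>A factor p in the denominator would force \<open>av ?X > 1\<close>, since the
    numerator is then prime to p.\<close>
  have pl: "\<not> int p dvd l"
  proof
    assume d: "int p dvd l"
    have pp: "Factorial_Ring.prime (int p)" using prime_p by simp
    then have "\<not> int p dvd m"
      using d ml(2) by (meson coprime_common_divisor not_prime_unit)
    then have "multiplicity (int p) m = 0" by (rule not_dvd_imp_multiplicity_0)
    moreover have "m \<noteq> 0" using \<open>\<not> int p dvd m\<close> by auto
    ultimately have "av (\<iota> m) = 1" by (simp add: av_int)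
    moreover have "multiplicity (int p) l > 0"
      using d ml(1) pp by (simp add: prime_multiplicity_gt_zero_iff)
    then have "av (\<iota> l) < 1"
      using p_ge_2 ml(1) by (auto simp: av_int power_less_one_iff)
    moreover have "av ?X * av (\<iota> l) \<le> av (\<iota> l)"
      using X1 av_nonneg[OF ml(3)] av_nonneg[OF Q_int[of l]] by (intro mult_left_le_one_le) auto
    ultimately show False using Xl by linarith
  qed
  then have l1: "av (\<iota> l) = 1"
    using ml(1) by (simp add: av_int not_dvd_imp_multiplicity_0)
  have "coprime (int p) l"
    using pl prime_p by (simp add: prime_imp_coprime)
  then obtain u v where uv: "u * l + v * int p = 1"
    using bezout_int[of l "int p"] by (metis coprime_imp_gcd_eq_1 gcd.commute)
  \<comment> \<open>u is an inverse of the denominator l modulo p, so u * m is the residue of the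
    fraction m / l.\<close>
  define k where "k = nat ((u * m) mod int p)"
  have kp: "k < p" using prime_gt_0_nat[OF prime_p] by (simp add: k_def nat_less_iff)
  have ik: "int k = u * m - int p * (u * m div int p)"
    using prime_gt_0_nat[OF prime_p] by (simp add: k_def minus_mult_div_eq_mod)
  have "u * l = 1 - v * int p" using uv by simp
  then have "int k * l - m = int p * (- v * m - (u * m div int p) * l)"
  proof -
    have "int k * l - m = (u * l) * m - m - int p * (u * m div int p) * l"
      unfolding ik by (simp add: algebra_simps)
    then show ?thesis
      unfolding \<open>u * l = 1 - v * int p\<close> by (simp add: algebra_simps)
  qed
  then obtain w where w: "int k * l - m = int p * w" by blast
  have "(\<iota> (int k) \<ominus> ?X) \<otimes> \<iota> l = \<iota> (int k * l - m)"
    using ml(4) c by (simp add: a_minus_def l_distr l_minus of_integer_mult of_integer_diff)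
  also have "\<dots> = P \<otimes> \<iota> w" unfolding w by (rule of_integer_mult)
  finally have "av (\<iota> (int k) \<ominus> ?X) * av (\<iota> l) = 1 / real p * av (\<iota> w)"
    using av_mult[OF Q_minus[OF Q_int ml(3)] Q_int, of k l] av_mult[OF Q_int Q_int, of "int p" w] by simp
  moreover have "av (\<iota> w) \<le> 1"
    using subring_of_integer[OF A_subring] by (simp add: A_iff)
  ultimately have "av (\<iota> (int k) \<ominus> ?X) \<le> 1 / real p"
    using l1 p_ge_2 by (simp add: field_simps)
  also have "1 / real p < 1" using p_ge_2 by simp
  finally have "av (?X \<ominus> \<iota> (int k)) < 1" using av_minus_commute[OF Q_int ml(3)] by simp
  moreover have "a \<ominus> \<iota> (int k) = (a \<ominus> ?X) \<oplus> (?X \<ominus> \<iota> (int k))"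
    using c of_integer_closed[of "int k"] by algebra
  ultimately have "av (a \<ominus> \<iota> (int k)) < 1"
    using r av_ultrametric[OF Q_minus[OF aQ(1) ml(3)] Q_minus[OF ml(3) Q_int[of "int k"]]] by auto
  then obtain d where d: "d \<in> A" "a \<ominus> \<iota> (int k) = d \<otimes> P"
    using A_divide_P[OF Q_minus[OF aQ(1) Q_int]] by blast
  have "a = \<iota> (int k) \<oplus> (a \<ominus> \<iota> (int k))" using c of_integer_closed[of "int k"] by algebra
  then have "a = \<iota> (int k) \<oplus> P \<otimes> d" using d A_carrier by (simp add: m_comm)
  then show ?thesis using kp d(1) by blast
qed

text \<open>\<open>T j\<close> is the sum of the tail t j + P t (j+1) + P^2 t (j+2) + ... . This is
  the only use of completeness; later constructions work with the recursion alone and never form a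
  limit.\<close>

lemma A_series:
  assumes t: "\<And>j::nat. t j \<in> A"
  shows "\<exists>T. \<forall>j. T j \<in> A \<and> T j = t j \<oplus> P \<otimes> T (Suc j)"
proof -
  define s where "s = rec_nat \<zero> (\<lambda>n x. x \<oplus> P [^] n \<otimes> t n)"
  have s0: "s 0 = \<zero>" and sS: "s (Suc n) = s n \<oplus> P [^] n \<otimes> t n" for n
    by (simp_all add: s_def)
  have PQ: "P [^] n \<in> Q" for n :: nat by (rule subring_pow[OF Q_subring Q_int])
  have tQ: "t n \<in> Q" "av (t n) \<le> 1" for n using t[of n] by (auto simp: A_iff)
  have sQ: "s n \<in> Q" for n
    by (induction n) (auto simp: s0 sS Q_closed PQ tQ)
  have c: "s n \<in> carrier L" "t n \<in> carrier L" "P [^] n \<in> carrier L" for n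
    using sQ tQ PQ Q_carrier by auto
  define q where "q = 1 / real p"
  have q: "0 < q" "q < 1" using p_ge_2 by (auto simp: q_def)
  have d: "av (s (n + i) \<ominus> s n) \<le> q ^ n" for n i
  proof (induction i)
    case 0
    have "s n \<ominus> s n = \<zero>" using c by algebra
    then show ?case using q by simp
  next
    case (Suc i)
    have "s (n + Suc i) \<ominus> s n = (s (n + i) \<ominus> s n) \<oplus> P [^] (n + i) \<otimes> t (n + i)"
      using c[of "n + i"] c(1)[of n] Q_carrier[OF Q_closed(4)[OF PQ tQ(1)], of "n + i" "n + i"]
      unfolding add_Suc_right sS by algebra
    then have "av (s (n + Suc i) \<ominus> s n) \<le> max (av (s (n + i) \<ominus> s n)) (av (P [^] (n + i) \<otimes> t (n + i)))"
      using av_ultrametric[OF Q_minus[OF sQ sQ] Q_closed(4)[OF PQ tQ(1)]] by simp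
    also have "av (P [^] (n + i) \<otimes> t (n + i)) \<le> q ^ (n + i)"
      using av_mult[OF PQ tQ(1)] av_nonneg[OF tQ(1)] tQ(2)[of "n + i"] q
      by (simp add: av_P_pow q_def mult_left_le)
    also have "q ^ (n + i) \<le> q ^ n" using q by (intro power_decreasing) auto
    finally show ?case using Suc by simp
  qed
  have d': "av (s m \<ominus> s n) \<le> q ^ N" if "m \<ge> N" "n \<ge> N" for m n N
  proof -
    have "av (s m \<ominus> s N) \<le> q ^ N" "av (s n \<ominus> s N) \<le> q ^ N"
      using d[of N "m - N"] d[of N "n - N"] that by simp_all
    moreover have "s m \<ominus> s n = (s m \<ominus> s N) \<ominus> (s n \<ominus> s N)"
      using c(1)[of m] c(1)[of n] c(1)[of N] by algebra
    ultimately show ?thesis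
      using av_ultrametric_minus[OF Q_minus[OF sQ[of m] sQ[of N]] Q_minus[OF sQ[of n] sQ[of N]]] by auto
  qed
  have "\<exists>N. \<forall>m\<ge>N. \<forall>n\<ge>N. av (s m \<ominus> s n) < e" if e: "0 < e" for e
  proof -
    obtain N where "q ^ N < e" using real_arch_pow_inv[OF e q(2)] by blast
    then show ?thesis using d' by (meson order_le_less_trans)
  qed
  then obtain x where x: "x \<in> Q" "(\<lambda>n. av (s n \<ominus> x)) \<longlonglongrightarrow> 0"
    using av_complete[of s] sQ by blast
  have "\<exists>T\<in>A. x \<ominus> s n = T \<otimes> P [^] n" for n
  proof -
    have "0 < q ^ n" using q by simp
    then obtain N where N: "\<And>m. m \<ge> N \<Longrightarrow> norm (av (s m \<ominus> x) - 0) < q ^ n"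
      using LIMSEQ_D[OF x(2)] by blast
    define m where "m = max n N"
    have 1: "av (x \<ominus> s m) < q ^ n" using N[of m] av_minus_commute[OF sQ x(1)] by (simp add: m_def)
    have 2: "av (s m \<ominus> s n) \<le> q ^ n" using d'[of n m n] by (simp add: m_def)
    have "x \<ominus> s n = (x \<ominus> s m) \<oplus> (s m \<ominus> s n)"
      using c(1)[of m] c(1)[of n] Q_carrier[OF x(1)] by algebra
    then have "av (x \<ominus> s n) \<le> q ^ n"
      using av_ultrametric[OF Q_minus[OF x(1) sQ[of m]] Q_minus[OF sQ[of m] sQ[of n]]] 1 2 by auto
    then show ?thesis
      using A_divide[OF Q_minus[OF x(1) sQ] PQ] by (simp add: av_P_pow q_def pow_nonzero[OF _ P_nonzero])
  qed
  then obtain T where T: "\<And>n. T n \<in> A" "\<And>n. x \<ominus> s n = T n \<otimes> P [^] n"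
    by metis
  have "T n = t n \<oplus> P \<otimes> T (Suc n)" for n
  proof -
    have Tc: "T n \<in> carrier L" "T (Suc n) \<in> carrier L" using T A_carrier by auto
    have "P [^] n \<otimes> T n = x \<ominus> s n" using T(2)[of n] Tc by (simp add: m_comm)
    also have "\<dots> = P [^] n \<otimes> t n \<oplus> (x \<ominus> s (Suc n))"
      using c[of n] Q_carrier[OF x(1)] unfolding sS by algebra
    also have "x \<ominus> s (Suc n) = P [^] n \<otimes> (P \<otimes> T (Suc n))"
      using T(2)[of "Suc n"] Tc by (simp add: m_ac)
    also have "P [^] n \<otimes> t n \<oplus> P [^] n \<otimes> (P \<otimes> T (Suc n)) = P [^] n \<otimes> (t n \<oplus> P \<otimes> T (Suc n))"
      using c Tc by (simp add: r_distr)
    finally show ?thesis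
      using c Tc m_lcancel[of "P [^] n"] by (simp add: pow_nonzero[OF _ P_nonzero])
  qed
  then show ?thesis using T(1) by blast
qed

end

section \<open>Finitely generated modules over a subring\<close>

declare (in ring) Span.simps [simp del]

context cring
begin

lemma Span_Nil: "Span S [] = {\<zero>}"
  by (simp add: Span.simps)

lemma Span_Cons_iff: "u \<in> Span S (b # Bs) \<longleftrightarrow> (\<exists>k\<in>S. \<exists>v\<in>Span S Bs. u = k \<otimes> b \<oplus> v)"
  by (simp add: Span.simps line_extension_mem_iff)

definition products :: "'a list \<Rightarrow> 'a list \<Rightarrow> 'a list" where
  "products Bs Cs = concat (map (\<lambda>b. map (\<lambda>c. b \<otimes> c) Cs) Bs)"

lemma products_carrier:
  "set Bs \<subseteq> carrier R \<Longrightarrow> set Cs \<subseteq> carrier R \<Longrightarrow> set (products Bs Cs) \<subseteq> carrier R"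
  by (auto simp: products_def)

text \<open>Descending exponents, so that the coefficients of a combination already form a list for
  \<open>eval\<close>, which reads the leading coefficient first.\<close>

definition pows :: "'a \<Rightarrow> nat \<Rightarrow> 'a list" where
  "pows x n = map (\<lambda>i. x [^] i) (rev [0..<n])"

lemma pows_carrier: "x \<in> carrier R \<Longrightarrow> set (pows x n) \<subseteq> carrier R"
  by (auto simp: pows_def)

context
  fixes S assumes S: "subring S R"
begin

lemma S_carrier: "k \<in> S \<Longrightarrow> k \<in> carrier R"
  using subringE(1)[OF S] by blast

lemma subring_Span_carrier: "set Bs \<subseteq> carrier R \<Longrightarrow> x \<in> Span S Bs \<Longrightarrow> x \<in> carrier R"
  using Span_in_carrier[OF subringE(1)[OF S]] by blast

lemma subring_Span_zero: "set Bs \<subseteq> carrier R \<Longrightarrow> \<zero> \<in> Span S Bs"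
proof (induction Bs)
  case (Cons b Bs)
  then show ?case
    using subringE(2)[OF S]
    by (auto simp: Span_Cons_iff intro!: bexI[of _ \<zero>])
qed (simp add: Span_Nil)

lemma subring_Span_mem: "set Bs \<subseteq> carrier R \<Longrightarrow> b \<in> set Bs \<Longrightarrow> b \<in> Span S Bs"
proof (induction Bs)
  case (Cons c Bs)
  have c: "c \<in> carrier R" using Cons by simp
  show ?case
  proof (cases "b = c")
    case True
    have "b = \<one> \<otimes> c \<oplus> \<zero>" using True c by simp
    then show ?thesis
      using subringE(3)[OF S] subring_Span_zero[of Bs] Cons.prems(1) unfolding Span_Cons_iff
      by (intro bexI[of _ \<one>] bexI[of _ \<zero>]) auto
  next
    case False
    then have b: "b \<in> Span S Bs" using Cons by auto
    then have "b = \<zero> \<otimes> c \<oplus> b" using c subring_Span_carrier[of Bs b] Cons.prems by simp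
    then show ?thesis
      using b subringE(2)[OF S] unfolding Span_Cons_iff by blast
  qed
qed simp

lemma subring_Span_add:
  "set Bs \<subseteq> carrier R \<Longrightarrow> x \<in> Span S Bs \<Longrightarrow> y \<in> Span S Bs \<Longrightarrow> x \<oplus> y \<in> Span S Bs"
proof (induction Bs arbitrary: x y)
  case (Cons b Bs)
  then obtain k v l w where *: "k \<in> S" "v \<in> Span S Bs" "x = k \<otimes> b \<oplus> v"
    "l \<in> S" "w \<in> Span S Bs" "y = l \<otimes> b \<oplus> w"
    unfolding Span_Cons_iff by blast
  have c: "b \<in> carrier R" "k \<in> carrier R" "l \<in> carrier R" "v \<in> carrier R" "w \<in> carrier R"
    using Cons.prems * S_carrier subring_Span_carrier by auto
  have "x \<oplus> y = (k \<oplus> l) \<otimes> b \<oplus> (v \<oplus> w)"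
    unfolding * using c by algebra
  then show ?case
    using * Cons.IH[of v w] Cons.prems(1) subringE(7)[OF S] unfolding Span_Cons_iff by auto
qed (simp add: Span_Nil)

lemma subring_Span_smult:
  "set Bs \<subseteq> carrier R \<Longrightarrow> c \<in> S \<Longrightarrow> x \<in> Span S Bs \<Longrightarrow> c \<otimes> x \<in> Span S Bs"
proof (induction Bs arbitrary: x)
  case (Cons b Bs)
  then obtain k v where *: "k \<in> S" "v \<in> Span S Bs" "x = k \<otimes> b \<oplus> v"
    unfolding Span_Cons_iff by blast
  have cr: "b \<in> carrier R" "k \<in> carrier R" "v \<in> carrier R" "c \<in> carrier R"
    using Cons.prems * S_carrier subring_Span_carrier by auto
  have "c \<otimes> x = (c \<otimes> k) \<otimes> b \<oplus> (c \<otimes> v)"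
    unfolding * using cr by algebra
  then show ?case
    using * Cons.IH[of v] Cons.prems(1,2) subringE(6)[OF S] unfolding Span_Cons_iff by auto
qed (simp add: Span_Nil S_carrier)

lemma subring_Span_neg:
  assumes "set Bs \<subseteq> carrier R" "x \<in> Span S Bs" shows "\<ominus> x \<in> Span S Bs"
proof -
  have "\<ominus> x = (\<ominus> \<one>) \<otimes> x"
    using subring_Span_carrier[OF assms] by (simp add: l_minus)
  then show ?thesis
    using subring_Span_smult[OF assms(1) _ assms(2), of "\<ominus> \<one>"] subringE(3,5)[OF S] by simp
qed

text \<open>Serves as the induction rule for spans: \<open>E\<close> is usually the set of y for
  which some multiple of y lies in a fixed span or ring, so closure under sums and multiples
  replaces computations with coefficients.\<close>

lemma subring_Span_least:
  assumes "set Us \<subseteq> E" "\<zero> \<in> E" "\<And>x y. x \<in> E \<Longrightarrow> y \<in> E \<Longrightarrow> x \<oplus> y \<in> E"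
    and "\<And>k x. k \<in> S \<Longrightarrow> x \<in> E \<Longrightarrow> k \<otimes> x \<in> E"
  shows "Span S Us \<subseteq> E"
  using assms(1)
proof (induction Us)
  case (Cons b Us)
  then show ?case
    using assms(3,4) unfolding subset_iff Span_Cons_iff by auto
qed (simp add: Span_Nil assms)

lemma subring_Span_mono:
  assumes "set Bs \<subseteq> carrier R" "set Us \<subseteq> Span S Bs"
  shows "Span S Us \<subseteq> Span S Bs"
  using assms subring_Span_zero subring_Span_add subring_Span_smult by (intro subring_Span_least) auto

text \<open>Bilinearity in two stages: first a generator b times all of the second span, then an
  arbitrary element of the first span.\<close>

lemma subring_Span_mult:
  assumes B: "set Bs \<subseteq> carrier R" and C: "set Cs \<subseteq> carrier R"
    and "x \<in> Span S Bs" "y \<in> Span S Cs"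
  shows "x \<otimes> y \<in> Span S (products Bs Cs)"
proof -
  let ?D = "products Bs Cs"
  have D: "set ?D \<subseteq> carrier R" by (rule products_carrier[OF B C])
  have b: "Span S Cs \<subseteq> {y \<in> carrier R. b \<otimes> y \<in> Span S ?D}" if b: "b \<in> set Bs" for b
  proof (rule subring_Span_least)
    have bc: "b \<in> carrier R" using b B by auto
    show "set Cs \<subseteq> {y \<in> carrier R. b \<otimes> y \<in> Span S ?D}"
    proof
      fix c assume c: "c \<in> set Cs"
      then have "b \<otimes> c \<in> set ?D" using b by (auto simp: products_def)
      then show "c \<in> {y \<in> carrier R. b \<otimes> y \<in> Span S ?D}"
        using c C subring_Span_mem[OF D] by auto
    qed
    show "\<zero> \<in> {y \<in> carrier R. b \<otimes> y \<in> Span S ?D}"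
      using bc subring_Span_zero[OF D] by simp
    show "u \<oplus> v \<in> {y \<in> carrier R. b \<otimes> y \<in> Span S ?D}"
      if "u \<in> {y \<in> carrier R. b \<otimes> y \<in> Span S ?D}" "v \<in> {y \<in> carrier R. b \<otimes> y \<in> Span S ?D}" for u v
      using that bc subring_Span_add[OF D] by (simp add: r_distr)
    show "k \<otimes> u \<in> {y \<in> carrier R. b \<otimes> y \<in> Span S ?D}"
      if k: "k \<in> S" and u: "u \<in> {y \<in> carrier R. b \<otimes> y \<in> Span S ?D}" for k u
      using u bc S_carrier[OF k] subring_Span_smult[OF D k, of "b \<otimes> u"] by (simp add: m_lcomm)
  qed
  have "Span S Bs \<subseteq> {x \<in> carrier R. \<forall>y\<in>Span S Cs. x \<otimes> y \<in> Span S ?D}"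
  proof (rule subring_Span_least)
    show "set Bs \<subseteq> {x \<in> carrier R. \<forall>y\<in>Span S Cs. x \<otimes> y \<in> Span S ?D}"
      using b B by auto
    show "\<zero> \<in> {x \<in> carrier R. \<forall>y\<in>Span S Cs. x \<otimes> y \<in> Span S ?D}"
      using subring_Span_zero[OF D] subring_Span_carrier[OF C] by simp
    show "u \<oplus> v \<in> {x \<in> carrier R. \<forall>y\<in>Span S Cs. x \<otimes> y \<in> Span S ?D}"
      if "u \<in> {x \<in> carrier R. \<forall>y\<in>Span S Cs. x \<otimes> y \<in> Span S ?D}"
        "v \<in> {x \<in> carrier R. \<forall>y\<in>Span S Cs. x \<otimes> y \<in> Span S ?D}" for u v
      using that subring_Span_add[OF D] subring_Span_carrier[OF C] by (simp add: l_distr)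
    show "k \<otimes> u \<in> {x \<in> carrier R. \<forall>y\<in>Span S Cs. x \<otimes> y \<in> Span S ?D}"
      if k: "k \<in> S" and u: "u \<in> {x \<in> carrier R. \<forall>y\<in>Span S Cs. x \<otimes> y \<in> Span S ?D}" for k u
      using u S_carrier[OF k] subring_Span_smult[OF D k] subring_Span_carrier[OF C]
      by (simp add: m_assoc)
  qed
  then show ?thesis using assms(3,4) by blast
qed

text \<open>The lists may start with zeros, unlike elements of a polynomial ring, so fixing the
  length n only says that the degree is below n.\<close>

lemma Span_pows:
  "y \<in> Span S (pows x n) \<longleftrightarrow> (\<exists>l. length l = n \<and> set l \<subseteq> S \<and> y = eval l x)"
proof (induction n arbitrary: y)
  case 0
  then show ?case by (simp add: pows_def Span_Nil)
next
  case (Suc n)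
  have "y \<in> Span S (pows x (Suc n)) \<longleftrightarrow> (\<exists>k\<in>S. \<exists>v\<in>Span S (pows x n). y = k \<otimes> x [^] n \<oplus> v)"
    by (simp add: pows_def Span_Cons_iff)
  also have "\<dots> \<longleftrightarrow> (\<exists>k\<in>S. \<exists>l. length l = n \<and> set l \<subseteq> S \<and> y = eval (k # l) x)"
    using Suc by (auto simp: Bex_def)
  also have "\<dots> \<longleftrightarrow> (\<exists>l. length l = Suc n \<and> set l \<subseteq> S \<and> y = eval l x)"
  proof (intro iffI)
    assume "\<exists>k\<in>S. \<exists>l. length l = n \<and> set l \<subseteq> S \<and> y = eval (k # l) x"
    then obtain k l where "k \<in> S" "length l = n" "set l \<subseteq> S" "y = eval (k # l) x" by blast
    then show "\<exists>l. length l = Suc n \<and> set l \<subseteq> S \<and> y = eval l x"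
      by (intro exI[of _ "k # l"]) auto
  next
    assume "\<exists>l. length l = Suc n \<and> set l \<subseteq> S \<and> y = eval l x"
    then obtain k l where "length (k # l) = Suc n" "set (k # l) \<subseteq> S" "y = eval (k # l) x"
      by (metis Suc_length_conv)
    then show "\<exists>k\<in>S. \<exists>l. length l = n \<and> set l \<subseteq> S \<and> y = eval (k # l) x"
      by (intro bexI[of _ k] exI[of _ l]) auto
  qed
  finally show ?case .
qed

end

end

section \<open>Integral elements over the \<open>p\<close>-adic integers\<close>

context padic_prime
begin

abbreviation OL where "OL \<equiv> ring_of_integers L Q av (carrier L)"

lemmas A_Span_carrier = subring_Span_carrier[OF A_subring]
lemmas A_Span_zero = subring_Span_zero[OF A_subring]
lemmas A_Span_mem = subring_Span_mem[OF A_subring]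
lemmas A_Span_add = subring_Span_add[OF A_subring]
lemmas A_Span_smult = subring_Span_smult[OF A_subring]
lemmas A_Span_neg = subring_Span_neg[OF A_subring]
lemmas A_Span_mono = subring_Span_mono[OF A_subring]
lemmas A_Span_mult = subring_Span_mult[OF A_subring]

text \<open>A monic equation is solved for its top power. This form of integrality speaks of spans
  only and replaces polynomials in most later arguments.\<close>

lemma OL_iff: "x \<in> OL \<longleftrightarrow> x \<in> carrier L \<and> (\<exists>n. x [^] n \<in> Span A (pows x n))"
proof
  assume "x \<in> OL"
  then obtain f where x: "x \<in> carrier L" and f: "f \<in> carrier (A[X])" "f \<noteq> []"
      "hd f = \<one>" "eval f x = \<zero>"
    by (auto simp: integral_closure_def)
  then obtain l where l: "f = \<one> # l" by (cases f) auto
  have lA: "set l \<subseteq> A"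
    using f(1) unfolding univ_poly_carrier[symmetric] polynomial_def l by auto
  have "eval l x \<in> Span A (pows x (length l))"
    unfolding Span_pows[OF A_subring] using lA by blast
  then have e: "\<ominus> eval l x \<in> Span A (pows x (length l))" "eval l x \<in> carrier L"
    using A_Span_neg[OF pows_carrier[OF x]] A_Span_carrier[OF pows_carrier[OF x]] by auto
  have "x [^] length l \<oplus> eval l x = \<zero>" using f(4) x by (simp add: l)
  then have "x [^] length l = \<ominus> eval l x" using x e(2) minus_equality[of _ "eval l x"] by simp
  then show "x \<in> carrier L \<and> (\<exists>n. x [^] n \<in> Span A (pows x n))" using e(1) x by metis
next
  assume *: "x \<in> carrier L \<and> (\<exists>n. x [^] n \<in> Span A (pows x n))"
  then obtain n where x: "x \<in> carrier L" and n: "x [^] n \<in> Span A (pows x n)" by blast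
  have "\<ominus> (x [^] n) \<in> Span A (pows x n)"
    using A_Span_neg pows_carrier[OF x] n by auto
  then obtain l where l: "length l = n" "set l \<subseteq> A" "\<ominus> (x [^] n) = eval l x"
    unfolding Span_pows[OF A_subring] by blast
  have "\<one> # l \<in> carrier (A[X])"
    unfolding univ_poly_carrier[symmetric] polynomial_def using l A_closed(2) by auto
  moreover have "eval (\<one> # l) x = \<zero>"
    using l x by (simp add: l(3)[symmetric] r_neg)
  ultimately show "x \<in> OL"
    unfolding integral_closure_def using x by (auto intro!: bexI[of _ "\<one> # l"])
qed

lemma OL_carrier: "x \<in> OL \<Longrightarrow> x \<in> carrier L"
  by (simp add: OL_iff)

text \<open>Noetherianity of finitely generated modules over a discrete valuation ring, phrased for
  sequences: split off a generator after subtracting multiples of a term whose coefficient divides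
  all others.\<close>

lemma Span_eventually_dependent:
  fixes v :: "nat \<Rightarrow> 'a"
  assumes "set Bs \<subseteq> carrier L" and "\<And>i. v i \<in> Span A Bs"
  shows "\<exists>n. v n \<in> Span A (map v (rev [0..<n]))"
  using assms
proof (induction Bs arbitrary: v)
  case Nil
  then show ?case by (intro exI[of _ 0]) (simp add: Span_Nil)
next
  case (Cons b Bs)
  have vc: "v i \<in> carrier L" for i using A_Span_carrier Cons.prems by blast
  have bc: "b \<in> carrier L" using Cons.prems by simp
  have "\<forall>j. \<exists>k w. k \<in> A \<and> w \<in> Span A Bs \<and> v j = k \<otimes> b \<oplus> w"
    using Cons.prems(2) unfolding Span_Cons_iff by blast
  then obtain a w where aw: "\<And>j. a j \<in> A" "\<And>j. w j \<in> Span A Bs" "\<And>j. v j = a j \<otimes> b \<oplus> w j"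
    by metis
  have awc: "a j \<in> carrier L" "w j \<in> carrier L" for j
    using aw A_carrier A_Span_carrier[of Bs] Cons.prems(1) by auto
  obtain i where "\<forall>j. \<exists>c\<in>A. a j = c \<otimes> a i" using A_common_divisor[of a] aw(1) by blast
  then obtain c where c: "\<And>j. c j \<in> A" "\<And>j. a j = c j \<otimes> a i" by metis
  \<comment> \<open>Subtracting the multiple of the pivot \<open>v i\<close> removes the
    b-component. The shift past i makes \<open>v i\<close> one of the earlier terms when the
    relation is read back for v.\<close>
  define v' where "v' j = v (Suc (i + j)) \<ominus> c (Suc (i + j)) \<otimes> v i" for j
  have "v' j \<in> Span A Bs" for j
  proof -
    let ?j = "Suc (i + j)"
    have cc: "c ?j \<in> carrier L" using c A_carrier by blast
    have "v' j = w ?j \<oplus> (\<ominus> c ?j) \<otimes> w i"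
      unfolding v'_def aw(3) c(2)[of ?j] using cc awc[of ?j] awc[of i] bc by algebra
    then show ?thesis
      using A_Span_add A_Span_smult aw(2) A_closed(3) c(1) Cons.prems(1) by auto
  qed
  then obtain n where n: "v' n \<in> Span A (map v' (rev [0..<n]))"
    using Cons.IH[of v'] Cons.prems(1) by auto
  let ?V = "map v (rev [0..<Suc (i + n)])"
  have V: "set ?V \<subseteq> carrier L" using vc by auto
  have vi: "v j \<in> Span A ?V" if "j \<le> i + n" for j
  proof -
    have "v j \<in> set ?V" using that unfolding set_map set_rev by (intro imageI) auto
    then show ?thesis by (rule A_Span_mem[OF V])
  qed
  have "v' j \<in> Span A ?V" if "j < n" for j
  proof -
    have cc: "c (Suc (i + j)) \<in> carrier L" using c A_carrier by blast
    have "v' j = v (Suc (i + j)) \<oplus> (\<ominus> c (Suc (i + j))) \<otimes> v i"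
      unfolding v'_def using cc vc[of i] vc[of "Suc (i + j)"] by algebra
    moreover have "v (Suc (i + j)) \<in> Span A ?V" "v i \<in> Span A ?V" using vi that by auto
    ultimately show ?thesis
      using A_Span_add[OF V] A_Span_smult[OF V A_closed(3)[OF c(1)]] by simp
  qed
  then have "set (map v' (rev [0..<n])) \<subseteq> Span A ?V" by auto
  then have *: "v' n \<in> Span A ?V" using A_Span_mono[OF V] n by blast
  have cc: "c (Suc (i + n)) \<in> carrier L" using c A_carrier by blast
  have "v (Suc (i + n)) = v' n \<oplus> c (Suc (i + n)) \<otimes> v i"
    unfolding v'_def using cc vc[of i] vc[of "Suc (i + n)"] by algebra
  then have "v (Suc (i + n)) \<in> Span A ?V"
    using A_Span_add[OF V *] A_Span_smult[OF V c(1) vi[of i]] by simp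
  then show ?case by blast
qed

text \<open>Applied to the sequence of powers, eventual dependence says that some power is a
  combination of lower ones, which is a monic relation.\<close>

lemma OL_if_powers_in_Span:
  assumes "x \<in> carrier L" "set Bs \<subseteq> carrier L" "\<And>i::nat. x [^] i \<in> Span A Bs"
  shows "x \<in> OL"
proof -
  have "\<exists>n. x [^] n \<in> Span A (pows x n)"
    unfolding pows_def by (rule Span_eventually_dependent[OF assms(2)]) (rule assms(3))
  then show ?thesis using assms(1) unfolding OL_iff by blast
qed

text \<open>The span is A[x], generated by the powers below the degree of a monic relation; it is
  closed under multiplication because x times the top generator is given by that relation.\<close>

lemma OL_order:
  assumes "x \<in> OL"
  obtains Bs where "set Bs \<subseteq> carrier L" "subring (Span A Bs) L" "x \<in> Span A Bs"
    "A \<subseteq> Span A Bs" "Span A Bs \<subseteq> OL"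
proof -
  obtain n where x: "x \<in> carrier L" and n: "x [^] n \<in> Span A (pows x n)"
    using assms by (auto simp: OL_iff)
  let ?B = "pows x n"
  have B: "set ?B \<subseteq> carrier L" by (rule pows_carrier[OF x])
  \<comment> \<open>For n = 0 the relation would read 1 = 0.\<close>
  have n0: "n > 0"
  proof (rule ccontr)
    assume "\<not> n > 0"
    then show False using n by (simp add: pows_def Span_Nil)
  qed
  have mem: "x [^] i \<in> Span A ?B" if "i < n" for i
    using A_Span_mem[OF B] that by (auto simp: pows_def)
  have "Span A ?B \<subseteq> {y \<in> carrier L. x \<otimes> y \<in> Span A ?B}"
  proof (rule subring_Span_least[OF A_subring])
    have "x \<otimes> x [^] i \<in> Span A ?B" if "i < n" for i
      using mem[of "Suc i"] n that x by (cases "Suc i = n") (auto simp: m_comm)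
    then show "set ?B \<subseteq> {y \<in> carrier L. x \<otimes> y \<in> Span A ?B}"
      using x by (auto simp: pows_def)
  qed (use A_Span_zero[OF B] A_Span_add[OF B] A_Span_smult[OF B] x A_carrier in
      \<open>auto simp: r_distr m_lcomm[of x]\<close>)
  then have xm: "x \<otimes> y \<in> Span A ?B" if "y \<in> Span A ?B" for y using that by blast
  have pm: "x [^] i \<otimes> y \<in> Span A ?B" if "y \<in> Span A ?B" for i :: nat and y
  proof (induction i)
    case 0
    then show ?case using that A_Span_carrier[OF B that] by simp
  next
    case (Suc i)
    then show ?case
      using xm[OF Suc] x A_Span_carrier[OF B that] by (simp add: m_ac)
  qed
  have "Span A ?B \<subseteq> {z \<in> carrier L. \<forall>y\<in>Span A ?B. z \<otimes> y \<in> Span A ?B}"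
  proof (rule subring_Span_least[OF A_subring])
    show "set ?B \<subseteq> {z \<in> carrier L. \<forall>y\<in>Span A ?B. z \<otimes> y \<in> Span A ?B}"
      using pm x by (auto simp: pows_def)
  qed (use A_Span_zero[OF B] A_Span_add[OF B] A_Span_smult[OF B] A_carrier A_Span_carrier[OF B] in
      \<open>auto simp: l_distr m_assoc\<close>)
  then have mm: "z \<otimes> y \<in> Span A ?B" if "z \<in> Span A ?B" "y \<in> Span A ?B" for y z
    using that by blast
  have one: "\<one> \<in> Span A ?B" using mem[of 0] n0 by simp
  have sub: "subring (Span A ?B) L"
    by (rule subringI) (use A_Span_carrier[OF B] one A_Span_neg[OF B] mm A_Span_add[OF B] in auto)
  moreover have "x \<in> Span A ?B" using xm[OF one] x by simp
  moreover have "A \<subseteq> Span A ?B"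
  proof
    fix a assume "a \<in> A"
    then show "a \<in> Span A ?B" using A_Span_smult[OF B _ one, of a] A_carrier by simp
  qed
  moreover have "Span A ?B \<subseteq> OL"
    using OL_if_powers_in_Span[OF A_Span_carrier[OF B] B subring_pow[OF sub]] by blast
  ultimately show ?thesis using that B by blast
qed

lemma A_subset_OL: "A \<subseteq> OL"
proof
  fix a assume a: "a \<in> A"
  have "\<And>i::nat. a [^] i \<in> Span A [\<one>]"
    using subring_pow[OF A_subring a] A_carrier by (auto simp: Span_Cons_iff Span_Nil)
  then show "a \<in> OL" using OL_if_powers_in_Span[of a "[\<one>]"] A_carrier[OF a] by simp
qed

lemma OL_subring: "subring OL L"
proof -
  have mult_add: "x \<otimes> y \<in> OL \<and> x \<oplus> y \<in> OL" if x: "x \<in> OL" and y: "y \<in> OL" for x y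
  proof -
    obtain Bs where B: "set Bs \<subseteq> carrier L" "subring (Span A Bs) L" "x \<in> Span A Bs"
      using OL_order[OF x] by metis
    obtain Cs where C: "set Cs \<subseteq> carrier L" "subring (Span A Cs) L" "y \<in> Span A Cs"
      using OL_order[OF y] by metis
    let ?D = "products Bs Cs"
    have D: "set ?D \<subseteq> carrier L" by (rule products_carrier[OF B(1) C(1)])
    have c: "x \<in> carrier L" "y \<in> carrier L" using x y OL_carrier by auto
    have m: "x [^] i \<otimes> y [^] j \<in> Span A ?D" for i j :: nat
      using A_Span_mult[OF B(1) C(1)] subring_pow[OF B(2,3)] subring_pow[OF C(2,3)] by blast
    have "(x \<otimes> y) [^] i \<in> Span A ?D" for i :: nat
      using m[of i i] c by (simp add: nat_pow_distrib)
    \<comment> \<open>The extra monomial factor makes the induction on i close: each factor x + y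
      raises one of the two exponents.\<close>
    moreover have "(x \<oplus> y) [^] i \<otimes> (x [^] a \<otimes> y [^] b) \<in> Span A ?D" for i a b :: nat
    proof (induction i arbitrary: a b)
      case 0
      then show ?case using m c by simp
    next
      case (Suc i)
      have "(x \<oplus> y) [^] Suc i \<otimes> (x [^] a \<otimes> y [^] b)
          = (x \<oplus> y) [^] i \<otimes> (x [^] Suc a \<otimes> y [^] b) \<oplus> (x \<oplus> y) [^] i \<otimes> (x [^] a \<otimes> y [^] Suc b)"
        using c by (simp add: l_distr r_distr m_ac)
      then show ?case using Suc[of "Suc a" b] Suc[of a "Suc b"] A_Span_add[OF D] by simp
    qed
    from this[of _ 0 0] have "(x \<oplus> y) [^] i \<in> Span A ?D" for i :: nat using c by simp
    ultimately show ?thesis using OL_if_powers_in_Span[OF _ D] c by blast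
  qed
  have one: "\<one> \<in> OL" "\<ominus> \<one> \<in> OL" using A_subset_OL A_closed by auto
  show ?thesis
  proof (rule subringI)
    fix x assume x: "x \<in> OL"
    have "\<ominus> x = (\<ominus> \<one>) \<otimes> x" using OL_carrier[OF x] by (simp add: l_minus)
    then show "\<ominus> x \<in> OL" using mult_add[OF one(2) x] by simp
  qed (use mult_add one OL_carrier in auto)
qed

lemmas OL_closed = subringE(2,3,5,6,7)[OF OL_subring]

lemma OL_minus: "x \<in> OL \<Longrightarrow> y \<in> OL \<Longrightarrow> x \<ominus> y \<in> OL"
  by (rule subring_minus[OF OL_subring])

lemma P_OL: "P \<in> OL"
  by (rule subring_of_integer[OF OL_subring])

text \<open>Coordinate by coordinate from \<open>A_series\<close>. The generators may be dependent,
  as any choice of coordinates of the terms will do.\<close>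

lemma Span_series:
  fixes t :: "nat \<Rightarrow> 'a"
  assumes "set Bs \<subseteq> carrier L" and "\<And>j. t j \<in> Span A Bs"
  shows "\<exists>T. \<forall>j. T j \<in> Span A Bs \<and> T j = t j \<oplus> P \<otimes> T (Suc j)"
  using assms
proof (induction Bs arbitrary: t)
  case Nil
  then show ?case by (intro exI[of _ "\<lambda>_. \<zero>"]) (simp add: Span_Nil)
next
  case (Cons b Bs)
  have bc: "b \<in> carrier L" using Cons.prems by simp
  have "\<forall>j. \<exists>k w. k \<in> A \<and> w \<in> Span A Bs \<and> t j = k \<otimes> b \<oplus> w"
    using Cons.prems(2) unfolding Span_Cons_iff by blast
  then obtain a w where aw: "\<And>j. a j \<in> A" "\<And>j. w j \<in> Span A Bs" "\<And>j. t j = a j \<otimes> b \<oplus> w j"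
    by metis
  obtain Z where Z: "\<And>j. Z j \<in> A" "\<And>j. Z j = a j \<oplus> P \<otimes> Z (Suc j)"
    using A_series[of a] aw(1) by blast
  have "\<exists>T. \<forall>j. T j \<in> Span A Bs \<and> T j = w j \<oplus> P \<otimes> T (Suc j)"
    by (rule Cons.IH) (use Cons.prems(1) aw(2) in auto)
  then obtain Y where Y: "\<And>j. Y j \<in> Span A Bs" "\<And>j. Y j = w j \<oplus> P \<otimes> Y (Suc j)"
    by blast
  show ?case
  proof (intro exI[of _ "\<lambda>j. Z j \<otimes> b \<oplus> Y j"] allI conjI)
    fix j
    show "Z j \<otimes> b \<oplus> Y j \<in> Span A (b # Bs)" using Z(1) Y(1) unfolding Span_Cons_iff by blast
    have c: "a j \<in> carrier L" "Z (Suc j) \<in> carrier L" "w j \<in> carrier L" "Y (Suc j) \<in> carrier L"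
      using aw Z(1) Y(1) A_carrier A_Span_carrier[of Bs] Cons.prems(1) by auto
    show "Z j \<otimes> b \<oplus> Y j = t j \<oplus> P \<otimes> (Z (Suc j) \<otimes> b \<oplus> Y (Suc j))"
      unfolding Z(2)[of j] Y(2)[of j] aw(3) using c bc of_integer_closed[of "int p"] by algebra
  qed
qed

text \<open>Modulo \<open>P\<close> each coordinate can be taken from p values, so an order has a
  finite quotient by \<open>P\<close>. This finiteness drives the pigeonhole arguments
  below.\<close>

lemma Span_residues_finite:
  assumes "set Bs \<subseteq> carrier L"
  shows "\<exists>C. finite C \<and> C \<subseteq> carrier L \<and> (\<forall>y\<in>Span A Bs. \<exists>c\<in>C. \<exists>r\<in>Span A Bs. y = c \<oplus> P \<otimes> r)"
  using assms
proof (induction Bs)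
  case Nil
  then show ?case by (intro exI[of _ "{\<zero>}"]) (simp add: Span_Nil)
next
  case (Cons b Bs)
  have bc: "b \<in> carrier L" using Cons.prems by simp
  obtain C where C: "finite C" "C \<subseteq> carrier L" "\<And>y. y \<in> Span A Bs \<Longrightarrow> \<exists>c\<in>C. \<exists>r\<in>Span A Bs. y = c \<oplus> P \<otimes> r"
    using Cons by auto
  let ?D = "(\<lambda>(k, c). \<iota> (int k) \<otimes> b \<oplus> c) ` ({..<p} \<times> C)"
  have "\<exists>c\<in>?D. \<exists>r\<in>Span A (b # Bs). y = c \<oplus> P \<otimes> r" if "y \<in> Span A (b # Bs)" for y
  proof -
    obtain a v where y: "a \<in> A" "v \<in> Span A Bs" "y = a \<otimes> b \<oplus> v"
      using \<open>y \<in> Span A (b # Bs)\<close> unfolding Span_Cons_iff by blast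
    obtain k d where k: "k < p" "d \<in> A" "a = \<iota> (int k) \<oplus> P \<otimes> d" using A_residue[OF y(1)] by blast
    obtain c r where c: "c \<in> C" "r \<in> Span A Bs" "v = c \<oplus> P \<otimes> r" using C(3)[OF y(2)] by blast
    have cr: "d \<in> carrier L" "c \<in> carrier L" "r \<in> carrier L"
      using k c C(2) A_carrier A_Span_carrier[of Bs] Cons.prems by auto
    have "y = (\<iota> (int k) \<otimes> b \<oplus> c) \<oplus> P \<otimes> (d \<otimes> b \<oplus> r)"
      unfolding y(3) k(3) c(3) using cr bc of_integer_closed[of "int p"] of_integer_closed[of "int k"]
      by algebra
    moreover have "d \<otimes> b \<oplus> r \<in> Span A (b # Bs)" using k c unfolding Span_Cons_iff by blast
    moreover have "\<iota> (int k) \<otimes> b \<oplus> c \<in> ?D" using k c by force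
    ultimately show ?thesis by blast
  qed
  moreover have "finite ?D" "?D \<subseteq> carrier L" using C bc by auto
  ultimately show ?case by blast
qed

end

section \<open>The ring of integers is local\<close>

context cring
begin

lemma nonunits_iff: "subring S R \<Longrightarrow> x \<in> nonunits R S \<longleftrightarrow> x \<in> S \<and> \<not> (\<exists>y\<in>S. x \<otimes> y = \<one>)"
  using m_comm subringE(1)[of S R] unfolding nonunits_def Units_def by auto (metis subsetD)

lemma eval_subring: "subring S R \<Longrightarrow> set l \<subseteq> S \<Longrightarrow> x \<in> S \<Longrightarrow> eval l x \<in> S"
  by (induction l) (auto simp: subringE subring_pow)

text \<open>The cofactor is the geometric sum of the powers of x below n.\<close>

lemma one_minus_pow_factor:
  assumes S: "subring S R" and x: "x \<in> S"
  shows "\<exists>s\<in>S. \<one> \<ominus> x [^] (n::nat) = (\<one> \<ominus> x) \<otimes> s"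
proof (induction n)
  case 0
  then show ?case
    using subringE(1,2)[OF S] x by (intro bexI[of _ \<zero>]) (auto simp: a_minus_def r_neg)
next
  case (Suc n)
  then obtain s where s: "s \<in> S" "\<one> \<ominus> x [^] n = (\<one> \<ominus> x) \<otimes> s" by blast
  have c: "x \<in> carrier R" "x [^] n \<in> carrier R" "s \<in> carrier R" using x s subringE(1)[OF S] by auto
  have "\<one> \<ominus> x [^] Suc n = (\<one> \<ominus> x [^] n) \<oplus> (\<one> \<ominus> x) \<otimes> x [^] n"
    unfolding nat_pow_Suc using c by algebra
  also have "\<dots> = (\<one> \<ominus> x) \<otimes> (s \<oplus> x [^] n)"
    unfolding s using c by algebra
  finally show ?case using subringE(7)[OF S s(1) subring_pow[OF S x]] by blast
qed

text \<open>The congruence is raised to the p-th power again and again: the correction term has a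
  p-th power that is still a multiple of p.\<close>

lemma frobenius_add_iterated:
  assumes p: "Factorial_Ring.prime (p::nat)" and S: "subring S R" and a: "a \<in> S" and b: "b \<in> S"
  shows "\<exists>s\<in>S. (a \<oplus> b) [^] (p ^ i) = a [^] (p ^ i) \<oplus> b [^] (p ^ i) \<oplus> \<iota> (int p) \<otimes> s"
proof (induction i)
  case 0
  have "a \<in> carrier R" "b \<in> carrier R" using a b subringE(1)[OF S] by auto
  then show ?case using subringE(2)[OF S] by (intro bexI[of _ \<zero>]) auto
next
  case (Suc i)
  let ?P = "\<iota> (int p)" and ?u = "a [^] (p ^ i)" and ?v = "b [^] (p ^ i)"
  obtain s where s: "s \<in> S" "(a \<oplus> b) [^] (p ^ i) = ?u \<oplus> ?v \<oplus> ?P \<otimes> s" using Suc by blast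
  have PS: "?P \<in> S" by (rule subring_of_integer[OF S])
  have uv: "?u \<in> S" "?v \<in> S" "?P \<otimes> s \<in> S"
    using a b s PS subring_pow[OF S] subringE(6)[OF S] by auto
  obtain s1 where s1: "s1 \<in> S"
      "(?u \<oplus> ?v \<oplus> ?P \<otimes> s) [^] p = (?u \<oplus> ?v) [^] p \<oplus> (?P \<otimes> s) [^] p \<oplus> ?P \<otimes> s1"
    using frobenius_add[OF p S subringE(7)[OF S uv(1,2)] uv(3)] by blast
  obtain s2 where s2: "s2 \<in> S" "(?u \<oplus> ?v) [^] p = ?u [^] p \<oplus> ?v [^] p \<oplus> ?P \<otimes> s2"
    using frobenius_add[OF p S uv(1,2)] by blast
  obtain q where q: "p = Suc q" using prime_gt_0_nat[OF p] by (cases p) auto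
  define s3 where "s3 = (?P \<otimes> s) [^] q \<otimes> s"
  have s3: "s3 \<in> S" "(?P \<otimes> s) [^] p = ?P \<otimes> s3"
  proof -
    show "s3 \<in> S" using uv s subring_pow[OF S] subringE(6)[OF S] by (simp add: s3_def)
    have "s \<in> carrier R" using s(1) subringE(1)[OF S] by auto
    then show "(?P \<otimes> s) [^] p = ?P \<otimes> s3"
      by (subst q) (simp add: s3_def m_ac)
  qed
  have c: "a \<in> carrier R" "b \<in> carrier R" "s1 \<in> carrier R" "s2 \<in> carrier R" "s3 \<in> carrier R"
    using a b s1 s2 s3 subringE(1)[OF S] by auto
  have "(a \<oplus> b) [^] (p ^ Suc i) = ((a \<oplus> b) [^] (p ^ i)) [^] p"
    using c by (simp add: nat_pow_pow mult.commute)
  also have "\<dots> = ?u [^] p \<oplus> ?v [^] p \<oplus> ?P \<otimes> (s2 \<oplus> s3 \<oplus> s1)"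
    unfolding s s1(2) s2(2) s3(2) using c by (simp add: r_distr a_ac)
  also have "?u [^] p = a [^] (p ^ Suc i)" using c by (simp add: nat_pow_pow mult.commute)
  also have "?v [^] p = b [^] (p ^ Suc i)" using c by (simp add: nat_pow_pow mult.commute)
  finally show ?case using s1 s2 s3 subringE(7)[OF S] by blast
qed

end

context padic_prime
begin

text \<open>Only the set of nonunits so far; closure under addition is \<open>\<mm>_add\<close> and
  rests on the locality proved in between.\<close>

abbreviation \<mm> (\<open>\<mm>\<close>) where "\<mm> \<equiv> nonunits L OL"

text \<open>Multiplying a monic relation of degree n for y = 1/P by \<open>P [^] n\<close> exhibits
  1 as a multiple of \<open>P\<close> in \<open>A\<close>, which contradicts the absolute
  values.\<close>

lemma inv_P_not_OL: "y \<in> OL \<Longrightarrow> P \<otimes> y \<noteq> \<one>"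
proof
  assume y: "y \<in> OL" and Py: "P \<otimes> y = \<one>"
  then obtain n where n: "y [^] n \<in> Span A (pows y n)" and yc: "y \<in> carrier L"
    by (auto simp: OL_iff)
  have PA: "P [^] i \<in> A" for i :: nat by (intro subring_pow[OF A_subring] subring_of_integer[OF A_subring])
  have Pp: "P [^] i \<otimes> y [^] i = \<one>" for i :: nat
    using Py yc by (simp add: nat_pow_distrib[symmetric])
  have "Span A (pows y n) \<subseteq> {z \<in> carrier L. \<exists>a\<in>A. P [^] n \<otimes> z = P \<otimes> a}"
  proof (rule subring_Span_least[OF A_subring])
    have "\<exists>a\<in>A. P [^] n \<otimes> y [^] i = P \<otimes> a" if i: "i < n" for i
    proof -
      obtain k where k: "n = Suc (k + i)" using i by (metis add.commute less_imp_Suc_add)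
      have "P [^] n \<otimes> y [^] i = P \<otimes> P [^] k \<otimes> (P [^] i \<otimes> y [^] i)"
        using yc unfolding k by (simp add: nat_pow_mult[symmetric] m_ac)
      then show ?thesis using PA[of k] by (auto simp: Pp)
    qed
    then show "set (pows y n) \<subseteq> {z \<in> carrier L. \<exists>a\<in>A. P [^] n \<otimes> z = P \<otimes> a}"
      using yc by (auto simp: pows_def)
    show "\<zero> \<in> {z \<in> carrier L. \<exists>a\<in>A. P [^] n \<otimes> z = P \<otimes> a}"
      using A_closed(1) by (auto intro!: bexI[of _ \<zero>])
  next
    fix u v assume "u \<in> {z \<in> carrier L. \<exists>a\<in>A. P [^] n \<otimes> z = P \<otimes> a}"
      "v \<in> {z \<in> carrier L. \<exists>a\<in>A. P [^] n \<otimes> z = P \<otimes> a}"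
    then obtain a b where "a \<in> A" "b \<in> A" "P [^] n \<otimes> u = P \<otimes> a" "P [^] n \<otimes> v = P \<otimes> b"
      "u \<in> carrier L" "v \<in> carrier L" by blast
    then show "u \<oplus> v \<in> {z \<in> carrier L. \<exists>a\<in>A. P [^] n \<otimes> z = P \<otimes> a}"
      using A_carrier A_closed(5) by (auto simp: r_distr intro!: bexI[of _ "a \<oplus> b"])
  next
    fix k u assume k: "k \<in> A" and "u \<in> {z \<in> carrier L. \<exists>a\<in>A. P [^] n \<otimes> z = P \<otimes> a}"
    then obtain a where a: "a \<in> A" "P [^] n \<otimes> u = P \<otimes> a" "u \<in> carrier L" by blast
    have "P [^] n \<otimes> (k \<otimes> u) = P \<otimes> (k \<otimes> a)"
      using a A_carrier k by (metis m_lcomm of_integer_closed nat_pow_closed)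
    then show "k \<otimes> u \<in> {z \<in> carrier L. \<exists>a\<in>A. P [^] n \<otimes> z = P \<otimes> a}"
      using a k A_carrier A_closed(4)[OF k a(1)] by auto
  qed
  then obtain a where a: "a \<in> A" "P [^] n \<otimes> y [^] n = P \<otimes> a" using n by blast
  then have "1 = 1 / real p * av a"
    using av_mult[OF Q_int, of a "int p"] by (simp add: Pp A_iff)
  moreover have "1 / real p * av a \<le> 1 / real p"
    using a p_ge_2 by (simp add: A_iff divide_right_mono)
  ultimately show False using p_ge_2 by (simp add: field_simps)
qed

text \<open>Substitute for the norm: the constant coefficient of a monic relation is a multiple of
  y. Vanishing constant coefficients are first removed by cancelling y in the domain
  \<open>L\<close>.\<close>

lemma OL_divides_A:
  assumes y: "y \<in> OL" "y \<noteq> \<zero>"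
  shows "\<exists>a\<in>A. a \<noteq> \<zero> \<and> (\<exists>w\<in>OL. a = y \<otimes> w)"
proof -
  have yc: "y \<in> carrier L" using OL_carrier[OF y(1)] .
  obtain f where f: "f \<in> carrier (A[X])" "f \<noteq> []" "hd f = \<one>" "eval f y = \<zero>"
    using y(1) by (auto simp: integral_closure_def)
  then obtain l where l: "f = \<one> # l" by (cases f) auto
  have "set l \<subseteq> A" "eval (\<one> # l) y = \<zero>"
    using f unfolding univ_poly_carrier[symmetric] polynomial_def l by auto
  then show ?thesis
  proof (induction l rule: rev_induct)
    case Nil
    then show ?case using yc by simp
  next
    case (snoc c l)
    have c: "c \<in> A" and lA: "set l \<subseteq> A" using snoc.prems by auto
    let ?e = "eval (\<one> # l) y"
    have eO: "?e \<in> OL"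
      using lA A_subset_OL OL_closed(2) y(1) by (intro eval_subring[OF OL_subring]) auto
    have ec: "?e \<in> carrier L" "c \<in> carrier L" using eO OL_carrier c A_carrier by auto
    have "set (\<one> # l) \<subseteq> carrier L" using lA A_carrier by auto
    then have *: "?e \<otimes> y \<oplus> c = \<zero>"
      using eval_append_aux[of "\<one> # l" c y] ec yc snoc.prems(2) by simp
    show ?case
    proof (cases "c = \<zero>")
      case True
      then have "?e = \<zero>" using * ec yc y(2) integral[of ?e y] by auto
      then show ?thesis using snoc.IH[OF lA] by blast
    next
      case False
      have "c = \<ominus> (?e \<otimes> y)" using * ec yc by (intro minus_equality[symmetric]) (simp_all add: a_comm)
      then have "c = y \<otimes> (\<ominus> ?e)" using ec yc by (simp add: r_minus m_comm)
      then show ?thesis using False c OL_closed(3)[OF eO] by blast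
    qed
  qed
qed

text \<open>Some \<open>P [^] n\<close> is a multiple of y in \<open>OL\<close>, so divisibility of
  y by \<open>P [^] Suc n\<close> would make \<open>P\<close> invertible. Identities between limits
  can therefore be checked modulo each power of \<open>P\<close>.\<close>

lemma OL_separated:
  assumes y: "y \<in> OL" and div: "\<And>j::nat. \<exists>r\<in>OL. y = P [^] j \<otimes> r"
  shows "y = \<zero>"
proof (rule ccontr)
  assume y0: "y \<noteq> \<zero>"
  obtain a w where a: "a \<in> A" "a \<noteq> \<zero>" "w \<in> OL" "a = y \<otimes> w" using OL_divides_A[OF y y0] by blast
  obtain n d where d: "d \<in> A" "P [^] (n::nat) = d \<otimes> a" using A_P_power[OF a(1,2)] by blast
  obtain r where r: "r \<in> OL" "y = P [^] Suc n \<otimes> r" using div by blast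
  have c: "d \<in> carrier L" "w \<in> carrier L" "r \<in> carrier L" using d a r A_carrier OL_carrier by auto
  have "P [^] n \<otimes> \<one> = d \<otimes> (P [^] Suc n \<otimes> r \<otimes> w)" using d a r by simp
  also have "\<dots> = P [^] n \<otimes> (P \<otimes> (d \<otimes> r \<otimes> w))" using c by (simp add: m_ac)
  finally have "P \<otimes> (d \<otimes> r \<otimes> w) = \<one>"
    using c m_lcancel[of "P [^] n" \<one>] by (simp add: pow_nonzero[OF _ P_nonzero])
  moreover have "d \<otimes> r \<otimes> w \<in> OL" using d r a A_subset_OL OL_closed(4) by auto
  ultimately show False using inv_P_not_OL by blast
qed

lemma Span_pigeonhole:
  fixes s :: "nat \<Rightarrow> 'a"
  assumes B: "set Bs \<subseteq> carrier L" and s: "\<And>i. s i \<in> Span A Bs"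
  shows "\<exists>i j. i < j \<and> (\<exists>r\<in>Span A Bs. s i = s j \<oplus> P \<otimes> r)"
proof -
  obtain C where C: "finite C" "C \<subseteq> carrier L"
      "\<And>y. y \<in> Span A Bs \<Longrightarrow> \<exists>c\<in>C. \<exists>r\<in>Span A Bs. y = c \<oplus> P \<otimes> r"
    using Span_residues_finite[OF B] by blast
  have "\<forall>i. \<exists>c r. c \<in> C \<and> r \<in> Span A Bs \<and> s i = c \<oplus> P \<otimes> r"
    using C(3)[OF s] by blast
  then obtain c r where cr: "\<And>i. c i \<in> C" "\<And>i. r i \<in> Span A Bs" "\<And>i. s i = c i \<oplus> P \<otimes> r i"
    by metis
  have "\<not> inj c"
    using C(1) cr(1) by (meson finite_imageD finite_subset image_subsetI infinite_UNIV_nat)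
  then obtain i' j' where "i' \<noteq> j'" "c i' = c j'" by (auto simp: inj_def)
  then obtain i j where ij: "i < j" "c i = c j" by (metis linorder_neqE_nat)
  have car: "c j \<in> carrier L" "r i \<in> carrier L" "r j \<in> carrier L"
    using cr C(2) A_Span_carrier[OF B] by auto
  have "s i = s j \<oplus> P \<otimes> (r i \<oplus> (\<ominus> r j))"
    unfolding cr(3) ij(2) using car of_integer_closed[of "int p"] by algebra
  then show ?thesis
    using ij(1) A_Span_add[OF B cr(2) A_Span_neg[OF B cr(2)]] by blast
qed

section \<open>Geometric series and lifting of idempotents in an order\<close>

context
  fixes Bs
  assumes B: "set Bs \<subseteq> carrier L" and N: "subring (Span A Bs) L" and NO: "Span A Bs \<subseteq> OL"
begin

lemma order_carrier: "x \<in> Span A Bs \<Longrightarrow> x \<in> carrier L"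
  by (rule A_Span_carrier[OF B])

lemmas order_closed = subringE(2,3,5,6,7)[OF N] subring_pow[OF N] subring_minus[OF N]
  subring_of_integer[OF N]

text \<open>The inverse is the geometric series in P w, whose tails come from
  \<open>Span_series\<close>; the product is compared with 1 modulo every power of
  \<open>P\<close>.\<close>

lemma order_geometric:
  assumes w: "w \<in> Span A Bs"
  shows "\<exists>v\<in>Span A Bs. (\<one> \<ominus> P \<otimes> w) \<otimes> v = \<one>"
proof -
  obtain T where T: "\<And>j. T j \<in> Span A Bs" "\<And>j. T j = w [^] j \<oplus> P \<otimes> T (Suc j)"
    using Span_series[OF B, of "\<lambda>j. w [^] j"] order_closed(6)[OF w] by blast
  have c: "w \<in> carrier L" "P \<in> carrier L" "\<And>j. T j \<in> carrier L" using w T(1) order_carrier by auto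
  \<comment> \<open>g is the partial sum of the first j terms.\<close>
  have *: "\<exists>g\<in>Span A Bs. T 0 = g \<oplus> P [^] j \<otimes> T j \<and>
      (\<one> \<ominus> P \<otimes> w) \<otimes> g = \<one> \<ominus> P [^] j \<otimes> w [^] j" for j
  proof (induction j)
    case 0
    show ?case using order_closed(1) c by (intro bexI[of _ \<zero>]) (auto simp: a_minus_def r_neg)
  next
    case (Suc j)
    then obtain g where g: "g \<in> Span A Bs" "T 0 = g \<oplus> P [^] j \<otimes> T j"
        "(\<one> \<ominus> P \<otimes> w) \<otimes> g = \<one> \<ominus> P [^] j \<otimes> w [^] j" by blast
    have gc: "g \<in> carrier L" "P [^] j \<in> carrier L" "w [^] j \<in> carrier L"
      using g order_carrier c by auto
    have "P [^] j \<otimes> w [^] j \<in> Span A Bs"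
      by (intro order_closed w)
    have "g \<oplus> P [^] j \<otimes> w [^] j \<in> Span A Bs" by (intro order_closed w g(1))
    moreover have "T 0 = (g \<oplus> P [^] j \<otimes> w [^] j) \<oplus> P [^] Suc j \<otimes> T (Suc j)"
      unfolding g(2) T(2)[of j] nat_pow_Suc using gc c(2) c(3)[of "Suc j"] by algebra
    moreover have "(\<one> \<ominus> P \<otimes> w) \<otimes> (g \<oplus> P [^] j \<otimes> w [^] j) = \<one> \<ominus> P [^] Suc j \<otimes> w [^] Suc j"
    proof -
      have "(\<one> \<ominus> P \<otimes> w) \<otimes> (g \<oplus> P [^] j \<otimes> w [^] j)
          = (\<one> \<ominus> P \<otimes> w) \<otimes> g \<oplus> (\<one> \<ominus> P \<otimes> w) \<otimes> (P [^] j \<otimes> w [^] j)"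
        using gc c by (simp add: r_distr)
      also have "\<dots> = \<one> \<ominus> P [^] Suc j \<otimes> w [^] Suc j"
        unfolding g(3) nat_pow_Suc using gc c(1,2) by algebra
      finally show ?thesis .
    qed
    ultimately show ?case by blast
  qed
  let ?y = "(\<one> \<ominus> P \<otimes> w) \<otimes> T 0 \<ominus> \<one>"
  have "?y = \<zero>"
  proof (rule OL_separated)
    show "?y \<in> OL"
      by (rule subsetD[OF NO]) (intro order_closed w T(1))
    fix j
    obtain g where g: "g \<in> Span A Bs" "T 0 = g \<oplus> P [^] j \<otimes> T j"
        "(\<one> \<ominus> P \<otimes> w) \<otimes> g = \<one> \<ominus> P [^] j \<otimes> w [^] j" using * by blast
    have gc: "g \<in> carrier L" "P [^] j \<in> carrier L" "w [^] j \<in> carrier L"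
      using g order_carrier c by auto
    have "?y = (\<one> \<ominus> P \<otimes> w) \<otimes> g \<oplus> (\<one> \<ominus> P \<otimes> w) \<otimes> (P [^] j \<otimes> T j) \<ominus> \<one>"
      unfolding g(2) using gc c by (simp add: r_distr)
    also have "\<dots> = P [^] j \<otimes> ((\<one> \<ominus> P \<otimes> w) \<otimes> T j \<ominus> w [^] j)"
      unfolding g(3) using gc c(1,2) c(3)[of j] by algebra
    finally show "\<exists>r\<in>OL. ?y = P [^] j \<otimes> r"
      by (intro bexI[of _ "(\<one> \<ominus> P \<otimes> w) \<otimes> T j \<ominus> w [^] j"] subsetD[OF NO] order_closed w T(1))
  qed
  then have "(\<one> \<ominus> P \<otimes> w) \<otimes> T 0 = \<one>"
    using c r_right_minus_eq by simp
  then show ?thesis using T(1) by blast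
qed

text \<open>Newton iteration for \<open>X\<^sup>2 - X\<close> lifts an idempotent modulo \<open>p\<close> to an idempotent of the
  domain \<open>L\<close>, which can only be \<open>0\<close> or \<open>1\<close>.\<close>

lemma order_idempotent:
  assumes e: "e \<in> Span A Bs" and d: "d \<in> Span A Bs" "e \<otimes> e \<ominus> e = P \<otimes> d"
  shows "(\<exists>r\<in>Span A Bs. e = P \<otimes> r) \<or> (\<exists>r\<in>Span A Bs. e = \<one> \<ominus> P \<otimes> r)"
proof -
  define E where "E = rec_nat e (\<lambda>_ e. e \<oplus> (e \<otimes> e \<ominus> e) \<otimes> (\<one> \<ominus> e \<ominus> e))"
  have E0: "E 0 = e" and ES: "E (Suc j) = E j \<oplus> (E j \<otimes> E j \<ominus> E j) \<otimes> (\<one> \<ominus> E j \<ominus> E j)" for j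
    by (simp_all add: E_def)
  have EN: "E j \<in> Span A Bs" for j
    by (induction j) (use e order_closed in \<open>auto simp: E0 ES\<close>)
  have c: "P \<in> carrier L" "\<And>j. E j \<in> carrier L" using EN order_carrier by auto
  have "\<exists>d\<in>Span A Bs. E j \<otimes> E j \<ominus> E j = P [^] Suc j \<otimes> d" for j
  proof (induction j)
    case 0
    then show ?case using d by (auto simp: E0)
  next
    case (Suc j)
    let ?D = "E j \<otimes> E j \<ominus> E j" and ?f = "E j"
    \<comment> \<open>4D - 3, the cofactor in the identity by which one step turns the defect D into
      D^2 (4D - 3).\<close>
    let ?q = "?D \<oplus> ?D \<oplus> ?D \<oplus> ?D \<ominus> \<one> \<ominus> \<one> \<ominus> \<one>"
    obtain d where d: "d \<in> Span A Bs" "?D = P [^] Suc j \<otimes> d" using Suc by blast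
    have qN: "?q \<in> Span A Bs" by (intro order_closed EN)
    have dc: "d \<in> carrier L" "P [^] j \<in> carrier L" "?q \<in> carrier L" using d qN order_carrier c by auto
    have "E (Suc j) \<otimes> E (Suc j) \<ominus> E (Suc j) = ?D \<otimes> ?D \<otimes> ?q"
    proof -
      define D g where "D = ?D" and "g = \<one> \<ominus> ?f \<ominus> ?f"
      have cc: "?f \<in> carrier L" "D \<in> carrier L" "g \<in> carrier L"
        using c(2)[of j] by (auto simp: D_def g_def)
      have gg: "g \<otimes> g = \<one> \<oplus> D \<oplus> D \<oplus> D \<oplus> D"
        unfolding D_def g_def using c(2)[of j] by algebra
      have fg: "?f \<oplus> ?f \<ominus> \<one> = \<ominus> g"
        unfolding g_def using c(2)[of j] by algebra
      have "E (Suc j) \<otimes> E (Suc j) \<ominus> E (Suc j) = (?f \<oplus> D \<otimes> g) \<otimes> (?f \<oplus> D \<otimes> g) \<ominus> (?f \<oplus> D \<otimes> g)"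
        unfolding ES D_def g_def by simp
      also have "\<dots> = (?f \<otimes> ?f \<ominus> ?f) \<oplus> D \<otimes> g \<otimes> (?f \<oplus> ?f \<ominus> \<one>) \<oplus> D \<otimes> D \<otimes> (g \<otimes> g)"
        using cc by algebra
      also have "\<dots> = D \<oplus> D \<otimes> g \<otimes> (\<ominus> g) \<oplus> D \<otimes> D \<otimes> (g \<otimes> g)"
        unfolding fg by (simp add: D_def)
      also have "\<dots> = D \<ominus> D \<otimes> (g \<otimes> g) \<oplus> D \<otimes> D \<otimes> (g \<otimes> g)"
        using cc(2,3) by algebra
      also have "\<dots> = D \<otimes> D \<otimes> (D \<oplus> D \<oplus> D \<oplus> D \<ominus> \<one> \<ominus> \<one> \<ominus> \<one>)"
        unfolding gg using cc(2) r_one[OF cc(2)] by algebra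
      finally show ?thesis by (simp add: D_def)
    qed
    also have "?D \<otimes> ?D \<otimes> ?q = (P [^] Suc j \<otimes> d) \<otimes> (P [^] Suc j \<otimes> d) \<otimes> ?q"
      using d(2) by simp
    \<comment> \<open>Convergence is quadratic, but one more factor \<open>P\<close> per step is all
      that is kept.\<close>
    also have "\<dots> = P [^] Suc (Suc j) \<otimes> (P [^] j \<otimes> d \<otimes> d \<otimes> ?q)"
      unfolding nat_pow_Suc using dc c(1) by (simp add: m_ac)
    finally show ?case by (intro bexI[of _ "P [^] j \<otimes> d \<otimes> d \<otimes> ?q"] order_closed d(1) EN)
  qed
  then obtain D where D: "\<And>j. D j \<in> Span A Bs" "\<And>j. E j \<otimes> E j \<ominus> E j = P [^] Suc j \<otimes> D j" by metis
  \<comment> \<open>The increments of E are \<open>P [^] j\<close> times P u j, so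
    \<open>T 0\<close> below is the sum of all increments and F is the limit of E.\<close>
  define u where "u j = D j \<otimes> (\<one> \<ominus> E j \<ominus> E j)" for j
  have uN: "u j \<in> Span A Bs" for j unfolding u_def by (intro order_closed D(1) EN)
  obtain T where T: "\<And>j. T j \<in> Span A Bs" "\<And>j. T j = P \<otimes> u j \<oplus> P \<otimes> T (Suc j)"
    using Span_series[OF B, of "\<lambda>j. P \<otimes> u j"] order_closed(4)[OF order_closed(8) uN] by blast
  have c': "u j \<in> carrier L" "T j \<in> carrier L" "D j \<in> carrier L" for j
    using uN T(1) D(1) order_carrier by auto
  have ES': "E (Suc j) = E j \<oplus> P [^] j \<otimes> (P \<otimes> u j)" for j
    unfolding ES D(2) u_def using c c'[of j] by (simp add: m_ac)
  define F where "F = E 0 \<oplus> T 0"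
  have F: "F = E j \<oplus> P [^] j \<otimes> T j" for j
  proof (induction j)
    case 0
    then show ?case using c' by (simp add: F_def)
  next
    case (Suc j)
    have "E j \<oplus> P [^] j \<otimes> T j = E j \<oplus> P [^] j \<otimes> (P \<otimes> u j \<oplus> P \<otimes> T (Suc j))"
      using T(2)[of j] by simp
    also have "\<dots> = E (Suc j) \<oplus> P [^] Suc j \<otimes> T (Suc j)"
      unfolding ES' nat_pow_Suc
      using c(1) c(2)[of j] c'(1)[of j] c'(2)[of "Suc j"] nat_pow_closed[OF c(1), of j] by algebra
    finally show ?case using Suc by simp
  qed
  have FN: "F \<in> Span A Bs" unfolding F_def by (intro order_closed EN T(1))
  have Fc: "F \<in> carrier L" using FN order_carrier by auto
  have "F \<otimes> F \<ominus> F = \<zero>"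
  proof (rule OL_separated)
    show "F \<otimes> F \<ominus> F \<in> OL" by (rule subsetD[OF NO]) (intro order_closed FN)
    fix j
    let ?r = "P \<otimes> D j \<oplus> T j \<otimes> (E j \<oplus> E j \<oplus> P [^] j \<otimes> T j \<ominus> \<one>)"
    have pc: "P [^] j \<in> carrier L" using c by simp
    have "F \<otimes> F \<ominus> F = (E j \<otimes> E j \<ominus> E j) \<oplus> P [^] j \<otimes> (T j \<otimes> (E j \<oplus> E j \<oplus> P [^] j \<otimes> T j \<ominus> \<one>))"
      unfolding F[of j] using c(2)[of j] c'(2)[of j] pc by algebra
    also have "\<dots> = P [^] j \<otimes> ?r"
      unfolding D(2) nat_pow_Suc using c(1) c(2)[of j] c'(2,3)[of j] pc by algebra
    finally have *: "F \<otimes> F \<ominus> F = P [^] j \<otimes> ?r" .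
    have "?r \<in> Span A Bs" by (intro order_closed D(1) T(1) EN)
    then show "\<exists>r\<in>OL. F \<otimes> F \<ominus> F = P [^] j \<otimes> r" using * NO by blast
  qed
  moreover have "F \<otimes> F \<ominus> F = F \<otimes> (F \<ominus> \<one>)" using Fc r_one[OF Fc] by algebra
  ultimately have F01: "F = \<zero> \<or> F = \<one>"
    using Fc integral[of F "F \<ominus> \<one>"] r_right_minus_eq[of F \<one>] by auto
  have eF: "e = F \<ominus> P \<otimes> (u 0 \<oplus> T (Suc 0))"
  proof -
    have "F = e \<oplus> (P \<otimes> u 0 \<oplus> P \<otimes> T (Suc 0))" unfolding F_def E0 using T(2)[of 0] by simp
    then show ?thesis
      using c(1) c'(1)[of 0] c'(2)[of "Suc 0"] order_carrier[OF e] by algebra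
  qed
  have uT: "u 0 \<oplus> T (Suc 0) \<in> Span A Bs" by (intro order_closed uN T(1))
  have z: "\<zero> \<ominus> P \<otimes> (u 0 \<oplus> T (Suc 0)) = P \<otimes> (\<ominus> (u 0 \<oplus> T (Suc 0)))"
    using c(1) c'(1)[of 0] c'(2)[of "Suc 0"] by algebra
  from F01 show ?thesis
  proof
    assume "F = \<zero>"
    then have "e = P \<otimes> (\<ominus> (u 0 \<oplus> T (Suc 0)))" using eF z by metis
    then show ?thesis using order_closed(3)[OF uT] by blast
  next
    assume "F = \<one>"
    then have "e = \<one> \<ominus> P \<otimes> (u 0 \<oplus> T (Suc 0))" using eF by metis
    then show ?thesis using uT by blast
  qed
qed

end

text \<open>Powers of x repeat modulo \<open>P\<close>, which yields an n for which x^n is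
  idempotent modulo \<open>P\<close>, hence congruent to 0 or 1. In the first case 1 - x^n and its
  divisor 1 - x are units, in the second x^n and x.\<close>

lemma OL_unit_or:
  assumes x: "x \<in> OL"
  shows "(\<exists>y\<in>OL. x \<otimes> y = \<one>) \<or> (\<exists>y\<in>OL. (\<one> \<ominus> x) \<otimes> y = \<one>)"
proof -
  obtain Bs where B: "set Bs \<subseteq> carrier L" and N: "subring (Span A Bs) L" and xN: "x \<in> Span A Bs"
    and NO: "Span A Bs \<subseteq> OL"
    using OL_order[OF x] by metis
  note cl = subringE(2,3,5,6,7)[OF N] subring_pow[OF N] subring_minus[OF N] subring_of_integer[OF N]
  have xc: "x \<in> carrier L" using x OL_carrier by simp
  have Nc: "\<And>y. y \<in> Span A Bs \<Longrightarrow> y \<in> carrier L" using A_Span_carrier[OF B] .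
  obtain i j :: nat and r where ij: "i < j" "r \<in> Span A Bs" "x [^] i = x [^] j \<oplus> P \<otimes> r"
    using Span_pigeonhole[OF B, of "\<lambda>i. x [^] i", OF cl(6)[OF xN]] by blast
  define k where "k = j - i"
  have k: "k > 0" "j = i + k" using ij by (auto simp: k_def)
  \<comment> \<open>A positive multiple of the period k that is at least the preperiod i, as needed
    for x^n to be idempotent modulo \<open>P\<close>.\<close>
  define n where "n = k * Suc i"
  have "1 * Suc i \<le> n" unfolding n_def using k by (intro mult_le_mono1) simp
  then have n: "n > 0" "n \<ge> i" by auto
  obtain s where s: "s \<in> Span A Bs" "\<one> \<ominus> x [^] n = (\<one> \<ominus> x [^] k) \<otimes> s"
    using one_minus_pow_factor[OF N cl(6)[OF xN], of k "Suc i"]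
    unfolding n_def nat_pow_pow[OF xc] by blast
  have rc: "r \<in> carrier L" "s \<in> carrier L" "x [^] i \<in> carrier L" "x [^] (n - i) \<in> carrier L"
    "x [^] k \<in> carrier L"
    using ij s Nc xc by auto
  have xn: "x [^] n = x [^] i \<otimes> x [^] (n - i)" using xc n by (simp add: nat_pow_mult)
  have "x [^] i \<otimes> x [^] k \<oplus> P \<otimes> r = x [^] i" using ij(3) unfolding k(2) nat_pow_mult[OF xc, symmetric] by (rule sym)
  moreover have "P \<otimes> r = (x [^] i \<otimes> x [^] k \<oplus> P \<otimes> r) \<ominus> x [^] i \<otimes> x [^] k"
    using rc of_integer_closed[of "int p"] by algebra
  moreover have "x [^] i \<otimes> (\<one> \<ominus> x [^] k) = x [^] i \<ominus> x [^] i \<otimes> x [^] k"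
    using rc by algebra
  ultimately have Pr: "x [^] i \<otimes> (\<one> \<ominus> x [^] k) = P \<otimes> r" by simp
  let ?d = "\<ominus> (x [^] (n - i) \<otimes> s \<otimes> r)"
  have "x [^] n \<otimes> x [^] n \<ominus> x [^] n = \<ominus> (x [^] n \<otimes> (\<one> \<ominus> x [^] n))"
    using xc nat_pow_closed[OF xc, of n] by algebra
  also have "\<dots> = \<ominus> (x [^] (n - i) \<otimes> s \<otimes> (x [^] i \<otimes> (\<one> \<ominus> x [^] k)))"
    unfolding s(2) unfolding xn using rc by algebra
  also have "\<dots> = P \<otimes> ?d" unfolding Pr using rc of_integer_closed[of "int p"] by algebra
  finally have e: "x [^] n \<otimes> x [^] n \<ominus> x [^] n = P \<otimes> ?d" .
  have "?d \<in> Span A Bs" by (intro cl s(1) ij(2) xN)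
  then have "(\<exists>r\<in>Span A Bs. x [^] n = P \<otimes> r) \<or> (\<exists>r\<in>Span A Bs. x [^] n = \<one> \<ominus> P \<otimes> r)"
    using order_idempotent[OF B N NO cl(6)[OF xN] _ e] by blast
  then show ?thesis
  proof
    assume "\<exists>r\<in>Span A Bs. x [^] n = P \<otimes> r"
    then obtain r where r: "r \<in> Span A Bs" "x [^] n = P \<otimes> r" by blast
    obtain v where v: "v \<in> Span A Bs" "(\<one> \<ominus> x [^] n) \<otimes> v = \<one>"
      using order_geometric[OF B N NO r(1)] unfolding r(2) by blast
    obtain t where t: "t \<in> Span A Bs" "\<one> \<ominus> x [^] n = (\<one> \<ominus> x) \<otimes> t"
      using one_minus_pow_factor[OF N xN] by blast
    have "(\<one> \<ominus> x) \<otimes> (t \<otimes> v) = \<one>" using v t Nc xc by (simp add: m_assoc)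
    then show ?thesis using NO v t cl(4) by blast
  next
    assume "\<exists>r\<in>Span A Bs. x [^] n = \<one> \<ominus> P \<otimes> r"
    then obtain r where r: "r \<in> Span A Bs" "x [^] n = \<one> \<ominus> P \<otimes> r" by blast
    obtain v where v: "v \<in> Span A Bs" "x [^] n \<otimes> v = \<one>"
      using order_geometric[OF B N NO r(1)] unfolding r(2) by blast
    obtain m where m: "n = Suc m" using n by (cases n) auto
    have "x \<otimes> (x [^] m \<otimes> v) = \<one>" using v Nc xc m by (simp add: m_ac)
    then show ?thesis using NO v xN cl(4,6) by blast
  qed
qed

lemma \<mm>_iff: "x \<in> \<mm> \<longleftrightarrow> x \<in> OL \<and> \<not> (\<exists>y\<in>OL. x \<otimes> y = \<one>)"
  by (rule nonunits_iff[OF OL_subring])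

lemma \<mm>_carrier: "x \<in> \<mm> \<Longrightarrow> x \<in> carrier L"
  using OL_carrier by (simp add: \<mm>_iff)

lemma P_\<mm>: "P \<in> \<mm>"
  using P_OL inv_P_not_OL by (auto simp: \<mm>_iff)

lemma one_not_\<mm>: "\<one> \<notin> \<mm>"
  using OL_closed(2) bexI[of "\<lambda>y. \<one> \<otimes> y = \<one>" \<one> OL] by (simp add: \<mm>_iff)

lemma zero_\<mm>: "\<zero> \<in> \<mm>"
  using OL_closed(1) OL_carrier by (auto simp: \<mm>_iff)

lemma \<mm>_mult: "a \<in> OL \<Longrightarrow> x \<in> \<mm> \<Longrightarrow> a \<otimes> x \<in> \<mm>"
proof -
  assume a: "a \<in> OL" and x: "x \<in> \<mm>"
  have "\<not> (\<exists>y\<in>OL. a \<otimes> x \<otimes> y = \<one>)"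
  proof
    assume "\<exists>y\<in>OL. a \<otimes> x \<otimes> y = \<one>"
    then obtain y where y: "y \<in> OL" "a \<otimes> x \<otimes> y = \<one>" by blast
    then have "x \<otimes> (a \<otimes> y) = \<one>" using OL_carrier a \<mm>_carrier[OF x] by (simp add: m_ac)
    then show False using x a y OL_closed(4) by (auto simp: \<mm>_iff)
  qed
  then show ?thesis using a x OL_closed(4) by (auto simp: \<mm>_iff)
qed

text \<open>If the sum had an inverse u, then u x and 1 - u x = u y would both be nonunits, against
  \<open>OL_unit_or\<close>.\<close>

lemma \<mm>_add: "x \<in> \<mm> \<Longrightarrow> y \<in> \<mm> \<Longrightarrow> x \<oplus> y \<in> \<mm>"
proof (rule ccontr)
  assume x: "x \<in> \<mm>" and y: "y \<in> \<mm>" and "x \<oplus> y \<notin> \<mm>"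
  then obtain u where u: "u \<in> OL" "(x \<oplus> y) \<otimes> u = \<one>"
    using OL_closed(5) by (auto simp: \<mm>_iff)
  have c: "x \<in> carrier L" "y \<in> carrier L" "u \<in> carrier L" using x y u \<mm>_carrier OL_carrier by auto
  have ux: "u \<otimes> x \<in> \<mm>" "u \<otimes> y \<in> \<mm>" using \<mm>_mult u x y by auto
  have "\<one> \<ominus> u \<otimes> x = u \<otimes> y" unfolding u(2)[symmetric] using c by algebra
  then show False using OL_unit_or[of "u \<otimes> x"] ux by (auto simp: \<mm>_iff)
qed

lemma \<mm>_neg: "x \<in> \<mm> \<Longrightarrow> \<ominus> x \<in> \<mm>"
  using \<mm>_mult[of "\<ominus> \<one>" x] OL_closed \<mm>_carrier[of x] by (simp add: l_minus)

lemma \<mm>_minus: "x \<in> \<mm> \<Longrightarrow> y \<in> \<mm> \<Longrightarrow> x \<ominus> y \<in> \<mm>"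
  using \<mm>_add \<mm>_neg by (simp add: a_minus_def)

lemma \<mm>_prime: "x \<in> OL \<Longrightarrow> y \<in> OL \<Longrightarrow> x \<otimes> y \<in> \<mm> \<Longrightarrow> x \<in> \<mm> \<or> y \<in> \<mm>"
proof (rule ccontr)
  assume x: "x \<in> OL" and y: "y \<in> OL" and xy: "x \<otimes> y \<in> \<mm>" and "\<not> (x \<in> \<mm> \<or> y \<in> \<mm>)"
  then obtain u v where uv: "u \<in> OL" "x \<otimes> u = \<one>" "v \<in> OL" "y \<otimes> v = \<one>"
    by (auto simp: \<mm>_iff)
  have c: "x \<in> carrier L" "y \<in> carrier L" "u \<in> carrier L" "v \<in> carrier L"
    using x y uv OL_carrier by auto
  have "(x \<otimes> y) \<otimes> (u \<otimes> v) = (x \<otimes> u) \<otimes> (y \<otimes> v)" using c by (simp add: m_ac)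
  then have "(x \<otimes> y) \<otimes> (u \<otimes> v) = \<one>" using uv by simp
  then show False using xy uv OL_closed(4) by (auto simp: \<mm>_iff)
qed

lemma \<mm>_pow: "x \<in> OL \<Longrightarrow> x [^] (n::nat) \<in> \<mm> \<Longrightarrow> x \<in> \<mm>"
  by (induction n) (use one_not_\<mm> \<mm>_prime subring_pow[OF OL_subring] in auto)

lemma OL_unit_inv: "x \<in> OL \<Longrightarrow> x \<notin> \<mm> \<Longrightarrow> inv x \<in> OL"
  using comm_inv_char OL_carrier by (auto simp: \<mm>_iff)

text \<open>Two iterated Frobenius powers of x agree modulo \<open>P\<close> by the pigeonhole
  principle. Frobenius is injective on residues because \<open>\<mm>\<close> is prime, so the
  smaller exponent cancels.\<close>

lemma OL_frobenius_residue:
  assumes x: "x \<in> OL"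
  shows "\<exists>f>0. x [^] (p ^ f) \<ominus> x \<in> \<mm>"
proof -
  obtain Bs where B: "set Bs \<subseteq> carrier L" and N: "subring (Span A Bs) L" and xN: "x \<in> Span A Bs"
    and NO: "Span A Bs \<subseteq> OL"
    using OL_order[OF x] by metis
  have xc: "x \<in> carrier L" using x OL_carrier by simp
  obtain i j r where ij: "i < j" "r \<in> Span A Bs" "x [^] (p ^ i) = x [^] (p ^ j) \<oplus> P \<otimes> r"
    using Span_pigeonhole[OF B, of "\<lambda>i. x [^] (p ^ i)", OF subring_pow[OF N xN]] by blast
  define f where "f = j - i"
  have f: "f > 0" "j = f + i" using ij by (auto simp: f_def)
  let ?y = "x [^] (p ^ f)"
  have y: "?y \<in> OL" using subring_pow[OF OL_subring x] .
  obtain s where s: "s \<in> OL"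
      "((x \<ominus> ?y) \<oplus> ?y) [^] (p ^ i) = (x \<ominus> ?y) [^] (p ^ i) \<oplus> ?y [^] (p ^ i) \<oplus> P \<otimes> s"
    using frobenius_add_iterated[OF prime_p OL_subring OL_minus[OF x y] y] by blast
  have c: "s \<in> carrier L" "r \<in> carrier L" "?y \<in> carrier L"
    using s ij NO y OL_carrier by auto
  have "(x \<ominus> ?y) \<oplus> ?y = x" using xc c(3) by algebra
  moreover have "?y [^] (p ^ i) = x [^] (p ^ j)" using xc by (simp add: nat_pow_pow power_add f(2))
  ultimately have *: "x [^] (p ^ j) \<oplus> P \<otimes> r = (x \<ominus> ?y) [^] (p ^ i) \<oplus> x [^] (p ^ j) \<oplus> P \<otimes> s"
    using s(2) ij(3) by simp
  have "(x \<ominus> ?y) [^] (p ^ i) = P \<otimes> (r \<ominus> s)"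
  proof -
    define z where "z = (x \<ominus> ?y) [^] (p ^ i)"
    define a where "a = x [^] (p ^ j)"
    have za: "z \<in> carrier L" "a \<in> carrier L" using xc c by (auto simp: z_def a_def)
    then have "z = (z \<oplus> a \<oplus> P \<otimes> s) \<ominus> a \<ominus> P \<otimes> s"
      using c of_integer_closed[of "int p"] by algebra
    also have "z \<oplus> a \<oplus> P \<otimes> s = a \<oplus> P \<otimes> r" using * by (simp add: z_def a_def)
    also have "a \<oplus> P \<otimes> r \<ominus> a \<ominus> P \<otimes> s = P \<otimes> (r \<ominus> s)"
      using za c of_integer_closed[of "int p"] by algebra
    finally show ?thesis by (simp add: z_def)
  qed
  also have "\<dots> \<in> \<mm>"
    using \<mm>_mult[OF OL_minus P_\<mm>, of r s] s ij NO c by (auto simp: m_comm)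
  finally have "x \<ominus> ?y \<in> \<mm>" using \<mm>_pow OL_minus[OF x y] by blast
  moreover have "?y \<ominus> x = \<ominus> (x \<ominus> ?y)" using xc c by algebra
  ultimately show ?thesis using f(1) \<mm>_neg by auto
qed

end

section \<open>Roots of unity of order prime to \<open>p\<close>\<close>

text \<open>Horner's scheme: a further coefficient of f appends the value of the shorter list at r
  to the quotient. The condition on \<open>hd\<close> keeps monic lists monic.\<close>

lemma (in cring) synthetic_division:
  assumes r: "r \<in> carrier R" and f: "set f \<subseteq> carrier R"
  shows "\<exists>q. set q \<subseteq> carrier R \<and> length q = length f - 1 \<and> (length f \<ge> 2 \<longrightarrow> hd q = hd f) \<and>
    (\<forall>x\<in>carrier R. eval f x = (x \<ominus> r) \<otimes> eval q x \<oplus> eval f r)"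
  using f
proof (induction f rule: rev_induct)
  case Nil
  then show ?case using r by (intro exI[of _ "[]"]) simp
next
  case (snoc c f)
  have c: "c \<in> carrier R" and f: "set f \<subseteq> carrier R" using snoc.prems by auto
  show ?case
  proof (cases "f = []")
    case True
    then show ?thesis using r c by (intro exI[of _ "[]"]) simp
  next
    case False
    obtain q where q: "set q \<subseteq> carrier R" "length q = length f - 1" "length f \<ge> 2 \<longrightarrow> hd q = hd f"
      "\<And>x. x \<in> carrier R \<Longrightarrow> eval f x = (x \<ominus> r) \<otimes> eval q x \<oplus> eval f r"
      using snoc.IH[OF f] by blast
    let ?e = "eval f r"
    have e: "?e \<in> carrier R" by (rule eval_in_carrier[OF f r])
    have "hd (q @ [?e]) = hd (f @ [c])"
    proof (cases "length f \<ge> 2")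
      case True
      then have "q \<noteq> []" using q(2) by auto
      then show ?thesis using q(3) True False by simp
    next
      case l: False
      then obtain a where a: "f = [a]" using False by (cases f; cases "tl f") auto
      then have "q = []" using q(2) by simp
      then show ?thesis using a f by simp
    qed
    moreover have "eval (f @ [c]) x = (x \<ominus> r) \<otimes> eval (q @ [?e]) x \<oplus> eval (f @ [c]) r"
      if x: "x \<in> carrier R" for x
    proof -
      have qx: "eval q x \<in> carrier R" by (rule eval_in_carrier[OF q(1) x])
      have "eval (f @ [c]) x = ((x \<ominus> r) \<otimes> eval q x \<oplus> ?e) \<otimes> x \<oplus> c"
        using eval_append_aux[OF f c x] q(4)[OF x] by simp
      also have "\<dots> = (x \<ominus> r) \<otimes> (eval q x \<otimes> x \<oplus> ?e) \<oplus> (?e \<otimes> r \<oplus> c)"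
        using qx x r e c by algebra
      finally show ?thesis
        using eval_append_aux[OF f c r] eval_append_aux[OF q(1) e x] by simp
    qed
    ultimately show ?thesis
      using q(1,2) e False by (intro exI[of _ "q @ [?e]"]) auto
  qed
qed

lemma (in algebraically_closed) monic_root_exists:
  assumes l: "set l \<subseteq> carrier L" "l \<noteq> []"
  shows "\<exists>r\<in>carrier L. eval (\<one> # l) r = \<zero>"
proof -
  have P: "\<one> # l \<in> carrier (poly_ring L)"
    unfolding univ_poly_carrier[symmetric] polynomial_def using l by auto
  then have "splitted (\<one> # l)" by (rule roots_over_carrier)
  then have "size (roots (\<one> # l)) > 0" using l(2) by (simp add: splitted_def)
  then obtain r where "r \<in># roots (\<one> # l)" by (metis multi_nonempty_split not_gr0 size_empty union_single_eq_member)
  then have "is_root (\<one> # l) r" using roots_mem_iff_is_root[OF P] by auto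
  then show ?thesis by (auto simp: is_root_def)
qed

locale unramified_closure = padic_prime L Q p av + finite_unramified_extension L Q p av K +
  AC: algebraic_closure L K for L (structure) and Q and p and av and K +
  assumes odd_p: "odd p"
begin

definition mu :: "'a set" where
  "mu = {z \<in> carrier L. \<exists>m::nat. m > 0 \<and> coprime m p \<and> z [^] m = \<one>}"

lemma K_subfield: "subfield K L"
  by (rule K.subfield_axioms)

lemma K_subring: "subring K L"
  using subfieldE(1)[OF K_subfield] .

lemma K_carrier: "x \<in> K \<Longrightarrow> x \<in> carrier L"
  using subringE(1)[OF K_subring] by blast

lemma root_of_unity_OL:
  assumes "z \<in> carrier L" "z [^] (m::nat) = \<one>" "m > 0"
  shows "z \<in> OL"
proof -
  have "z [^] (0::nat) \<in> Span A (pows z m)"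
    using assms by (intro A_Span_mem pows_carrier) (auto simp: pows_def image_iff intro!: bexI[of _ 0])
  then have "z [^] m \<in> Span A (pows z m)" using assms by simp
  then show ?thesis using assms(1) by (auto simp: OL_iff)
qed

lemma mu_OL: "z \<in> mu \<Longrightarrow> z \<in> OL"
  using root_of_unity_OL by (auto simp: mu_def)

text \<open>Bezout: an integral combination of m and p equals 1, and \<open>P\<close> already lies
  in \<open>\<mm>\<close>.\<close>

lemma of_integer_coprime_not_\<mm>: "coprime (int m) (int p) \<Longrightarrow> \<iota> (int m) \<notin> \<mm>"
proof
  assume "coprime (int m) (int p)" and m: "\<iota> (int m) \<in> \<mm>"
  then obtain u v where uv: "u * int m + v * int p = 1"
    using bezout_int[of "int m" "int p"] by auto
  have "\<one> = \<iota> u \<otimes> \<iota> (int m) \<oplus> \<iota> v \<otimes> P"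
    unfolding of_integer_mult[symmetric] of_integer_add[symmetric] uv by simp
  also have "\<dots> \<in> \<mm>"
    using m P_\<mm> by (intro \<mm>_add \<mm>_mult subring_of_integer[OF OL_subring])
  finally show False using one_not_\<mm> by simp
qed

text \<open>The sum g = 1 + \<eta> + ... + \<eta>^(m-1) is congruent to m, a unit, while (1 -
  \<eta>) g = 1 - \<eta>^m = 0. This is what makes reduction injective on \<open>mu\<close>.\<close>

lemma root_of_unity_residue_1:
  assumes e: "\<eta> \<in> carrier L" "\<eta> [^] (m::nat) = \<one>" "m > 0" "coprime m p" "\<one> \<ominus> \<eta> \<in> \<mm>"
  shows "\<eta> = \<one>"
proof (rule ccontr)
  assume ne: "\<eta> \<noteq> \<one>"
  have eO: "\<eta> \<in> OL" by (rule root_of_unity_OL[OF e(1,2,3)])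
  have "\<exists>g\<in>OL. (\<one> \<ominus> \<eta>) \<otimes> g = \<one> \<ominus> \<eta> [^] n \<and> g \<ominus> \<iota> (int n) \<in> \<mm>" for n :: nat
  proof (induction n)
    case 0
    then show ?case
      using OL_closed(1) e(1) zero_\<mm> by (intro bexI[of _ \<zero>]) (auto simp: a_minus_def r_neg)
  next
    case (Suc n)
    then obtain g where g: "g \<in> OL" "(\<one> \<ominus> \<eta>) \<otimes> g = \<one> \<ominus> \<eta> [^] n" "g \<ominus> \<iota> (int n) \<in> \<mm>" by blast
    have en: "\<eta> [^] n \<in> OL" by (rule subring_pow[OF OL_subring eO])
    have c: "g \<in> carrier L" "\<eta> [^] n \<in> carrier L" "\<iota> (int n) \<in> carrier L" "\<iota> (int (Suc n)) = \<iota> (int n) \<oplus> \<one>"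
      using g en OL_carrier of_integer_add[of "int n" 1] by (auto simp: add.commute)
    have "(\<one> \<ominus> \<eta>) \<otimes> (g \<oplus> \<eta> [^] n) = (\<one> \<ominus> \<eta>) \<otimes> g \<oplus> (\<one> \<ominus> \<eta>) \<otimes> \<eta> [^] n"
      using c e(1) by (simp add: r_distr)
    also have "\<dots> = \<one> \<ominus> \<eta> [^] Suc n"
      unfolding g(2) nat_pow_Suc using c(2) e(1) by algebra
    finally have 1: "(\<one> \<ominus> \<eta>) \<otimes> (g \<oplus> \<eta> [^] n) = \<one> \<ominus> \<eta> [^] Suc n" .
    obtain s where s: "s \<in> OL" "\<one> \<ominus> \<eta> [^] n = (\<one> \<ominus> \<eta>) \<otimes> s"
      using one_minus_pow_factor[OF OL_subring eO] by blast
    have "\<one> \<ominus> \<eta> [^] n \<in> \<mm>"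
      unfolding s(2) using \<mm>_mult[OF s(1) e(5)] s e(1) OL_carrier by (simp add: m_comm)
    then have "(g \<ominus> \<iota> (int n)) \<ominus> (\<one> \<ominus> \<eta> [^] n) \<in> \<mm>" using g(3) by (rule \<mm>_minus[rotated])
    moreover have "(g \<ominus> \<iota> (int n)) \<ominus> (\<one> \<ominus> \<eta> [^] n) = (g \<oplus> \<eta> [^] n) \<ominus> \<iota> (int (Suc n))"
      unfolding c(4) using c(1-3) by algebra
    ultimately show ?case using 1 OL_closed(5)[OF g(1) en] by (intro bexI[of _ "g \<oplus> \<eta> [^] n"]) auto
  qed
  then obtain g where g: "g \<in> OL" "(\<one> \<ominus> \<eta>) \<otimes> g = \<one> \<ominus> \<eta> [^] m" "g \<ominus> \<iota> (int m) \<in> \<mm>" by blast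
  have gc: "g \<in> carrier L" using g OL_carrier by auto
  have "\<one> \<ominus> \<eta> \<noteq> \<zero>" using ne e(1) r_right_minus_eq[of \<one> \<eta>] by auto
  moreover have "(\<one> \<ominus> \<eta>) \<otimes> g = \<zero>" using g(2) e(2) by (simp add: a_minus_def r_neg)
  ultimately have "g = \<zero>" using integral[of "\<one> \<ominus> \<eta>" g] gc e(1) by auto
  then have "\<ominus> (\<zero> \<ominus> \<iota> (int m)) \<in> \<mm>" using g(3) \<mm>_neg by blast
  then have "\<iota> (int m) \<in> \<mm>" by (simp add: a_minus_def)
  then show False using of_integer_coprime_not_\<mm>[of m] e(4) by simp
qed

text \<open>Roots are split off one at a time: if x - r is a unit, dividing by it leaves a monic
  polynomial of smaller degree whose value at x is still in \<open>\<mm>\<close>. The degree cannot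
  drop to 0, as 1 is not in \<open>\<mm>\<close>.\<close>

lemma monic_residue_root:
  assumes x: "x \<in> OL" and f: "set l \<subseteq> carrier L" "eval (\<one> # l) x \<in> \<mm>"
    and roots: "\<And>r. r \<in> carrier L \<Longrightarrow> eval (\<one> # l) r = \<zero> \<Longrightarrow> r \<in> OL"
  shows "\<exists>r\<in>carrier L. eval (\<one> # l) r = \<zero> \<and> x \<ominus> r \<in> \<mm>"
  using f roots
proof (induction "length l" arbitrary: l)
  case 0
  then show ?case using one_not_\<mm> by simp
next
  case (Suc n)
  then have "l \<noteq> []" by auto
  then obtain r where r: "r \<in> carrier L" "eval (\<one> # l) r = \<zero>"
    using AC.monic_root_exists[OF Suc.prems(1)] by blast
  have rO: "r \<in> OL" using Suc.prems(3) r by blast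
  have xc: "x \<in> carrier L" using OL_carrier[OF x] .
  show ?case
  proof (cases "x \<ominus> r \<in> \<mm>")
    case True
    then show ?thesis using r by blast
  next
    case False
    have "set (\<one> # l) \<subseteq> carrier L" using Suc.prems(1) by simp
    then obtain q where q: "set q \<subseteq> carrier L" "length q = length l" "hd q = \<one>"
      "\<And>x. x \<in> carrier L \<Longrightarrow> eval (\<one> # l) x = (x \<ominus> r) \<otimes> eval q x \<oplus> eval (\<one> # l) r"
      using synthetic_division[OF r(1), of "\<one> # l"] Suc.hyps(2) by auto
    obtain l' where l': "q = \<one> # l'" using q(2,3) Suc.hyps(2) by (cases q) auto
    have l'c: "set l' \<subseteq> carrier L" "length l' = n" using q l' Suc.hyps(2) by auto
    have ev: "eval (\<one> # l) y = (y \<ominus> r) \<otimes> eval (\<one> # l') y" if "y \<in> carrier L" for y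
      using q(4)[OF that] r that eval_in_carrier[OF q(1) that] unfolding l' by simp
    have inv: "inv (x \<ominus> r) \<in> OL" using OL_unit_inv[OF OL_minus[OF x rO] False] .
    have nz: "x \<ominus> r \<noteq> \<zero>" using False zero_\<mm> by auto
    have "eval (\<one> # l') x = inv (x \<ominus> r) \<otimes> eval (\<one> # l) x"
      unfolding ev[OF xc] using nz xc r(1) eval_in_carrier[OF q(1) xc] l' field_Units
      by (simp add: m_assoc[symmetric] del: eval.simps)
    also have "\<dots> \<in> \<mm>" using \<mm>_mult[OF inv Suc.prems(2)] .
    finally have m: "eval (\<one> # l') x \<in> \<mm>" .
    have z: "eval (\<one> # l) y = \<zero>" if "y \<in> carrier L" "eval (\<one> # l') y = \<zero>" for y
      using ev that r(1) by simp
    have "\<exists>r\<in>carrier L. eval (\<one> # l') r = \<zero> \<and> x \<ominus> r \<in> \<mm>"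
      by (rule Suc.hyps(1)) (use l'c m z Suc.prems(3) in \<open>simp_all del: eval.simps\<close>)
    then show ?thesis using z by blast
  qed
qed

text \<open>The coefficient list is X^n - c with its leading 1 split off, the shape that the lemmas
  on monic polynomials expect.\<close>

lemma eval_pow_minus:
  assumes "n > 0" "x \<in> carrier L" "c \<in> carrier L"
  shows "eval (\<one> # replicate (n - 1) \<zero> @ [\<ominus> c]) x = x [^] n \<ominus> c"
proof -
  have "eval ((\<one> # replicate k \<zero>) @ [\<ominus> c]) x = x [^] Suc k \<ominus> c" for k
  proof -
    have "set (\<one> # replicate k \<zero>) \<subseteq> carrier L" by (auto simp: set_replicate_conv_if)
    from eval_append_aux[OF this _ assms(2), of "\<ominus> c"] show ?thesis
      using assms(2,3) eval_replicate[of "[]" x k] by (simp add: a_minus_def)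
  qed
  from this[of "n - 1"] show ?thesis using assms(1) by simp
qed

text \<open>Teichmueller representative: a nonzero residue satisfies X^(p^f - 1) = 1, and the roots
  of this equation in \<open>L\<close> are roots of unity of order prime to p, one of which must
  have the given residue.\<close>

lemma residue_root_of_unity:
  assumes x: "x \<in> OL"
  shows "\<exists>z\<in>insert \<zero> mu. x \<ominus> z \<in> \<mm>"
proof (cases "x \<in> \<mm>")
  case True
  then show ?thesis using \<mm>_carrier[OF True] by (auto simp: a_minus_def)
next
  case False
  obtain f where f: "f > 0" "x [^] (p ^ f) \<ominus> x \<in> \<mm>" using OL_frobenius_residue[OF x] by blast
  define n where "n = p ^ f - 1"
  have "p ^ f > 1" using prime_gt_1_nat[OF prime_p] f(1) by (rule one_less_power)
  then have n: "n > 0" "p ^ f = Suc n" by (auto simp: n_def)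
  have xc: "x \<in> carrier L" using OL_carrier[OF x] .
  have xn: "x [^] n \<in> carrier L" and 1: "\<one> \<in> carrier L" using xc by simp_all
  have "x [^] (p ^ f) \<ominus> x = x \<otimes> (x [^] n \<ominus> \<one>)"
    unfolding n(2) nat_pow_Suc using xc xn r_one[OF xc] by algebra
  then have "x [^] n \<ominus> \<one> \<in> \<mm>"
    using \<mm>_prime[OF x, of "x [^] n \<ominus> \<one>"] f(2) False OL_minus subring_pow[OF OL_subring x] OL_closed(2)
    by auto
  then have "eval (\<one> # replicate (n - 1) \<zero> @ [\<ominus> \<one>]) x \<in> \<mm>"
    by (simp only: eval_pow_minus[OF n(1) xc 1])
  moreover have pw: "r [^] n = \<one>" if "r \<in> carrier L" "eval (\<one> # replicate (n - 1) \<zero> @ [\<ominus> \<one>]) r = \<zero>" for r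
    using that(2) r_right_minus_eq[of "r [^] n" \<one>] that(1)
    by (simp only: eval_pow_minus[OF n(1) that(1) 1]) simp
  moreover have "set (replicate (n - 1) \<zero> @ [\<ominus> \<one>]) \<subseteq> carrier L" by auto
  ultimately have "\<exists>r\<in>carrier L. eval (\<one> # replicate (n - 1) \<zero> @ [\<ominus> \<one>]) r = \<zero> \<and> x \<ominus> r \<in> \<mm>"
    using root_of_unity_OL n(1) by (intro monic_residue_root[OF x]) blast+
  then obtain r where r: "r \<in> carrier L" "r [^] n = \<one>" "x \<ominus> r \<in> \<mm>"
    using pw by blast
  have "coprime n p"
  proof -
    have "coprime (Suc n) n" by simp
    then have "coprime (p ^ f) n" using n(2) by simp
    then show ?thesis using f(1) by (simp add: coprime_commute)
  qed
  then have "r \<in> mu" using r n(1) by (auto simp: mu_def)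
  then show ?thesis using r by blast
qed

text \<open>The quotient of the two roots has order prime to p and residue 1, so
  \<open>root_of_unity_residue_1\<close> applies.\<close>

lemma mu_cong_eq:
  assumes z: "z \<in> mu" and w: "w \<in> mu" and "z \<ominus> w \<in> \<mm>"
  shows "z = w"
proof -
  obtain m n where m: "m > 0" "coprime m p" "z [^] (m::nat) = \<one>" "n > 0" "coprime n p" "w [^] (n::nat) = \<one>"
    and c: "z \<in> carrier L" "w \<in> carrier L"
    using z w by (auto simp: mu_def)
  obtain k where k: "n = Suc k" using m(4) by (cases n) auto
  \<comment> \<open>The inverse of w, because \<open>w [^] Suc k = \<one>\<close>.\<close>
  define w' where "w' = w [^] k"
  have w': "w' \<in> carrier L" "w' \<otimes> w = \<one>" "w' \<in> OL"
    using c m(6) k subring_pow[OF OL_subring mu_OL[OF w]] by (auto simp: w'_def)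
  have "\<one> \<ominus> w' \<otimes> z = \<ominus> (w' \<otimes> (z \<ominus> w))" unfolding w'(2)[symmetric] using c w'(1) by algebra
  then have "\<one> \<ominus> w' \<otimes> z \<in> \<mm>" using \<mm>_neg[OF \<mm>_mult[OF w'(3) assms(3)]] by simp
  moreover have "(w' \<otimes> z) [^] (n * m) = \<one>"
  proof -
    have "w' [^] n = (w [^] n) [^] k" using c by (simp add: w'_def nat_pow_pow mult.commute)
    then have "w' [^] n = \<one>" using m(6) by simp
    then have "w' [^] (n * m) = \<one>" using w'(1) by (simp add: nat_pow_pow[symmetric])
    moreover have "z [^] (n * m) = \<one>"
      using m(3) c by (simp add: mult.commute[of n] nat_pow_pow[symmetric])
    ultimately show ?thesis using c w' by (simp add: nat_pow_distrib)
  qed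
  moreover have "n * m > 0" "coprime (n * m) p" "w' \<otimes> z \<in> carrier L" using m w'(1) c(1) by auto
  ultimately have "w' \<otimes> z = \<one>"
    using root_of_unity_residue_1[of "w' \<otimes> z" "n * m"] by blast
  then have "w \<otimes> (w' \<otimes> z) = w" using c by simp
  moreover have "w \<otimes> (w' \<otimes> z) = (w' \<otimes> w) \<otimes> z" using c w'(1) by (simp add: m_ac)
  ultimately show ?thesis using w'(2) c by simp
qed

lemma mu_pow: "z \<in> mu \<Longrightarrow> z [^] (k::nat) \<in> mu"
proof -
  assume "z \<in> mu"
  then obtain m where m: "z \<in> carrier L" "m > 0" "coprime m p" "z [^] (m::nat) = \<one>" by (auto simp: mu_def)
  have "(z [^] k) [^] m = (z [^] m) [^] k" using m(1) by (simp add: nat_pow_pow mult.commute)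
  then show ?thesis using m by (auto simp: mu_def)
qed

end

section \<open>The maximal unramified extension\<close>

context unramified_closure
begin

abbreviation OK where "OK \<equiv> ring_of_integers L Q av K"

lemma OK_iff: "x \<in> OK \<longleftrightarrow> x \<in> OL \<and> x \<in> K"
  using K_carrier by (auto simp: integral_closure_def)

lemma OK_subring: "subring OK L"
proof -
  have "OK = OL \<inter> K" using OK_iff by blast
  then show ?thesis using subring_inter[OF OL_subring K_subring] by simp
qed

lemma A_subset_OK: "A \<subseteq> OK"
  using A_subset_OL base_subset A_iff OK_iff by blast

lemma A_nonunit: "x \<in> nonunits L A \<Longrightarrow> \<exists>c\<in>A. x = P \<otimes> c"
proof -
  assume "x \<in> nonunits L A"
  then have x: "x \<in> A" "\<not> (\<exists>y\<in>A. x \<otimes> y = \<one>)" using nonunits_iff[OF A_subring] by auto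
  have xQ: "x \<in> Q" "av x \<le> 1" using x(1) by (auto simp: A_iff)
  have "av x \<noteq> 1"
  proof
    assume 1: "av x = 1"
    then have "x \<noteq> \<zero>" by auto
    then obtain c where "c \<in> A" "\<one> = c \<otimes> x"
      using A_divide[OF Q_closed(2) xQ(1)] 1 by auto
    then show False using x A_carrier m_comm by metis
  qed
  then obtain c where c: "c \<in> A" "x = c \<otimes> P" using A_divide_P[OF xQ(1)] xQ(2) by force
  then show ?thesis using A_carrier[OF c(1)] m_comm[of c P] by auto
qed

text \<open>Unramifiedness of K in usable form. The multiples of \<open>P\<close> form an ideal of
  \<open>OK\<close> containing the nonunits of \<open>A\<close>, hence the ideal they generate,
  which by hypothesis consists of all nonunits of \<open>OK\<close>.\<close>

lemma OK_\<mm>: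
  assumes x: "x \<in> K" "x \<in> \<mm>"
  shows "\<exists>y\<in>OK. x = P \<otimes> y"
proof -
  let ?R = "L\<lparr>carrier := OK\<rparr>" and ?J = "(\<lambda>y. P \<otimes> y) ` OK"
  have xOK: "x \<in> OK" using x by (auto simp: OK_iff \<mm>_iff)
  have "\<not> (\<exists>y\<in>OK. x \<otimes> y = \<one>)" using x(2) by (auto simp: OK_iff \<mm>_iff)
  then have "x \<in> nonunits L OK" using xOK nonunits_iff[OF OK_subring] by simp
  then have "x \<in> genideal ?R (nonunits L A)" using unram by (simp add: unramified_def)
  moreover have "ideal ?J ?R"
  proof (rule idealI)
    interpret OR: ring ?R by (rule subring_is_ring[OF OK_subring])
    show "ring ?R" by (rule OR.ring_axioms)
    have PO: "P \<in> OK" by (rule subring_of_integer[OF OK_subring])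
    have c: "\<And>y. y \<in> OK \<Longrightarrow> y \<in> carrier L" using subringE(1)[OF OK_subring] by blast
    show "subgroup ?J (add_monoid ?R)"
    proof (rule OR.add.subgroupI)
      show "?J \<subseteq> carrier ?R" using PO subringE(6)[OF OK_subring] by auto
      show "?J \<noteq> {}" using subringE(4)[OF OK_subring] by auto
      fix a b assume "a \<in> ?J" "b \<in> ?J"
      then obtain y z where yz: "y \<in> OK" "z \<in> OK" "a = P \<otimes> y" "b = P \<otimes> z" by auto
      have "a \<oplus> b = P \<otimes> (y \<oplus> z)" using yz c by (simp add: r_distr)
      then show "a \<oplus>\<^bsub>?R\<^esub> b \<in> ?J" using yz subringE(7)[OF OK_subring] by simp
      have yR: "a \<in> carrier ?R" using yz PO subringE(6)[OF OK_subring] by auto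
      have ac: "a \<in> carrier L" using yz c by auto
      have "\<ominus>\<^bsub>?R\<^esub> a = \<ominus> a"
      proof (rule OR.minus_equality)
        show "\<ominus> a \<oplus>\<^bsub>?R\<^esub> a = \<zero>\<^bsub>?R\<^esub>" using ac by (simp add: l_neg)
        show "\<ominus> a \<in> carrier ?R" using yR subringE(5)[OF OK_subring] by simp
      qed (rule yR)
      also have "\<dots> = P \<otimes> (\<ominus> y)" using yz c by (simp add: r_minus)
      finally show "\<ominus>\<^bsub>?R\<^esub> a \<in> ?J" using yz subringE(5)[OF OK_subring] by simp
    qed
    fix a b assume "a \<in> ?J" "b \<in> carrier ?R"
    then obtain y where y: "y \<in> OK" "b \<in> OK" "a = P \<otimes> y" by auto
    have "b \<otimes> a = P \<otimes> (b \<otimes> y)" "a \<otimes> b = P \<otimes> (y \<otimes> b)" using y c by (simp_all add: m_ac)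
    then show "b \<otimes>\<^bsub>?R\<^esub> a \<in> ?J" "a \<otimes>\<^bsub>?R\<^esub> b \<in> ?J" using y subringE(6)[OF OK_subring] by auto
  qed
  moreover have "nonunits L A \<subseteq> ?J" using A_nonunit A_subset_OK by blast
  ultimately show ?thesis unfolding genideal_def by blast
qed

text \<open>The ring OK[mu]. It turns out to be a discrete valuation ring with uniformizer
  \<open>P\<close> and plays the part of the integers of the maximal unramified extension of
  K.\<close>

definition RU :: "'a set" where "RU = generate_ring L (OK \<union> mu)"

lemma RU_subring: "subring RU L" and RU_OL: "RU \<subseteq> OL" and OK_RU: "OK \<subseteq> RU" and mu_RU: "mu \<subseteq> RU"
proof -
  have H: "OK \<union> mu \<subseteq> carrier L" by (auto simp: integral_closure_def K_carrier mu_def)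
  show "subring RU L" unfolding RU_def by (rule generate_ring_is_subring[OF H])
  show "OK \<subseteq> RU" "mu \<subseteq> RU" unfolding RU_def by (auto intro: generate_ring.incl)
  show "RU \<subseteq> OL"
    unfolding RU_def using mu_OL OK_iff by (intro generate_ring_min_subring1[OF H OL_subring]) auto
qed

lemmas RU_closed = subringE(2,3,5,6,7)[OF RU_subring] subring_pow[OF RU_subring]
  subring_minus[OF RU_subring] subring_of_integer[OF RU_subring]

lemma RU_carrier: "x \<in> RU \<Longrightarrow> x \<in> carrier L"
  using subringE(1)[OF RU_subring] by blast

text \<open>The congruence is modulo \<open>P\<close> times \<open>RU\<close>, not merely modulo
  \<open>\<mm>\<close>. It survives sums and products, and it forces \<open>\<mm>\<close> to meet
  \<open>RU\<close> in multiples of \<open>P\<close> only.\<close>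

definition frob_fixed :: "'a \<Rightarrow> nat \<Rightarrow> bool" where
  "frob_fixed y f \<longleftrightarrow> y \<in> RU \<and> (\<exists>s\<in>RU. y [^] (p ^ f) = y \<oplus> P \<otimes> s)"

text \<open>Used to give two elements a common exponent, the product of theirs.\<close>

lemma frob_fixed_multiple:
  assumes "frob_fixed y f"
  shows "frob_fixed y (f * k)"
proof (induction k)
  case 0
  then show ?case
    using assms RU_closed(1) RU_carrier by (auto simp: frob_fixed_def intro!: bexI[of _ \<zero>])
next
  case (Suc k)
  obtain s where y: "y \<in> RU" and s: "s \<in> RU" "y [^] (p ^ f) = y \<oplus> P \<otimes> s"
    using assms by (auto simp: frob_fixed_def)
  obtain t where t: "t \<in> RU" "y [^] (p ^ (f * k)) = y \<oplus> P \<otimes> t"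
    using Suc by (auto simp: frob_fixed_def)
  have Pt: "P \<otimes> t \<in> RU" by (intro RU_closed t(1))
  obtain u where u: "u \<in> RU"
      "(y \<oplus> P \<otimes> t) [^] (p ^ f) = y [^] (p ^ f) \<oplus> (P \<otimes> t) [^] (p ^ f) \<oplus> P \<otimes> u"
    using frobenius_add_iterated[OF prime_p RU_subring y Pt] by blast
  have c: "y \<in> carrier L" "s \<in> carrier L" "t \<in> carrier L" "u \<in> carrier L"
    using y s t u RU_carrier by auto
  obtain q where q: "p ^ f = Suc q" using prime_gt_0_nat[OF prime_p] by (metis gr0_implies_Suc zero_less_power)
  define v where "v = (P \<otimes> t) [^] q \<otimes> t"
  have v: "v \<in> RU" "(P \<otimes> t) [^] (p ^ f) = P \<otimes> v"
    using c by (auto simp: v_def q m_ac intro!: RU_closed t(1) Pt)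
  have vc: "v \<in> carrier L" using v RU_carrier by auto
  have "y [^] (p ^ (f * Suc k)) = (y [^] (p ^ (f * k))) [^] (p ^ f)"
    using c by (simp add: nat_pow_pow power_add mult.commute)
  also have "\<dots> = y \<oplus> P \<otimes> (s \<oplus> v \<oplus> u)"
    unfolding t(2) u(2) s(2) v(2) using c vc by (simp add: r_distr a_ac)
  finally show ?case
    unfolding frob_fixed_def using y s v u by (auto intro!: bexI[of _ "s \<oplus> v \<oplus> u"] RU_closed)
qed

lemma frob_fixed_add:
  assumes "frob_fixed x f" "frob_fixed y f"
  shows "frob_fixed (x \<oplus> y) f"
proof -
  obtain s t where *: "x \<in> RU" "y \<in> RU" "s \<in> RU" "t \<in> RU"
      "x [^] (p ^ f) = x \<oplus> P \<otimes> s" "y [^] (p ^ f) = y \<oplus> P \<otimes> t"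
    using assms by (auto simp: frob_fixed_def)
  obtain u where u: "u \<in> RU" "(x \<oplus> y) [^] (p ^ f) = x [^] (p ^ f) \<oplus> y [^] (p ^ f) \<oplus> P \<otimes> u"
    using frobenius_add_iterated[OF prime_p RU_subring *(1,2)] by blast
  have c: "x \<in> carrier L" "y \<in> carrier L" "s \<in> carrier L" "t \<in> carrier L" "u \<in> carrier L"
    using * u RU_carrier by auto
  have "(x \<oplus> y) [^] (p ^ f) = (x \<oplus> y) \<oplus> P \<otimes> (s \<oplus> t \<oplus> u)"
    unfolding u(2) * using c by (simp add: r_distr a_ac)
  then show ?thesis
    unfolding frob_fixed_def using * u by (auto intro!: bexI[of _ "s \<oplus> t \<oplus> u"] RU_closed)
qed

lemma frob_fixed_mult:
  assumes "frob_fixed x f" "frob_fixed y f"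
  shows "frob_fixed (x \<otimes> y) f"
proof -
  obtain s t where *: "x \<in> RU" "y \<in> RU" "s \<in> RU" "t \<in> RU"
      "x [^] (p ^ f) = x \<oplus> P \<otimes> s" "y [^] (p ^ f) = y \<oplus> P \<otimes> t"
    using assms by (auto simp: frob_fixed_def)
  have c: "x \<in> carrier L" "y \<in> carrier L" "s \<in> carrier L" "t \<in> carrier L" "P \<in> carrier L"
    using * RU_carrier by auto
  have "(x \<otimes> y) [^] (p ^ f) = (x \<oplus> P \<otimes> s) \<otimes> (y \<oplus> P \<otimes> t)"
    using c * by (simp add: nat_pow_distrib)
  also have "\<dots> = x \<otimes> y \<oplus> P \<otimes> (s \<otimes> y \<oplus> x \<otimes> t \<oplus> P \<otimes> s \<otimes> t)"
    using c by algebra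
  finally show ?thesis
    unfolding frob_fixed_def using * by (auto intro!: bexI[of _ "s \<otimes> y \<oplus> x \<otimes> t \<oplus> P \<otimes> s \<otimes> t"] RU_closed)
qed

text \<open>An odd power of -1 is -1 itself, and p is odd. Negation in \<open>RU\<close> is then
  treated as multiplication by this element.\<close>

lemma frob_fixed_minus_one: "frob_fixed (\<ominus> \<one>) f"
proof -
  have "(\<ominus> \<one>) [^] (2 * k + 1) = \<ominus> \<one>" for k :: nat
    by (induction k) (auto simp: l_minus r_minus)
  moreover have "odd (p ^ f)" using odd_p by simp
  then obtain k where "p ^ f = 2 * k + 1" by (elim oddE)
  ultimately have "(\<ominus> \<one>) [^] (p ^ f) = \<ominus> \<one>" by metis
  then show ?thesis
    unfolding frob_fixed_def using RU_closed by (auto intro!: bexI[of _ \<zero>])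
qed

text \<open>On \<open>OK\<close> a congruence modulo \<open>\<mm>\<close> is one modulo
  \<open>P\<close> because K is unramified; on \<open>mu\<close> it is an equality because residues
  separate roots of unity of order prime to p. The rest is closure under the ring
  operations.\<close>

lemma RU_frobenius:
  assumes "y \<in> RU"
  shows "\<exists>f>0. frob_fixed y f"
  using assms unfolding RU_def
proof (induction rule: generate_ring.induct)
  case one
  show ?case
    using RU_closed(1,2) by (intro exI[of _ 1]) (auto simp: frob_fixed_def intro!: bexI[of _ \<zero>])
next
  case (incl h)
  then consider "h \<in> OK" | "h \<in> mu" by blast
  then show ?case
  proof cases
    case 1
    then have h: "h \<in> OL" "h \<in> K" by (auto simp: OK_iff)
    obtain f where f: "f > 0" "h [^] (p ^ f) \<ominus> h \<in> \<mm>" using OL_frobenius_residue[OF h(1)] by blast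
    have "h [^] (p ^ f) \<ominus> h \<in> K" by (intro subring_minus[OF K_subring] subring_pow[OF K_subring] h(2))
    then obtain y where y: "y \<in> OK" "h [^] (p ^ f) \<ominus> h = P \<otimes> y" using OK_\<mm> f(2) by blast
    have c: "h \<in> carrier L" "h [^] (p ^ f) \<in> carrier L" using h K_carrier by auto
    have "h [^] (p ^ f) = h \<oplus> (h [^] (p ^ f) \<ominus> h)" using c by algebra
    then have "h [^] (p ^ f) = h \<oplus> P \<otimes> y" using y(2) by simp
    then show ?thesis using f(1) y(1) 1 OK_RU unfolding frob_fixed_def by blast
  next
    case 2
    obtain f where f: "f > 0" "h [^] (p ^ f) \<ominus> h \<in> \<mm>" using OL_frobenius_residue[OF mu_OL[OF 2]] by blast
    then have "h [^] (p ^ f) = h" using mu_cong_eq[OF mu_pow[OF 2] 2] by blast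
    moreover have "h \<in> RU" using 2 mu_RU by blast
    ultimately show ?thesis
      using f(1) RU_closed(1) RU_carrier by (auto simp: frob_fixed_def intro!: exI[of _ f] bexI[of _ \<zero>])
  qed
next
  case (a_inv h)
  then obtain f where f: "f > 0" "frob_fixed h f" by blast
  have "h \<in> carrier L" using f(2) RU_carrier by (auto simp: frob_fixed_def)
  then have "\<ominus> h = (\<ominus> \<one>) \<otimes> h" by (simp add: l_minus)
  then show ?case using f frob_fixed_mult[OF frob_fixed_minus_one f(2)] by auto
next
  case (eng_add h1 h2)
  then obtain f g where fg: "f > 0" "frob_fixed h1 f" "g > 0" "frob_fixed h2 g" by blast
  then have "frob_fixed h1 (f * g)" "frob_fixed h2 (f * g)"
    using frob_fixed_multiple[OF fg(2), of g] frob_fixed_multiple[OF fg(4), of f]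
    by (auto simp: mult.commute)
  then show ?case using frob_fixed_add fg(1,3) by (intro exI[of _ "f * g"]) auto
next
  case (eng_mult h1 h2)
  then obtain f g where fg: "f > 0" "frob_fixed h1 f" "g > 0" "frob_fixed h2 g" by blast
  then have "frob_fixed h1 (f * g)" "frob_fixed h2 (f * g)"
    using frob_fixed_multiple[OF fg(2), of g] frob_fixed_multiple[OF fg(4), of f]
    by (auto simp: mult.commute)
  then show ?case using frob_fixed_mult fg(1,3) by (intro exI[of _ "f * g"]) auto
qed

lemma A_subset_RU: "A \<subseteq> RU"
  using A_subset_OK OK_RU by blast

text \<open>Multiplying a monic relation of degree n over \<open>A\<close> for v = 1/w by w^(n-1)
  expresses v through nonnegative powers of w.\<close>

lemma RU_inv:
  assumes w: "w \<in> RU" "w \<notin> \<mm>"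
  shows "inv w \<in> RU"
proof -
  have wO: "w \<in> OL" using w RU_OL by blast
  have wc: "w \<in> carrier L" "w \<noteq> \<zero>" using wO OL_carrier w(2) zero_\<mm> by auto
  let ?v = "inv w"
  have v: "?v \<in> OL" by (rule OL_unit_inv[OF wO w(2)])
  have vc: "?v \<in> carrier L" using v OL_carrier by blast
  have wv: "w \<otimes> ?v = \<one>" using wc field_Units by simp
  obtain n where n: "?v [^] n \<in> Span A (pows ?v n)" using v by (auto simp: OL_iff)
  have wvi: "w [^] i \<otimes> ?v [^] i = \<one>" for i :: nat
    using wv wc vc by (simp add: nat_pow_distrib[symmetric])
  have "n \<noteq> 0"
  proof
    assume "n = 0"
    then show False using n by (simp add: pows_def Span_Nil)
  qed
  then obtain k where k: "n = Suc k" by (cases n) auto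
  have "Span A (pows ?v n) \<subseteq> {y \<in> carrier L. w [^] k \<otimes> y \<in> RU}"
  proof (rule subring_Span_least[OF A_subring])
    have "w [^] k \<otimes> ?v [^] i \<in> RU" if i: "i < n" for i
    proof -
      have "w [^] k = w [^] (k - i) \<otimes> w [^] i" using wc i k by (simp add: nat_pow_mult)
      then have "w [^] k \<otimes> ?v [^] i = w [^] (k - i)" using wvi[of i] wc vc by (simp add: m_assoc)
      then show ?thesis using RU_closed(6)[OF w(1)] by simp
    qed
    then show "set (pows ?v n) \<subseteq> {y \<in> carrier L. w [^] k \<otimes> y \<in> RU}" using vc by (auto simp: pows_def)
    show "\<zero> \<in> {y \<in> carrier L. w [^] k \<otimes> y \<in> RU}" using wc RU_closed(1) by simp
    show "x \<oplus> y \<in> {y \<in> carrier L. w [^] k \<otimes> y \<in> RU}"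
      if "x \<in> {y \<in> carrier L. w [^] k \<otimes> y \<in> RU}" "y \<in> {y \<in> carrier L. w [^] k \<otimes> y \<in> RU}" for x y
      using that wc RU_closed(5) by (simp add: r_distr)
    show "a \<otimes> x \<in> {y \<in> carrier L. w [^] k \<otimes> y \<in> RU}"
      if a: "a \<in> A" and x: "x \<in> {y \<in> carrier L. w [^] k \<otimes> y \<in> RU}" for a x
    proof -
      have "w [^] k \<otimes> (a \<otimes> x) = a \<otimes> (w [^] k \<otimes> x)" using A_carrier[OF a] x wc by (simp add: m_lcomm)
      then show ?thesis using a x A_carrier[OF a] A_subset_RU RU_closed(4) by auto
    qed
  qed
  then have "w [^] k \<otimes> ?v [^] n \<in> RU" using n by blast
  moreover have "w [^] k \<otimes> ?v [^] n = ?v" using wvi[of k] wc vc unfolding k by (simp add: m_assoc[symmetric])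
  ultimately show ?thesis by simp
qed

text \<open>From y^(p^f) = y + P s follows y (1 - y^(p^f - 1)) = - P s, and the second factor on the
  left is a unit of \<open>RU\<close> when y is in \<open>\<mm>\<close>.\<close>

lemma RU_\<mm>:
  assumes y: "y \<in> RU" "y \<in> \<mm>"
  shows "\<exists>s\<in>RU. y = P \<otimes> s"
proof -
  obtain f s where f: "f > 0" "s \<in> RU" "y [^] (p ^ f) = y \<oplus> P \<otimes> s"
    using RU_frobenius[OF y(1)] by (auto simp: frob_fixed_def)
  have "p ^ f > 1" using prime_gt_1_nat[OF prime_p] f(1) by (rule one_less_power)
  \<comment> \<open>The exponent p^f is at least 2, so that y^(p^f - 1) is still divisible by y and
    lies in \<open>\<mm>\<close>.\<close>
  then obtain q where q: "p ^ f = Suc (Suc q)" by (metis One_nat_def less_imp_Suc_add plus_1_eq_Suc add.commute)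
  define w where "w = \<one> \<ominus> y [^] Suc q"
  have c: "y \<in> carrier L" "s \<in> carrier L" "w \<in> carrier L" "y [^] Suc q \<in> carrier L"
    using y(1) f RU_carrier by (auto simp: w_def)
  have wR: "w \<in> RU" unfolding w_def by (intro RU_closed y(1))
  have "y [^] Suc q \<in> \<mm>"
    unfolding nat_pow_Suc using \<mm>_mult[OF _ y(2)] RU_OL RU_closed(6)[OF y(1)] by blast
  then have wm: "w \<notin> \<mm>"
  proof -
    have "\<one> = w \<oplus> y [^] Suc q" unfolding w_def using c(4) by algebra
    then show ?thesis using \<mm>_add[of w "y [^] Suc q"] one_not_\<mm> \<open>y [^] Suc q \<in> \<mm>\<close> by auto
  qed
  then have "w \<noteq> \<zero>" using zero_\<mm> by blast
  then have iw: "inv w \<in> RU" "w \<otimes> inv w = \<one>"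
    using RU_inv[OF wR wm] c(3) field_Units by simp_all
  have "y \<otimes> w = y \<ominus> y [^] (p ^ f)"
    unfolding w_def q using c(1,4) r_one[OF c(1)] by (simp add: r_distr r_minus a_minus_def m_comm[of y])
  also have "\<dots> = P \<otimes> (\<ominus> s)"
    unfolding f(3) using c of_integer_closed[of "int p"] by algebra
  finally have yw: "y \<otimes> w = P \<otimes> (\<ominus> s)" .
  have "y = (y \<otimes> w) \<otimes> inv w" using iw c RU_carrier by (simp add: m_assoc)
  also have "\<dots> = P \<otimes> (\<ominus> s \<otimes> inv w)" unfolding yw using c iw RU_carrier by (simp add: m_assoc)
  finally show ?thesis using RU_closed(4)[OF RU_closed(3)[OF f(2)] iw(1)] by blast
qed

text \<open>A largest power of \<open>P\<close> dividing y in \<open>RU\<close> exists by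
  \<open>OL_separated\<close>; its cofactor is not in \<open>\<mm>\<close>, as otherwise
  \<open>RU_\<mm>\<close> would extract one more factor.\<close>

lemma RU_valuation:
  assumes y: "y \<in> RU" "y \<noteq> \<zero>"
  shows "\<exists>j u. u \<in> RU \<and> u \<notin> \<mm> \<and> y = P [^] (j::nat) \<otimes> u"
proof -
  define Z where "Z = (\<lambda>j::nat. \<exists>s\<in>RU. y = P [^] j \<otimes> s)"
  have yc: "y \<in> carrier L" using y RU_carrier by blast
  have "\<exists>j. \<not> Z j"
  proof (rule ccontr)
    assume "\<nexists>j. \<not> Z j"
    then have "\<And>j::nat. \<exists>r\<in>OL. y = P [^] j \<otimes> r" using RU_OL unfolding Z_def by blast
    then show False using OL_separated[of y] y RU_OL by blast
  qed
  then have n: "\<not> Z (LEAST j. \<not> Z j)" by (metis (mono_tags, lifting) LeastI)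
  have "Z 0" unfolding Z_def using y yc by (intro bexI[of _ y]) simp_all
  with n obtain i where i: "(LEAST j. \<not> Z j) = Suc i" by (metis not0_implies_Suc)
  then have "Z i" using not_less_Least[of i "\<lambda>j. \<not> Z j"] by auto
  then obtain s where s: "s \<in> RU" "y = P [^] i \<otimes> s" by (auto simp: Z_def)
  have "s \<notin> \<mm>"
  proof
    assume "s \<in> \<mm>"
    then obtain t where t: "t \<in> RU" "s = P \<otimes> t" using RU_\<mm> s by blast
    then have "y = P [^] Suc i \<otimes> t" using s RU_carrier by (simp add: m_assoc)
    then have "Z (Suc i)" using t by (auto simp: Z_def)
    then show False using n i by simp
  qed
  then show ?thesis using s by blast
qed

text \<open>The localisation RU[1/P]. By \<open>RU_valuation\<close> and \<open>RU_inv\<close> it is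
  the fraction field of \<open>RU\<close>, that is K(mu).\<close>

definition KU :: "'a set" where "KU = {x \<in> carrier L. \<exists>j::nat. P [^] j \<otimes> x \<in> RU}"

lemma KU_I: "x \<in> carrier L \<Longrightarrow> P [^] (j::nat) \<otimes> x \<in> RU \<Longrightarrow> x \<in> KU"
  unfolding KU_def by blast

lemma RU_P_pow: "x \<in> RU \<Longrightarrow> P [^] (j::nat) \<otimes> x \<in> RU"
  by (intro RU_closed)

lemma RU_KU: "RU \<subseteq> KU"
  using RU_carrier by (auto simp: KU_def intro!: exI[of _ "0::nat"])

lemma KU_valuation:
  assumes x: "x \<in> KU" "x \<noteq> \<zero>"
  shows "\<exists>(a::nat) (b::nat) u. u \<in> RU \<and> u \<notin> \<mm> \<and> P [^] a \<otimes> x = P [^] b \<otimes> u"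
proof -
  obtain a where a: "x \<in> carrier L" "P [^] (a::nat) \<otimes> x \<in> RU" using x by (auto simp: KU_def)
  have "P [^] a \<otimes> x \<noteq> \<zero>" using a x pow_nonzero[OF _ P_nonzero] by (simp add: integral_iff)
  then show ?thesis using RU_valuation[OF a(2)] by metis
qed

lemma KU_subring: "subring KU L"
proof (rule subringI)
  show "KU \<subseteq> carrier L" by (auto simp: KU_def)
  show "\<one> \<in> KU" using RU_KU RU_closed(2) by blast
  fix x y assume "x \<in> KU" "y \<in> KU"
  then obtain a b :: nat where *: "x \<in> carrier L" "P [^] a \<otimes> x \<in> RU" "y \<in> carrier L" "P [^] b \<otimes> y \<in> RU"
    by (auto simp: KU_def)
  have "P [^] a \<otimes> (\<ominus> x) = \<ominus> (P [^] a \<otimes> x)" using * by (simp add: r_minus)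
  then show "\<ominus> x \<in> KU" using * RU_closed(3)[OF *(2)] by (intro KU_I[of _ a]) auto
  have "P [^] (a + b) \<otimes> (x \<otimes> y) = (P [^] a \<otimes> x) \<otimes> (P [^] b \<otimes> y)"
    using * by (simp add: nat_pow_mult[symmetric] m_ac)
  then show "x \<otimes> y \<in> KU" using * RU_closed(4)[OF *(2,4)] by (intro KU_I[of _ "a + b"]) auto
  have "P [^] (a + b) \<otimes> (x \<oplus> y) = P [^] b \<otimes> (P [^] a \<otimes> x) \<oplus> P [^] a \<otimes> (P [^] b \<otimes> y)"
    using * by (simp add: nat_pow_mult[symmetric] m_ac r_distr l_distr)
  then have "P [^] (a + b) \<otimes> (x \<oplus> y) \<in> RU" using RU_P_pow * RU_closed(5) by simp
  then show "x \<oplus> y \<in> KU" using * by (intro KU_I[of _ "a + b"]) auto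
qed

lemma Q_scale: "set l \<subseteq> Q \<Longrightarrow> \<exists>k::nat. \<forall>x\<in>set l. P [^] k \<otimes> x \<in> A"
proof (induction l)
  case (Cons c l)
  then obtain k :: nat where k: "\<forall>x\<in>set l. P [^] k \<otimes> x \<in> A" by auto
  have c: "c \<in> Q" "\<And>x. x \<in> set l \<Longrightarrow> x \<in> Q" using Cons.prems by auto
  have PA: "P [^] n \<in> A" for n :: nat by (intro subring_pow[OF A_subring] subring_of_integer[OF A_subring])
  have PQ: "P [^] n \<in> Q" for n :: nat using PA by (simp add: A_iff)
  obtain n where "av c < real p ^ n" using real_arch_pow[of "real p" "av c"] p_ge_2 by auto
  then have "av (P [^] n \<otimes> c) \<le> 1"
    using p_ge_2 by (simp add: av_mult[OF PQ c(1)] av_P_pow field_simps)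
  then have nc: "P [^] n \<otimes> c \<in> A" using Q_closed(4)[OF PQ c(1)] by (simp add: A_iff)
  have "P [^] (n + k) \<otimes> x \<in> A" if "x \<in> set (c # l)" for x
  proof (cases "x = c")
    case True
    have "P [^] (n + k) \<otimes> c = P [^] k \<otimes> (P [^] n \<otimes> c)"
      using Q_carrier[OF c(1)] by (simp add: nat_pow_mult[symmetric] m_ac)
    then show ?thesis using A_closed(4)[OF PA nc] True by simp
  next
    case False
    then have x: "x \<in> set l" using that by simp
    have "P [^] (n + k) \<otimes> x = P [^] n \<otimes> (P [^] k \<otimes> x)"
      using Q_carrier[OF c(2)[OF x]] by (simp add: nat_pow_mult[symmetric] m_ac)
    then show ?thesis using A_closed(4)[OF PA] k x by simp
  qed
  then show ?case by blast
qed simp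

text \<open>Multiplying an equation of degree n by a^(n-1) turns it into a monic one for a c. In
  terms of spans, a^(n-1) carries the powers of c below n into the span of the powers of a
  c.\<close>

lemma algebraic_scale_OL:
  assumes c: "c \<in> carrier L" and l: "set l \<subseteq> A" "a \<in> A" "a \<noteq> \<zero>" and e: "eval (a # l) c = \<zero>"
  shows "a \<otimes> c \<in> OL"
proof -
  let ?n = "length l" and ?d = "a \<otimes> c"
  have ac: "a \<in> carrier L" using A_carrier[OF l(2)] .
  have lc: "set l \<subseteq> carrier L" using l(1) A_carrier by blast
  have ev: "eval l c \<in> carrier L" by (rule eval_in_carrier[OF lc c])
  have e': "a \<otimes> c [^] ?n \<oplus> eval l c = \<zero>" using e by simp
  have "?n \<noteq> 0"
  proof
    assume "?n = 0"
    then have "a = \<zero>" using e' ac by simp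
    then show False using l by simp
  qed
  then obtain k where k: "?n = Suc k" by (cases ?n) auto
  have dc: "?d \<in> carrier L" using ac c by simp
  let ?B = "pows ?d ?n"
  have B: "set ?B \<subseteq> carrier L" by (rule pows_carrier[OF dc])
  have "Span A (pows c ?n) \<subseteq> {y \<in> carrier L. a [^] k \<otimes> y \<in> Span A ?B}"
  proof (rule subring_Span_least[OF A_subring])
    have "a [^] k \<otimes> c [^] i \<in> Span A ?B" if i: "i < ?n" for i
    proof -
      have "a [^] k = a [^] (k - i) \<otimes> a [^] i" using ac i k by (simp add: nat_pow_mult)
      then have "a [^] k \<otimes> c [^] i = a [^] (k - i) \<otimes> ?d [^] i"
        using ac c by (simp add: m_assoc nat_pow_distrib)
      moreover have "?d [^] i \<in> Span A ?B" using A_Span_mem[OF B] i by (auto simp: pows_def)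
      ultimately show ?thesis using A_Span_smult[OF B subring_pow[OF A_subring l(2)]] by simp
    qed
    then show "set (pows c ?n) \<subseteq> {y \<in> carrier L. a [^] k \<otimes> y \<in> Span A ?B}" using c by (auto simp: pows_def)
    show "\<zero> \<in> {y \<in> carrier L. a [^] k \<otimes> y \<in> Span A ?B}" using ac A_Span_zero[OF B] by simp
    show "x \<oplus> y \<in> {y \<in> carrier L. a [^] k \<otimes> y \<in> Span A ?B}"
      if "x \<in> {y \<in> carrier L. a [^] k \<otimes> y \<in> Span A ?B}" "y \<in> {y \<in> carrier L. a [^] k \<otimes> y \<in> Span A ?B}" for x y
      using that ac A_Span_add[OF B] by (simp add: r_distr)
    show "b \<otimes> x \<in> {y \<in> carrier L. a [^] k \<otimes> y \<in> Span A ?B}"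
      if b: "b \<in> A" and x: "x \<in> {y \<in> carrier L. a [^] k \<otimes> y \<in> Span A ?B}" for b x
    proof -
      have "a [^] k \<otimes> (b \<otimes> x) = b \<otimes> (a [^] k \<otimes> x)" using A_carrier[OF b] x ac by (simp add: m_lcomm)
      then show ?thesis using b x A_carrier[OF b] A_Span_smult[OF B b] by auto
    qed
  qed
  moreover have "eval l c \<in> Span A (pows c ?n)" unfolding Span_pows[OF A_subring] using l(1) by blast
  ultimately have "\<ominus> (a [^] k \<otimes> eval l c) \<in> Span A ?B" using A_Span_neg[OF B] by blast
  moreover have "?d [^] ?n = \<ominus> (a [^] k \<otimes> eval l c)"
  proof -
    have "?d [^] ?n = a [^] k \<otimes> (a \<otimes> c [^] ?n)"
      using ac c unfolding nat_pow_distrib[OF ac c] by (simp add: k m_ac)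
    moreover have "a \<otimes> c [^] ?n = \<ominus> eval l c"
      using e' ac c ev by (intro minus_equality[symmetric]) auto
    ultimately show ?thesis using ac ev by (simp add: r_minus)
  qed
  ultimately have "?d [^] ?n \<in> Span A ?B" by simp
  then show ?thesis using dc unfolding OL_iff by blast
qed

text \<open>An element of K is algebraic over Q. A power of \<open>P\<close> clears the denominators
  of its equation, the leading coefficient then makes the element integral, and that coefficient
  divides a power of \<open>P\<close>.\<close>

lemma K_subset_KU: "K \<subseteq> KU"
proof
  fix c assume cK: "c \<in> K"
  have c: "c \<in> carrier L" using K_carrier[OF cK] .
  have Q: "subfield Q L" using Q_subfield .
  have "(algebraic over Q) c"
    using finite_dimension_imp_algebraic[OF Q K_subring finite_ext cK] .
  then obtain f where f: "f \<in> carrier (Q[X])" "f \<noteq> []" "eval f c = \<zero>"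
    using algebraicE[OF Q_subring c] by blast
  then obtain a l where al: "f = a # l" "a \<noteq> \<zero>" "set f \<subseteq> Q"
    unfolding univ_poly_carrier[symmetric] polynomial_def by (cases f) auto
  obtain k :: nat where k: "\<forall>x\<in>set f. P [^] k \<otimes> x \<in> A" using Q_scale[OF al(3)] by blast
  let ?l = "map (\<lambda>x. P [^] k \<otimes> x) l" and ?a = "P [^] k \<otimes> a"
  have fc: "set f \<subseteq> carrier L" using al(3) Q_carrier by blast
  have "eval (map (\<lambda>x. P [^] k \<otimes> x) g) c = P [^] k \<otimes> eval g c" if "set g \<subseteq> carrier L" for g
    using that
  proof (induction g)
    case (Cons b g)
    then show ?case using c eval_in_carrier[of g c] by (simp add: r_distr m_assoc)
  qed simp
  from this[OF fc] have ev: "eval (?a # ?l) c = \<zero>" using f(3) unfolding al(1) by simp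
  have a: "?a \<in> A" "?a \<noteq> \<zero>" "set ?l \<subseteq> A"
    using k al fc pow_nonzero[OF _ P_nonzero] by (auto simp: integral_iff)
  have "?a \<otimes> c \<in> OL" by (rule algebraic_scale_OL[OF c a(3,1,2) ev])
  moreover have "?a \<otimes> c \<in> K" using subringE(6)[OF K_subring _ cK] a(1) A_subset_OK by (auto simp: OK_iff)
  ultimately have *: "?a \<otimes> c \<in> RU" using OK_RU by (auto simp: OK_iff)
  obtain n d where d: "d \<in> A" "P [^] (n::nat) = d \<otimes> ?a" using A_P_power[OF a(1,2)] by blast
  have "P [^] n \<otimes> c = d \<otimes> (?a \<otimes> c)"
    unfolding d(2) using A_carrier[OF d(1)] A_carrier[OF a(1)] c by (simp add: m_assoc)
  then have "P [^] n \<otimes> c \<in> RU" using RU_closed(4)[OF _ *] d(1) A_subset_RU by auto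
  then show "c \<in> KU" by (rule KU_I[OF c])
qed

end

section \<open>Extension of embeddings to an algebraic closure\<close>

context cring
begin

lemma eval_map2_add:
  assumes "length l = length m" "set l \<subseteq> carrier R" "set m \<subseteq> carrier R" "x \<in> carrier R"
  shows "eval (map2 (\<oplus>) l m) x = eval l x \<oplus> eval m x"
  using assms
proof (induction l m rule: list_induct2)
  case (Cons a l b m)
  have c: "a \<in> carrier R" "b \<in> carrier R" "eval l x \<in> carrier R" "eval m x \<in> carrier R" "x [^] length m \<in> carrier R"
    using Cons.prems eval_in_carrier by auto
  have "eval (map2 (\<oplus>) (a # l) (b # m)) x = (a \<oplus> b) \<otimes> x [^] length m \<oplus> eval (map2 (\<oplus>) l m) x"
    using Cons.hyps by simp
  also have "eval (map2 (\<oplus>) l m) x = eval l x \<oplus> eval m x"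
    using Cons.IH Cons.prems by auto
  also have "(a \<oplus> b) \<otimes> x [^] length m \<oplus> (eval l x \<oplus> eval m x)
      = (a \<otimes> x [^] length m \<oplus> eval l x) \<oplus> (b \<otimes> x [^] length m \<oplus> eval m x)"
    using c by algebra
  finally show ?case using Cons.hyps by simp
qed simp

lemma eval_map_smult:
  assumes "set l \<subseteq> carrier R" "x \<in> carrier R" "a \<in> carrier R"
  shows "eval (map (\<lambda>c. a \<otimes> c) l) x = a \<otimes> eval l x"
  using assms
proof (induction l)
  case (Cons b l)
  then show ?case using eval_in_carrier[of l x] by (simp add: r_distr m_assoc)
qed simp

lemma eval_append_zeros:
  assumes l: "set l \<subseteq> carrier R" and x: "x \<in> carrier R"
  shows "eval (l @ replicate k \<zero>) x = eval l x \<otimes> x [^] k"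
proof (induction k)
  case (Suc k)
  have e: "eval l x \<in> carrier R" by (rule eval_in_carrier[OF l x])
  have "set (l @ replicate k \<zero>) \<subseteq> carrier R" using l by (auto simp: set_replicate_conv_if)
  from eval_append_aux[OF this _ x, of \<zero>]
  have "eval ((l @ replicate k \<zero>) @ [\<zero>]) x = eval l x \<otimes> x [^] k \<otimes> x"
    using Suc e x by simp
  moreover have "(l @ replicate k \<zero>) @ [\<zero>] = l @ replicate (Suc k) \<zero>"
    by (simp add: replicate_append_same)
  ultimately show ?case using e x by (simp add: m_assoc)
qed (use eval_in_carrier[OF assms] in simp)

lemma eval_zeros: "set l \<subseteq> {\<zero>} \<Longrightarrow> x \<in> carrier R \<Longrightarrow> eval l x = \<zero>"
  by (induction l) auto

text \<open>One step of division by the monic polynomial \<open>\<one> # f\<close>: the leading term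
  of \<open>a # g\<close> is replaced by means of X^(length f) = - f. Padding with zeros aligns the
  product with the top of g.\<close>

definition reduce :: "'a \<Rightarrow> 'a list \<Rightarrow> 'a list \<Rightarrow> 'a list" where
  "reduce a f g = map2 (\<oplus>) g (map (\<lambda>c. \<ominus> a \<otimes> c) f @ replicate (length g - length f) \<zero>)"

lemma eval_reduce:
  assumes f: "set f \<subseteq> carrier R" "eval (\<one> # f) x = \<zero>" and g: "set g \<subseteq> carrier R"
    and x: "x \<in> carrier R" and a: "a \<in> carrier R" and le: "length f \<le> length g"
  shows "eval (reduce a f g) x = eval (a # g) x"
proof -
  let ?k = "length g - length f"
  have e: "eval f x \<in> carrier R" "eval g x \<in> carrier R"
    using eval_in_carrier f g x by auto
  have m: "set (map (\<lambda>c. \<ominus> a \<otimes> c) f) \<subseteq> carrier R" using f a by auto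
  then have "set (map (\<lambda>c. \<ominus> a \<otimes> c) f @ replicate ?k \<zero>) \<subseteq> carrier R"
    by (auto simp: set_replicate_conv_if)
  then have "eval (reduce a f g) x = eval g x \<oplus> eval (map (\<lambda>c. \<ominus> a \<otimes> c) f @ replicate ?k \<zero>) x"
    unfolding reduce_def using g x le by (intro eval_map2_add) auto
  also have "\<dots> = eval g x \<oplus> (\<ominus> a \<otimes> eval f x) \<otimes> x [^] ?k"
    using eval_append_zeros[OF m x] eval_map_smult[OF f(1) x, of "\<ominus> a"] a by simp
  finally have 1: "eval (reduce a f g) x = eval g x \<oplus> (\<ominus> a \<otimes> eval f x) \<otimes> x [^] ?k" .
  have "x [^] length f \<oplus> eval f x = \<zero>" using f x by simp
  then have xf: "x [^] length f = \<ominus> eval f x"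
    using e x by (intro minus_equality[symmetric]) auto
  have "x [^] length g = x [^] length f \<otimes> x [^] ?k" using x le by (simp add: nat_pow_mult)
  then have "a \<otimes> x [^] length g = a \<otimes> ((\<ominus> eval f x) \<otimes> x [^] ?k)" unfolding xf by simp
  also have "\<dots> = (\<ominus> a \<otimes> eval f x) \<otimes> x [^] ?k"
    using a e x by (simp add: l_minus r_minus m_assoc)
  finally show ?thesis unfolding 1 using e x a by (simp add: a_comm)
qed

end

context algebraic_closure
begin

lemma sub_carrier: "a \<in> K \<Longrightarrow> a \<in> carrier L"
  using subringE(1)[OF subfieldE(1)[OF subfield_axioms]] by blast

text \<open>Graphs of ring homomorphisms into \<open>L\<close> which are defined on a subring of \<open>L\<close> containing \<open>K\<close>
  and fix \<open>K\<close>.\<close>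

definition hom_graph :: "('a \<times> 'a) set \<Rightarrow> bool" where
  "hom_graph G \<longleftrightarrow> G \<subseteq> carrier L \<times> carrier L \<and> (\<forall>a\<in>K. (a, a) \<in> G) \<and>
    (\<forall>a b c d. (a, b) \<in> G \<longrightarrow> (c, d) \<in> G \<longrightarrow> (a \<oplus> c, b \<oplus> d) \<in> G \<and> (a \<otimes> c, b \<otimes> d) \<in> G) \<and>
    (\<forall>a b. (a, b) \<in> G \<longrightarrow> (\<ominus> a, \<ominus> b) \<in> G) \<and> (\<forall>b. (\<zero>, b) \<in> G \<longrightarrow> b = \<zero>)"

context
  fixes G assumes G: "hom_graph G"
begin

lemma hg_carrier: "(a, b) \<in> G \<Longrightarrow> a \<in> carrier L" "(a, b) \<in> G \<Longrightarrow> b \<in> carrier L"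
  and hg_refl: "a \<in> K \<Longrightarrow> (a, a) \<in> G"
  and hg_add: "(a, b) \<in> G \<Longrightarrow> (c, d) \<in> G \<Longrightarrow> (a \<oplus> c, b \<oplus> d) \<in> G"
  and hg_mult: "(a, b) \<in> G \<Longrightarrow> (c, d) \<in> G \<Longrightarrow> (a \<otimes> c, b \<otimes> d) \<in> G"
  and hg_neg: "(a, b) \<in> G \<Longrightarrow> (\<ominus> a, \<ominus> b) \<in> G"
  and hg_zero: "(\<zero>, b) \<in> G \<Longrightarrow> b = \<zero>"
  using G unfolding hom_graph_def by auto

lemma hg_0: "(\<zero>, \<zero>) \<in> G" and hg_1: "(\<one>, \<one>) \<in> G"
  using hg_refl subringE(2,3)[OF subfieldE(1)[OF subfield_axioms]] by auto

text \<open>The difference of two values at a is a value at zero, and the last condition of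
  \<open>hom_graph\<close> excludes nonzero ones.\<close>

lemma hg_unique:
  assumes "(a, b) \<in> G" "(a, c) \<in> G" shows "b = c"
proof -
  have "(a \<oplus> (\<ominus> a), b \<oplus> (\<ominus> c)) \<in> G" using hg_add[OF assms(1) hg_neg[OF assms(2)]] .
  then have "b \<ominus> c = \<zero>" using hg_zero hg_carrier assms by (simp add: r_neg a_minus_def)
  then show ?thesis using hg_carrier(2) assms r_right_minus_eq by blast
qed

lemma hg_pow: "(a, b) \<in> G \<Longrightarrow> (a [^] (n::nat), b [^] n) \<in> G"
  by (induction n) (auto simp: hg_1 hg_mult)

lemma hg_list_carrier:
  "set g \<subseteq> G \<Longrightarrow> set (map fst g) \<subseteq> carrier L" "set g \<subseteq> G \<Longrightarrow> set (map snd g) \<subseteq> carrier L"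
  by (auto dest!: subsetD intro: hg_carrier)

lemma hg_eval: "(x, y) \<in> G \<Longrightarrow> set g \<subseteq> G \<Longrightarrow> (eval (map fst g) x, eval (map snd g) y) \<in> G"
proof (induction g)
  case Nil
  then show ?case by (simp add: hg_0)
next
  case (Cons ab g)
  obtain a b where ab: "ab = (a, b)" by fastforce
  show ?case
    using hg_add[OF hg_mult[OF _ hg_pow[OF Cons.prems(1)]] Cons.IH[OF Cons.prems(1)], of a b "length g"]
      Cons.prems(2) by (simp add: ab)
qed

text \<open>The domain of a graph is a ring between K and \<open>L\<close>. Since a is algebraic
  over K, its inverse is a polynomial in a over K, so this ring is a field.\<close>

lemma hg_inverse:
  assumes ab: "(a, b) \<in> G" "a \<noteq> \<zero>"
  shows "\<exists>c. (inv a, c) \<in> G"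
proof -
  have ac: "a \<in> carrier L" using hg_carrier ab by blast
  have Ks: "subring K L" using subfieldE(1)[OF subfield_axioms] .
  obtain f where f: "f \<in> carrier (K[X])" "f \<noteq> []" "eval f a = \<zero>"
    using algebraicE[OF Ks ac algebraic_extension[OF ac]] by blast
  have "set f \<subseteq> K" "f \<noteq> []" "hd f \<noteq> \<zero>" "eval f a = \<zero>"
    using f unfolding univ_poly_carrier[symmetric] polynomial_def by auto
  then have "\<exists>g c. set g \<subseteq> K \<and> c \<in> K \<and> c \<noteq> \<zero> \<and> eval g a \<otimes> a = c"
  proof (induction f rule: rev_induct)
    case (snoc c f)
    have fc: "set f \<subseteq> carrier L" "c \<in> carrier L" "c \<in> K" using snoc.prems(1) sub_carrier by auto
    have e: "eval f a \<in> carrier L" by (rule eval_in_carrier[OF fc(1) ac])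
    have 0: "eval f a \<otimes> a \<oplus> c = \<zero>" using eval_append_aux[OF fc(1,2) ac] snoc.prems by simp
    show ?case
    proof (cases "c = \<zero>")
      case True
      then have "eval f a = \<zero>" using 0 e ac ab(2) integral[of "eval f a" a] by auto
      moreover have "f \<noteq> []" using snoc.prems True by auto
      ultimately show ?thesis using snoc by auto
    next
      case False
      have "eval f a \<otimes> a = \<ominus> c" using 0 e ac fc by (intro minus_equality[symmetric]) auto
      moreover have "\<ominus> c \<in> K" using subringE(5)[OF Ks] fc by auto
      moreover have "\<ominus> c \<noteq> \<zero>" using False fc by (metis minus_minus minus_zero)
      ultimately show ?thesis using snoc.prems(1) by (intro exI[of _ f] exI[of _ "\<ominus> c"]) auto
    qed
  qed simp
  then obtain g c where g: "set g \<subseteq> K" "c \<in> K" "c \<noteq> \<zero>" "eval g a \<otimes> a = c" by blast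
  have gc: "set g \<subseteq> carrier L" using g sub_carrier by blast
  have e: "eval g a \<in> carrier L" by (rule eval_in_carrier[OF gc ac])
  have ic: "inv c \<in> K" "inv c \<otimes> c = \<one>" "inv c \<in> carrier L"
    using subfield_m_inv[OF subfield_axioms, of c] g sub_carrier by auto
  have "inv c \<otimes> eval g a \<otimes> a = \<one>" using g(4) ic e ac by (simp add: m_assoc)
  then have ia: "inv a = inv c \<otimes> eval g a"
    using e ic ac by (intro comm_inv_char[of a]) (auto simp: m_comm)
  have "set (map (\<lambda>x. (x, x)) g) \<subseteq> G" using g(1) hg_refl by auto
  from hg_eval[OF ab(1) this] have "(eval g a, eval g b) \<in> G" by (simp add: comp_def)
  then have "(inv c \<otimes> eval g a, inv c \<otimes> eval g b) \<in> G" using hg_mult hg_refl ic(1) by blast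
  then show ?thesis using ia by auto
qed

section \<open>Adjoining one element to the domain of a graph\<close>

context
  fixes x y f
  assumes x: "x \<in> carrier L" and y: "y \<in> carrier L" and f: "set f \<subseteq> G"
    and fx: "eval (\<one> # map fst f) x = \<zero>" and fy: "eval (\<one> # map snd f) y = \<zero>"
    and indep: "\<And>g. set g \<subseteq> G \<Longrightarrow> length g \<le> length f \<Longrightarrow> eval (map fst g) x = \<zero> \<Longrightarrow>
      set (map fst g) \<subseteq> {\<zero>}"
begin

text \<open>Well-definedness of the extension. A relation with more than \<open>length f\<close>
  coefficients is shortened by dividing by the monic polynomial on both sides at once; a shorter one
  has only zero coefficients by \<open>indep\<close>, and so has its image.\<close>

lemma hg_eval_zero:
  "set g \<subseteq> G \<Longrightarrow> eval (map fst g) x = \<zero> \<Longrightarrow> eval (map snd g) y = \<zero>"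
proof (induction "length g" arbitrary: g rule: less_induct)
  case less
  show ?case
  proof (cases "length g \<le> length f")
    case True
    then have z: "set (map fst g) \<subseteq> {\<zero>}" using indep less.prems by blast
    have "b = \<zero>" if "(a, b) \<in> set g" for a b
    proof -
      have "a = \<zero>" using z that by force
      then show ?thesis using hg_zero less.prems(1) that by blast
    qed
    then have "set (map snd g) \<subseteq> {\<zero>}" by auto
    then show ?thesis using y by (rule eval_zeros)
  next
    case False
    then obtain ab h where "g = ab # h" by (cases g) auto
    then obtain a b where g: "g = (a, b) # h" by (cases ab) auto
    have le: "length f \<le> length h" using False g by simp
    have ab: "(a, b) \<in> G" "set h \<subseteq> G" using less.prems g by auto
    have abc: "a \<in> carrier L" "b \<in> carrier L" using hg_carrier ab(1) by auto
    let ?k = "length h - length f"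
    \<comment> \<open>The pairs carry both division steps in parallel: first components reduce the
      relation for x, second components its image for y.\<close>
    define F where "F = map (\<lambda>(c, d). (\<ominus> a \<otimes> c, \<ominus> b \<otimes> d)) f @ replicate ?k (\<zero>, \<zero>)"
    define g' where "g' = map2 (\<lambda>(a, b) (c, d). (a \<oplus> c, b \<oplus> d)) h F"
    have len: "length F = length h" using le by (simp add: F_def)
    have F: "set F \<subseteq> G"
      using f hg_mult[OF hg_neg[OF ab(1)]] hg_0 by (auto simp: F_def set_replicate_conv_if)
    have fst': "map fst g' = reduce a (map fst f) (map fst h)"
      unfolding g'_def F_def reduce_def
      by (rule nth_equalityI) (use le in \<open>auto simp: nth_append split_beta\<close>)
    have snd': "map snd g' = reduce b (map snd f) (map snd h)"
      unfolding g'_def F_def reduce_def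
      by (rule nth_equalityI) (use le in \<open>auto simp: nth_append split_beta\<close>)
    have g'G: "set g' \<subseteq> G"
    proof
      fix z assume "z \<in> set g'"
      then obtain i where i: "i < length h" "z = g' ! i" using len by (auto simp: g'_def in_set_conv_nth)
      obtain c d c' d' where cd: "h ! i = (c, d)" "F ! i = (c', d')" by fastforce
      have "(c, d) \<in> G" using ab(2) i(1) cd(1) by (metis nth_mem subset_iff)
      moreover have "(c', d') \<in> G" using F i(1) cd(2) len nth_mem[of i F] by auto
      moreover have "z = (c \<oplus> c', d \<oplus> d')" unfolding i(2) g'_def using i(1) len cd by simp
      ultimately show "z \<in> G" using hg_add by blast
    qed
    have ex: "eval (map fst g') x = eval (map fst g) x"
      unfolding fst' using eval_reduce[OF hg_list_carrier(1)[OF f] fx hg_list_carrier(1)[OF ab(2)] x abc(1)]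
        le by (simp add: g)
    have ey: "eval (map snd g') y = eval (map snd g) y"
      unfolding snd' using eval_reduce[OF hg_list_carrier(2)[OF f] fy hg_list_carrier(2)[OF ab(2)] y abc(2)]
        le by (simp add: g)
    have "length g' < length g" using len by (simp add: g'_def g)
    then have "eval (map snd g') y = \<zero>" using less.hyps[OF _ g'G] ex less.prems(2) by simp
    then show ?thesis using ey by simp
  qed
qed

definition adjoin :: "('a \<times> 'a) set" where
  "adjoin = {(eval (map fst g) x, eval (map snd g) y) | g. set g \<subseteq> G}"

lemma adjoinI: "set g \<subseteq> G \<Longrightarrow> (eval (map fst g) x, eval (map snd g) y) \<in> adjoin"
  unfolding adjoin_def by blast

lemma adjoin_carrier: "(a, b) \<in> adjoin \<Longrightarrow> a \<in> carrier L \<and> b \<in> carrier L"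
  using eval_in_carrier x y hg_list_carrier unfolding adjoin_def by blast

lemma adjoin_base: "G \<subseteq> adjoin"
proof clarify
  fix a b assume "(a, b) \<in> G"
  then show "(a, b) \<in> adjoin" using adjoinI[of "[(a, b)]"] hg_carrier x y by simp
qed

lemma adjoin_gen: "(x, y) \<in> adjoin"
  using adjoinI[of "[(\<one>, \<one>), (\<zero>, \<zero>)]"] hg_0 hg_1 x y by simp

lemma adjoin_add:
  assumes "(a, b) \<in> adjoin" "(c, d) \<in> adjoin"
  shows "(a \<oplus> c, b \<oplus> d) \<in> adjoin"
proof -
  obtain g where g: "set g \<subseteq> G" "a = eval (map fst g) x" "b = eval (map snd g) y"
    using assms(1) unfolding adjoin_def by blast
  obtain h where h: "set h \<subseteq> G" "c = eval (map fst h) x" "d = eval (map snd h) y"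
    using assms(2) unfolding adjoin_def by blast
  define n where "n = max (length g) (length h)"
  \<comment> \<open>Leading zeros bring both lists to the same length without changing the
    values.\<close>
  define g1 where "g1 = replicate (n - length g) (\<zero>, \<zero>) @ g"
  define h1 where "h1 = replicate (n - length h) (\<zero>, \<zero>) @ h"
  have s: "set g1 \<subseteq> G" "set h1 \<subseteq> G" "length g1 = n" "length h1 = n"
    using g h hg_0 by (auto simp: g1_def h1_def n_def set_replicate_conv_if)
  have ev: "eval (map fst g1) x = a" "eval (map snd g1) y = b" "eval (map fst h1) x = c" "eval (map snd h1) y = d"
    using g h x y hg_list_carrier eval_replicate by (auto simp: g1_def h1_def)
  let ?k = "map2 (\<lambda>(a, b) (c, d). (a \<oplus> c, b \<oplus> d)) g1 h1"
  have f: "map fst ?k = map2 (\<oplus>) (map fst g1) (map fst h1)" "map snd ?k = map2 (\<oplus>) (map snd g1) (map snd h1)"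
    by (rule nth_equalityI; auto simp: split_beta s)+
  have "set ?k \<subseteq> G"
  proof
    fix z assume "z \<in> set ?k"
    then obtain i where i: "i < n" "z = ?k ! i" using s by (auto simp: in_set_conv_nth)
    obtain c d c' d' where cd: "g1 ! i = (c, d)" "h1 ! i = (c', d')" by fastforce
    have "(c, d) \<in> G" using s i(1) cd(1) by (metis nth_mem subset_iff)
    moreover have "(c', d') \<in> G" using s i(1) cd(2) by (metis nth_mem subset_iff)
    moreover have "z = (c \<oplus> c', d \<oplus> d')" unfolding i(2) using i(1) s cd by simp
    ultimately show "z \<in> G" using hg_add by blast
  qed
  from adjoinI[OF this] show ?thesis
    unfolding f using s ev x y hg_list_carrier[OF s(1)] hg_list_carrier[OF s(2)]
    by (simp add: eval_map2_add)
qed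

lemma adjoin_smult:
  assumes "(a, b) \<in> G" "(c, d) \<in> adjoin"
  shows "(a \<otimes> c, b \<otimes> d) \<in> adjoin"
proof -
  obtain h where h: "set h \<subseteq> G" "c = eval (map fst h) x" "d = eval (map snd h) y"
    using assms(2) unfolding adjoin_def by blast
  let ?h = "map (\<lambda>(c, d). (a \<otimes> c, b \<otimes> d)) h"
  have "set ?h \<subseteq> G" using h(1) hg_mult[OF assms(1)] by auto
  moreover have "map fst ?h = map (\<lambda>c. a \<otimes> c) (map fst h)" "map snd ?h = map (\<lambda>c. b \<otimes> c) (map snd h)"
    by auto
  ultimately show ?thesis
    using adjoinI[of ?h] eval_map_smult hg_list_carrier[OF h(1)] x y hg_carrier[OF assms(1)] h by metis
qed

text \<open>Multiplication by the generator appends a zero constant coefficient on both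
  sides.\<close>

lemma adjoin_mult_gen:
  assumes "(c, d) \<in> adjoin"
  shows "(c \<otimes> x, d \<otimes> y) \<in> adjoin"
proof -
  obtain h where h: "set h \<subseteq> G" "c = eval (map fst h) x" "d = eval (map snd h) y"
    using assms unfolding adjoin_def by blast
  have "set (h @ [(\<zero>, \<zero>)]) \<subseteq> G" using h(1) hg_0 by auto
  from adjoinI[OF this] show ?thesis
    using eval_append_aux[OF hg_list_carrier(1)[OF h(1)] _ x, of \<zero>]
      eval_append_aux[OF hg_list_carrier(2)[OF h(1)] _ y, of \<zero>] h x y
      adjoin_carrier[OF assms] by simp
qed

lemma adjoin_mult:
  assumes "(a, b) \<in> adjoin" "(c, d) \<in> adjoin"
  shows "(a \<otimes> c, b \<otimes> d) \<in> adjoin"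
proof -
  have abc: "a \<in> carrier L" "b \<in> carrier L" using adjoin_carrier[OF assms(1)] by auto
  have pw: "(a \<otimes> x [^] n, b \<otimes> y [^] n) \<in> adjoin" for n :: nat
  proof (induction n)
    case (Suc n)
    then show ?case using adjoin_mult_gen[OF Suc] abc x y by (simp add: m_assoc)
  qed (use assms(1) abc in simp)
  obtain h where h: "set h \<subseteq> G" "c = eval (map fst h) x" "d = eval (map snd h) y"
    using assms(2) unfolding adjoin_def by blast
  have "(a \<otimes> eval (map fst h) x, b \<otimes> eval (map snd h) y) \<in> adjoin"
    using h(1)
  proof (induction h)
    case Nil
    have "(\<zero>, \<zero>) \<in> adjoin" using adjoin_base hg_0 by blast
    then show ?case using abc by simp
  next
    case (Cons uv h)
    obtain u v where uv: "uv = (u, v)" "(u, v) \<in> G" using Cons.prems by (cases uv) auto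
    have c: "u \<in> carrier L" "v \<in> carrier L" using hg_carrier uv(2) by auto
    have hh: "set h \<subseteq> G" using Cons.prems by simp
    have e: "eval (map fst h) x \<in> carrier L" "eval (map snd h) y \<in> carrier L"
      using eval_in_carrier hg_list_carrier[OF hh] x y by auto
    have "(u \<otimes> (a \<otimes> x [^] length h) \<oplus> a \<otimes> eval (map fst h) x,
           v \<otimes> (b \<otimes> y [^] length h) \<oplus> b \<otimes> eval (map snd h) y) \<in> adjoin"
      by (intro adjoin_add adjoin_smult[OF uv(2)] pw Cons.IH[OF hh])
    moreover have "u \<otimes> (a \<otimes> x [^] length h) = a \<otimes> (u \<otimes> x [^] length h)"
      "v \<otimes> (b \<otimes> y [^] length h) = b \<otimes> (v \<otimes> y [^] length h)"
      using c abc x y by (simp_all add: m_lcomm)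
    ultimately show ?case using c abc x y e by (simp add: uv(1) r_distr)
  qed
  then show ?thesis using h by simp
qed

lemma adjoin_hom_graph: "hom_graph adjoin"
proof -
  have neg: "(\<ominus> a, \<ominus> b) \<in> adjoin" if ab: "(a, b) \<in> adjoin" for a b
    using adjoin_smult[OF hg_neg[OF hg_1] ab] adjoin_carrier[OF ab] by (simp add: l_minus)
  have zero: "b = \<zero>" if b: "(\<zero>, b) \<in> adjoin" for b
  proof -
    obtain h where h: "set h \<subseteq> G" "\<zero> = eval (map fst h) x" "b = eval (map snd h) y"
      using b unfolding adjoin_def by blast
    then show ?thesis using hg_eval_zero[OF h(1)] by simp
  qed
  show ?thesis
    unfolding hom_graph_def
  proof (intro conjI allI impI ballI)
    show "adjoin \<subseteq> carrier L \<times> carrier L" using adjoin_carrier by auto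
    show "(a, a) \<in> adjoin" if "a \<in> K" for a using that adjoin_base hg_refl by blast
  qed (fact adjoin_add adjoin_mult neg zero)+
qed

end

end

lemma hom_graph_extend:
  assumes "hom_graph G" "x \<in> carrier L" "y \<in> carrier L" "set f \<subseteq> G"
    "eval (\<one> # map fst f) x = \<zero>" "eval (\<one> # map snd f) y = \<zero>"
    "\<And>g. set g \<subseteq> G \<Longrightarrow> length g \<le> length f \<Longrightarrow> eval (map fst g) x = \<zero> \<Longrightarrow>
      set (map fst g) \<subseteq> {\<zero>}"
  shows "\<exists>G'. hom_graph G' \<and> G \<subseteq> G' \<and> (x, y) \<in> G'"
  using adjoin_hom_graph[OF assms] adjoin_base[OF assms] adjoin_gen[OF assms] by blast

text \<open>f comes from a monic relation of least length for x over the field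
  \<open>Domain G\<close>, in effect the minimal polynomial, and y is any root of the image of that
  polynomial.\<close>

lemma hom_graph_extend_element:
  assumes G: "hom_graph G" and x: "x \<in> carrier L"
  shows "\<exists>G' y. hom_graph G' \<and> G \<subseteq> G' \<and> (x, y) \<in> G'"
proof -
  define Z where "Z n \<longleftrightarrow> (\<exists>f. set f \<subseteq> G \<and> length f = n \<and> eval (\<one> # map fst f) x = \<zero>)" for n
  have Ks: "subring K L" using subfieldE(1)[OF subfield_axioms] .
  have "\<exists>n. Z n"
  proof -
    obtain f where f: "f \<in> carrier (K[X])" "f \<noteq> []" "eval f x = \<zero>"
      using algebraicE[OF Ks x algebraic_extension[OF x]] by blast
    then obtain a l where al: "f = a # l" "a \<noteq> \<zero>" "a \<in> K" "set l \<subseteq> K"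
      unfolding univ_poly_carrier[symmetric] polynomial_def by (cases f) auto
    have ia: "inv a \<in> K" "inv a \<otimes> a = \<one>" "inv a \<in> carrier L"
      using subfield_m_inv[OF subfield_axioms, of a] al sub_carrier by auto
    let ?l = "map (\<lambda>c. inv a \<otimes> c) l"
    have fc: "set f \<subseteq> carrier L" using al sub_carrier by auto
    have "eval (map (\<lambda>c. inv a \<otimes> c) f) x = \<zero>"
      using eval_map_smult[OF fc x ia(3)] f(3) ia(3) by simp
    then have "eval (\<one> # ?l) x = \<zero>" using ia(2) by (simp add: al(1))
    moreover have "set ?l \<subseteq> K" using al ia subringE(6)[OF Ks] by auto
    ultimately have "set (map (\<lambda>c. (c, c)) ?l) \<subseteq> G \<and> length (map (\<lambda>c. (c, c)) ?l) = length l \<and>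
        eval (\<one> # map fst (map (\<lambda>c. (c, c)) ?l)) x = \<zero>"
      using hg_refl[OF G] by (auto simp: comp_def)
    then show ?thesis unfolding Z_def by blast
  qed
  then have "Z (LEAST n. Z n)" by (metis LeastI)
  then obtain f where f: "set f \<subseteq> G" "length f = (LEAST n. Z n)" "eval (\<one> # map fst f) x = \<zero>"
    unfolding Z_def by blast
  have "f \<noteq> []" using f(3) x by auto
  then obtain y where y: "y \<in> carrier L" "eval (\<one> # map snd f) y = \<zero>"
    using monic_root_exists[of "map snd f"] hg_list_carrier(2)[OF G f(1)] by auto
  have "set (map fst g) \<subseteq> {\<zero>}"
    if "set g \<subseteq> G" "length g \<le> length f" "eval (map fst g) x = \<zero>" for g
    using that
  proof (induction g)
    case (Cons ab g)
    obtain a b where ab: "ab = (a, b)" "(a, b) \<in> G" using Cons.prems by (cases ab) auto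
    have gG: "set g \<subseteq> G" using Cons.prems by simp
    have ac: "a \<in> carrier L" using hg_carrier(1)[OF G ab(2)] .
    have gc: "set (map fst g) \<subseteq> carrier L" using hg_list_carrier(1)[OF G gG] .
    show ?case
    proof (cases "a = \<zero>")
      case True
      then have "eval (map fst g) x = \<zero>"
        using Cons.prems(3) x eval_in_carrier[OF gc x] by (simp add: ab(1))
      then show ?thesis using Cons True ab by auto
    next
      \<comment> \<open>A nonzero leading coefficient could be inverted in the domain of G, giving a
        monic relation of degree \<open>length g\<close>, below the minimal degree.\<close>
      case False
      then obtain c where c: "(inv a, c) \<in> G" using hg_inverse[OF G ab(2)] by blast
      have ia: "inv a \<in> carrier L" "inv a \<otimes> a = \<one>" using False ac field_Units by auto
      let ?h = "map (\<lambda>(u, v). (inv a \<otimes> u, c \<otimes> v)) g"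
      have "set ?h \<subseteq> G" using gG hg_mult[OF G c] by auto
      moreover have mf: "map fst ?h = map (\<lambda>u. inv a \<otimes> u) (map fst g)" by auto
      have "eval (map (\<lambda>u. inv a \<otimes> u) (a # map fst g)) x = \<zero>"
        using eval_map_smult[of "a # map fst g" x "inv a"] ac gc x ia Cons.prems(3) by (simp add: ab(1))
      then have "eval (\<one> # map fst ?h) x = \<zero>" unfolding mf using ia(2) by simp
      ultimately have "Z (length g)" unfolding Z_def by (intro exI[of _ ?h]) simp
      then have "length f \<le> length g" unfolding f(2) by (rule Least_le)
      then show ?thesis using Cons.prems(2) by simp
    qed
  qed simp
  then show ?thesis using hom_graph_extend[OF G x y(1) f(1,3) y(2)] by blast
qed

text \<open>Zorn's lemma: each closure condition involves at most two pairs, so the union of a chain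
  is again a graph, and a maximal graph has full domain by the one-element extension.\<close>

lemma hom_graph_total:
  assumes "hom_graph G"
  shows "\<exists>G'. hom_graph G' \<and> G \<subseteq> G' \<and> Domain G' = carrier L"
proof -
  let ?S = "{G'. hom_graph G' \<and> G \<subseteq> G'}"
  have "\<exists>M\<in>?S. \<forall>Y\<in>?S. M \<subseteq> Y \<longrightarrow> Y = M"
  proof (rule subset_Zorn_nonempty)
    show "?S \<noteq> {}" using assms by blast
    fix C assume C: "C \<noteq> {}" "subset.chain ?S C"
    then have CS: "\<And>G'. G' \<in> C \<Longrightarrow> hom_graph G' \<and> G \<subseteq> G'" by (auto simp: subset.chain_def)
    have two: "\<exists>H\<in>C. u \<in> H \<and> v \<in> H" if uv: "u \<in> \<Union>C" "v \<in> \<Union>C" for u v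
    proof -
      obtain H1 H2 where H: "H1 \<in> C" "u \<in> H1" "H2 \<in> C" "v \<in> H2" using uv by blast
      have "H1 \<subseteq> H2 \<or> H2 \<subseteq> H1" using C(2) H by (auto simp: subset_chain_def)
      then show ?thesis using H by blast
    qed
    have "hom_graph (\<Union>C)"
      unfolding hom_graph_def
    proof (intro conjI allI impI ballI)
      show "\<Union>C \<subseteq> carrier L \<times> carrier L" using CS unfolding hom_graph_def by blast
      fix a assume "a \<in> K"
      then show "(a, a) \<in> \<Union>C" using CS C(1) unfolding hom_graph_def by blast
    next
      fix a b c d assume "(a, b) \<in> \<Union>C" "(c, d) \<in> \<Union>C"
      then obtain H where H: "H \<in> C" "(a, b) \<in> H" "(c, d) \<in> H" using two by blast
      then show "(a \<oplus> c, b \<oplus> d) \<in> \<Union>C" "(a \<otimes> c, b \<otimes> d) \<in> \<Union>C"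
        using hg_add hg_mult CS by blast+
    next
      fix a b assume "(a, b) \<in> \<Union>C"
      then show "(\<ominus> a, \<ominus> b) \<in> \<Union>C" using hg_neg CS by blast
    next
      fix b assume "(\<zero>, b) \<in> \<Union>C"
      then show "b = \<zero>" using hg_zero CS by blast
    qed
    moreover have "G \<subseteq> \<Union>C" using C(1) CS by blast
    ultimately show "\<Union>C \<in> ?S" by blast
  qed
  then obtain M where MS: "M \<in> ?S" and max: "\<And>Y. Y \<in> ?S \<Longrightarrow> M \<subseteq> Y \<Longrightarrow> Y = M"
    by (elim bexE) simp
  have M: "hom_graph M" "G \<subseteq> M" using MS by auto
  have "x \<in> Domain M" if x: "x \<in> carrier L" for x
  proof -
    obtain Y y where Y: "hom_graph Y" "M \<subseteq> Y" "(x, y) \<in> Y"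
      using hom_graph_extend_element[OF M(1) x] by (elim exE conjE)
    then have "Y = M" using M(2) by (intro max) auto
    then show ?thesis using Y(3) by blast
  qed
  moreover have "Domain M \<subseteq> carrier L" using hg_carrier(1)[OF M(1)] by blast
  ultimately show ?thesis using M by blast
qed

text \<open>A total graph is an injective endomorphism of \<open>L\<close> over K. It is onto
  because it permutes the finite set of roots of each nonzero polynomial over K, and every element
  of \<open>L\<close> is such a root.\<close>

theorem hom_graph_automorphism:
  assumes "hom_graph G0"
  shows "\<exists>\<sigma>\<in>Bij (carrier L). \<sigma> \<in> ring_hom L L \<and> (\<forall>(a, b)\<in>G0. \<sigma> a = b)"
proof -
  obtain G where G: "hom_graph G" "G0 \<subseteq> G" "Domain G = carrier L"
    using hom_graph_total[OF assms] by blast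
  define s where "s = (\<lambda>x\<in>carrier L. THE y. (x, y) \<in> G)"
  have sI: "s a = b" if "(a, b) \<in> G" for a b
  proof -
    have "(THE y. (a, y) \<in> G) = b" using that hg_unique[OF G(1)] by blast
    then show ?thesis using hg_carrier(1)[OF G(1) that] by (simp add: s_def)
  qed
  have sG: "(x, s x) \<in> G" if "x \<in> carrier L" for x
    using that G(3) sI by blast
  have sc: "s x \<in> carrier L" if "x \<in> carrier L" for x using hg_carrier(2)[OF G(1) sG[OF that]] .
  have hom: "s \<in> ring_hom L L"
  proof (rule ring_hom_memI)
    fix x y assume xy: "x \<in> carrier L" "y \<in> carrier L"
    show "s x \<in> carrier L" using sc xy by blast
    show "s (x \<otimes> y) = s x \<otimes> s y" using sI[OF hg_mult[OF G(1) sG sG]] xy by blast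
    show "s (x \<oplus> y) = s x \<oplus> s y" using sI[OF hg_add[OF G(1) sG sG]] xy by blast
  next
    show "s \<one> = \<one>" using sI[OF hg_1[OF G(1)]] .
  qed
  have inj: "inj_on s (carrier L)"
  proof (rule inj_onI)
    fix x y assume xy: "x \<in> carrier L" "y \<in> carrier L" "s x = s y"
    have "(x \<oplus> (\<ominus> y), s x \<oplus> (\<ominus> s y)) \<in> G" using hg_add[OF G(1) sG hg_neg[OF G(1) sG]] xy by blast
    then have d: "(x \<ominus> y, \<zero>) \<in> G" using xy sc by (simp add: a_minus_def r_neg)
    show "x = y"
    proof (rule ccontr)
      assume "x \<noteq> y"
      then have nz: "x \<ominus> y \<noteq> \<zero>" using xy r_right_minus_eq by blast
      then obtain c where c: "(inv (x \<ominus> y), c) \<in> G" using hg_inverse[OF G(1) d] by blast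
      have "(inv (x \<ominus> y) \<otimes> (x \<ominus> y), c \<otimes> \<zero>) \<in> G" using hg_mult[OF G(1) c d] .
      moreover have "inv (x \<ominus> y) \<otimes> (x \<ominus> y) = \<one>" using nz xy field_Units by simp
      ultimately have "(\<one>, \<zero>) \<in> G" using hg_carrier(2)[OF G(1) c] by simp
      from hg_unique[OF G(1) hg_1[OF G(1)] this] show False by simp
    qed
  qed
  have surj: "s ` carrier L = carrier L"
  proof
    show "s ` carrier L \<subseteq> carrier L" using sc by blast
    show "carrier L \<subseteq> s ` carrier L"
    proof
      fix y assume y: "y \<in> carrier L"
      have Ks: "subring K L" using subfieldE(1)[OF subfield_axioms] .
      obtain f where f: "f \<in> carrier (K[X])" "f \<noteq> []" "eval f y = \<zero>"
        using algebraicE[OF Ks y algebraic_extension[OF y]] by blast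
      have fK: "set f \<subseteq> K" using f(1,2) unfolding univ_poly_carrier[symmetric] polynomial_def by auto
      have "f \<in> carrier (poly_ring L)"
        using f(1,2) sub_carrier unfolding univ_poly_carrier[symmetric] polynomial_def by auto
      then have fin: "finite {z. is_root f z}" by (rule finite_number_of_roots)
      let ?Z = "{z. is_root f z}"
      have "s ` ?Z \<subseteq> ?Z"
      proof clarify
        fix z assume z: "is_root f z"
        then have zc: "z \<in> carrier L" "eval f z = \<zero>" by (auto simp: is_root_def)
        have "set (map (\<lambda>c. (c, c)) f) \<subseteq> G" using fK hg_refl[OF G(1)] by auto
        from hg_eval[OF G(1) sG[OF zc(1)] this] have "(\<zero>, eval f (s z)) \<in> G"
          using zc(2) by (simp add: comp_def)
        then show "is_root f (s z)" using hg_zero[OF G(1)] sc[OF zc(1)] f(2) by (simp add: is_root_def)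
      qed
      moreover have "inj_on s ?Z" using inj by (rule inj_on_subset) (auto simp: is_root_def)
      ultimately have "s ` ?Z = ?Z" using fin by (metis endo_inj_surj)
      moreover have "y \<in> ?Z" using y f by (simp add: is_root_def)
      ultimately have "y \<in> s ` ?Z" by simp
      then show "y \<in> s ` carrier L" by (auto simp: is_root_def)
    qed
  qed
  have "s \<in> Bij (carrier L)"
    using inj surj by (auto simp: Bij_def bij_betw_def s_def)
  then show ?thesis using hom sI G(2) by blast
qed

end

section \<open>Eisenstein polynomials for roots of unity of \<open>p\<close>-power order\<close>

lemma prime_dvd_add_power:
  fixes a b :: "'a :: comm_ring_1"
  assumes p: "Factorial_Ring.prime p"
  shows "of_nat p dvd (a + b) ^ p - (a ^ p + b ^ p)"
proof -
  let ?t = "\<lambda>k. of_nat (p choose k) * a ^ k * b ^ (p - k)"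
  have p0: "p > 0" using prime_gt_0_nat[OF p] .
  have "{..p} = insert 0 (insert p {1..<p})" by auto
  then have "(a + b) ^ p = (\<Sum>k\<in>insert 0 (insert p {1..<p}). ?t k)" by (simp add: binomial_ring)
  also have "\<dots> = b ^ p + (a ^ p + (\<Sum>k\<in>{1..<p}. ?t k))" using p0 by simp
  finally have "(a + b) ^ p - (a ^ p + b ^ p) = (\<Sum>k\<in>{1..<p}. ?t k)" by simp
  moreover have "of_nat p dvd (\<Sum>k\<in>{1..<p}. ?t k)"
  proof (intro dvd_sum dvd_mult2)
    fix k assume "k \<in> {1..<p}"
    then have "p dvd (p choose k)" using p by (intro dvd_choose_prime) auto
    then show "(of_nat p :: 'a) dvd of_nat (p choose k)" by (auto elim!: dvdE)
  qed
  ultimately show ?thesis by simp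
qed

text \<open>Induction on k: a congruence modulo p persists under p-th powers, since y - z divides
  y^p - z^p.\<close>

lemma prime_dvd_one_plus_power:
  fixes x :: "'a :: comm_ring_1"
  assumes p: "Factorial_Ring.prime p"
  shows "of_nat p dvd (1 + x) ^ (p ^ k) - (1 + x ^ (p ^ k))"
proof (induction k)
  case (Suc k)
  let ?y = "(1 + x) ^ (p ^ k)" and ?z = "1 + x ^ (p ^ k)"
  have "of_nat p dvd ?y ^ p - ?z ^ p"
    using Suc dvd_trans[OF Suc, of "?y ^ p - ?z ^ p"] by (simp add: power_diff_sumr2)
  moreover have "of_nat p dvd ?z ^ p - (1 ^ p + (x ^ (p ^ k)) ^ p)" by (rule prime_dvd_add_power[OF p])
  ultimately have "of_nat p dvd (?y ^ p - ?z ^ p) + (?z ^ p - (1 ^ p + (x ^ (p ^ k)) ^ p))" by (rule dvd_add)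
  moreover have "(x ^ (p ^ k)) ^ p = x ^ (p ^ Suc k)" "?y ^ p = (1 + x) ^ (p ^ Suc k)"
    by (simp_all add: mult.commute flip: power_mult)
  ultimately show ?case by (simp add: algebra_simps)
qed simp

text \<open>F is the cyclotomic polynomial of order p^(k+1) at 1 + X, and the last equation is its
  Eisenstein shape. With q = p^k, the quotient of (1+X)^(qp) - 1 by (1+X)^q - 1 is X^(qp-q) modulo
  p, and its constant term is p, the number of summands of a geometric sum.\<close>

lemma eisenstein_cyclotomic:
  fixes p k :: nat
  assumes p: "Factorial_Ring.prime p"
  obtains F h :: "int poly" where
    "F * ([:1, 1:] ^ (p ^ k) - 1) = [:1, 1:] ^ (p ^ k * p) - 1"
    "Polynomial.degree F = p ^ k * (p - 1)" "Polynomial.coeff F (p ^ k * (p - 1)) = 1"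
    "F = [:0, 1:] ^ (p ^ k * (p - 1)) + of_nat p * (1 + [:0, 1:] * h)"
proof -
  define q where "q = p ^ k"
  define x :: "int poly" where "x = [:0, 1:]"
  define n where "n = q * (p - 1)"
  have p1: "p > 1" using prime_gt_1_nat[OF p] .
  have q0: "q > 0" using p1 by (simp add: q_def)
  have n0: "n > 0" using p1 q0 by (simp add: n_def)
  have qp: "q * p = q + n" using p1 by (cases p) (simp_all add: n_def)
  have x1: "[:1, 1:] = 1 + x" by (simp add: x_def one_pCons)
  define F where "F = (\<Sum>i<p. ((1 + x) ^ q) ^ i)"
  have F: "F * ((1 + x) ^ q - 1) = (1 + x) ^ (q * p) - 1"
    using power_diff_1_eq[of "(1 + x) ^ q" p] unfolding F_def power_mult by (simp add: mult.commute)
  have xm: "x ^ j = Polynomial.monom 1 j" for j by (simp add: x_def monom_altdef)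
  have degP: "Polynomial.degree ((1 + x) ^ j - 1) = j \<and> Polynomial.coeff ((1 + x) ^ j - 1) j = 1" if "j > 0" for j
  proof -
    have m: "Polynomial.degree (1 + x) = 1" "Polynomial.lead_coeff (1 + x) = 1"
      by (simp_all flip: x1)
    have d: "Polynomial.degree ((1 + x) ^ j) = j"
      using degree_power_eq[of "1 + x" j] m by (auto simp flip: x1)
    have c: "Polynomial.coeff ((1 + x) ^ j) j = 1"
      using lead_coeff_power[of "1 + x" j] m d by simp
    have "Polynomial.coeff ((1 + x) ^ j - 1) j = 1" using c that by (simp add: coeff_1)
    moreover have "Polynomial.degree ((1 + x) ^ j - 1) \<le> j"
      using d degree_diff_le[of "(1 + x) ^ j" j 1] by simp
    ultimately show ?thesis by (metis le_antisym le_degree one_neq_zero)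
  qed
  let ?D = "(1 + x) ^ q - 1"
  have nz: "(1 + x) ^ (q * p) - 1 \<noteq> 0" using degP[of "q * p"] q0 p1 by auto
  then have Fnz: "F \<noteq> 0" "?D \<noteq> 0" using F by auto
  have "Polynomial.degree F + q = q * p"
    using degree_mult_eq[OF Fnz] degP[of q] degP[of "q * p"] q0 p1 unfolding F by simp
  then have dF: "Polynomial.degree F = n" using qp by simp
  have "Polynomial.lead_coeff F * Polynomial.lead_coeff ?D = 1"
    using lead_coeff_mult[of F ?D] degP[of "q * p"] q0 p1 unfolding F by simp
  then have lF: "Polynomial.coeff F n = 1" using degP[of q] q0 dF by simp
  \<comment> \<open>The part of F below the leading term. Multiplied by X^q it becomes a visible
    multiple of p, and X^q only shifts coefficients.\<close>
  define W where "W = F - x ^ n"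
  obtain H1 where H1: "(1 + x) ^ q = 1 + x ^ q + of_nat p * H1"
    using prime_dvd_one_plus_power[OF p, of x k] unfolding q_def dvd_def by (auto simp: algebra_simps)
  obtain H2 where H2: "(1 + x) ^ (q * p) = 1 + x ^ (q * p) + of_nat p * H2"
    using prime_dvd_one_plus_power[OF p, of x "Suc k"] unfolding q_def dvd_def
    by (auto simp: algebra_simps)
  have "x ^ q * W = of_nat p * (H2 - F * H1)"
  proof -
    have "F * (x ^ q + of_nat p * H1) = x ^ (q * p) + of_nat p * H2"
      using F unfolding H2 unfolding H1 by simp
    moreover have "x ^ (q * p) = x ^ q * x ^ n" unfolding qp by (rule power_add)
    ultimately show ?thesis by (simp add: W_def algebra_simps)
  qed
  then have "of_nat p dvd x ^ q * W" by (metis dvd_triv_left)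
  then have "[:int p:] dvd x ^ q * W" by (simp only: of_nat_poly)
  then have "\<forall>j. int p dvd Polynomial.coeff (x ^ q * W) j" by (simp add: const_poly_dvd_iff)
  then have "int p dvd Polynomial.coeff (x ^ q * W) (j + q)" for j by blast
  then have "int p dvd Polynomial.coeff W j" for j by (simp add: xm coeff_monom_mult)
  then have "[:int p:] dvd W" by (simp add: const_poly_dvd_iff)
  then have "of_nat p dvd W" by (simp only: of_nat_poly)
  then obtain G where G: "W = of_nat p * G" by (elim dvdE)
  have "poly F 0 = int p" by (simp add: F_def x_def poly_sum)
  then have "poly W 0 = int p" using n0 by (simp add: W_def x_def)
  then have "int p * poly G 0 = int p" by (simp add: G)
  then have "poly G 0 = 1" using p1 by simp
  then obtain h where "G = pCons 1 h" by (cases G) auto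
  then have "G = 1 + x * h" by (simp add: x_def one_pCons)
  then have "F = x ^ n + of_nat p * (1 + x * h)" using G by (simp add: W_def algebra_simps)
  then show ?thesis
    using that[of F h] F dF lF unfolding q_def n_def x_def[symmetric] x1 by simp
qed

context cring
begin

text \<open>Horner evaluation of integer polynomials, by which identities in \<open>int poly\<close>
  are transported to \<open>L\<close>.\<close>

definition poly_at :: "'a \<Rightarrow> int poly \<Rightarrow> 'a" where
  "poly_at y F = fold_coeffs (\<lambda>a b. \<iota> a \<oplus> y \<otimes> b) F \<zero>"

context
  fixes y assumes y: "y \<in> carrier R"
begin

lemma poly_at_0 [simp]: "poly_at y 0 = \<zero>"
  by (simp add: poly_at_def)

lemma poly_at_pCons: "poly_at y (pCons a F) = \<iota> a \<oplus> y \<otimes> poly_at y F"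
proof (cases "a = 0 \<and> F = 0")
  case True
  then show ?thesis using y by simp
next
  case False
  then show ?thesis using y by (auto simp: poly_at_def)
qed

lemma poly_at_subring: "subring S R \<Longrightarrow> y \<in> S \<Longrightarrow> poly_at y F \<in> S"
  by (induction F) (auto simp: poly_at_pCons subringE subring_of_integer)

lemma poly_at_closed [simp]: "poly_at y F \<in> carrier R"
  by (rule poly_at_subring[OF carrier_is_subring y])

lemma poly_at_add: "poly_at y (F + H) = poly_at y F \<oplus> poly_at y H"
proof (induction F H rule: poly_induct2)
  case (pCons a F b H)
  have c: "poly_at y F \<in> carrier R" "poly_at y H \<in> carrier R" "\<iota> a \<in> carrier R" "\<iota> b \<in> carrier R" by simp_all
  have "poly_at y (pCons a F + pCons b H) = (\<iota> a \<oplus> \<iota> b) \<oplus> y \<otimes> (poly_at y F \<oplus> poly_at y H)"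
    using pCons by (simp add: poly_at_pCons of_integer_add)
  also have "\<dots> = (\<iota> a \<oplus> y \<otimes> poly_at y F) \<oplus> (\<iota> b \<oplus> y \<otimes> poly_at y H)" using c y by algebra
  finally show ?case by (simp add: poly_at_pCons)
qed simp

lemma poly_at_smult: "poly_at y (Polynomial.smult a F) = \<iota> a \<otimes> poly_at y F"
proof (induction F)
  case (pCons b F)
  have c: "poly_at y F \<in> carrier R" "\<iota> a \<in> carrier R" "\<iota> b \<in> carrier R" by simp_all
  have "poly_at y (Polynomial.smult a (pCons b F)) = \<iota> a \<otimes> \<iota> b \<oplus> y \<otimes> (\<iota> a \<otimes> poly_at y F)"
    using pCons by (simp add: poly_at_pCons of_integer_mult)
  also have "\<dots> = \<iota> a \<otimes> (\<iota> b \<oplus> y \<otimes> poly_at y F)" using c y by algebra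
  finally show ?case by (simp add: poly_at_pCons)
qed simp

lemma poly_at_mult: "poly_at y (F * H) = poly_at y F \<otimes> poly_at y H"
proof (induction F)
  case (pCons a F)
  have c: "poly_at y F \<in> carrier R" "poly_at y H \<in> carrier R" "\<iota> a \<in> carrier R" by simp_all
  have "poly_at y (pCons a F * H) = \<iota> a \<otimes> poly_at y H \<oplus> (\<iota> 0 \<oplus> y \<otimes> (poly_at y F \<otimes> poly_at y H))"
    using pCons by (simp add: poly_at_add poly_at_smult poly_at_pCons)
  also have "\<dots> = (\<iota> a \<oplus> y \<otimes> poly_at y F) \<otimes> poly_at y H" using c y by (simp add: l_distr m_assoc)
  finally show ?case by (simp add: poly_at_pCons)
qed simp

lemma poly_at_const: "poly_at y [:a:] = \<iota> a"
  using y by (simp add: poly_at_pCons)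

lemma poly_at_1: "poly_at y 1 = \<one>"
  using poly_at_const[of 1] by (simp add: one_pCons)

lemma poly_at_of_nat: "poly_at y (of_nat n) = \<iota> (int n)"
  by (simp add: of_nat_poly poly_at_const)

lemma poly_at_power: "poly_at y (F ^ n) = poly_at y F [^] n"
  by (induction n) (simp_all add: poly_at_1 poly_at_mult m_comm)

lemma poly_at_minus_1: "poly_at y (F - 1) = poly_at y F \<ominus> \<one>"
proof -
  have "F - 1 = F + [:-1:]" by (simp add: one_pCons)
  then show ?thesis by (simp only: poly_at_add poly_at_const of_integer_neg of_integer_1 a_minus_def)
qed

lemma poly_at_X: "poly_at y [:0, 1:] = y" and poly_at_one_plus_X: "poly_at y [:1, 1:] = \<one> \<oplus> y"
  using y by (simp_all add: poly_at_pCons poly_at_const)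

lemma poly_at_eval: "poly_at y F = eval (map (\<lambda>a. \<iota> a) (rev (coeffs F))) y"
proof (induction F)
  case (pCons a F)
  have s: "set (map (\<lambda>a. \<iota> a) (rev (coeffs F))) \<subseteq> carrier R" by auto
  have "coeffs (pCons a F) = a # coeffs F" using pCons.hyps by (auto simp: cCons_def)
  then show ?case
    using eval_append_aux[OF s _ y, of "\<iota> a"] pCons.IH y eval_in_carrier[OF s y]
    by (simp add: poly_at_pCons m_comm a_comm)
qed simp

end

end

section \<open>Ramified automorphisms\<close>

context unramified_closure
begin

lemma unit_mult: "u \<in> OL \<Longrightarrow> u \<notin> \<mm> \<Longrightarrow> v \<in> OL \<Longrightarrow> v \<notin> \<mm> \<Longrightarrow> u \<otimes> v \<in> OL \<and> u \<otimes> v \<notin> \<mm>"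
  using \<mm>_prime OL_closed(4) by blast

lemma unit_pow: "u \<in> OL \<Longrightarrow> u \<notin> \<mm> \<Longrightarrow> u [^] (n::nat) \<in> OL \<and> u [^] n \<notin> \<mm>"
  using \<mm>_pow subring_pow[OF OL_subring] by blast

lemma unit_inv:
  assumes u: "u \<in> OL" "u \<notin> \<mm>"
  shows "inv u \<in> OL" "inv u \<notin> \<mm>" "u \<otimes> inv u = \<one>"
proof -
  have uc: "u \<in> carrier L" "u \<noteq> \<zero>" using u OL_carrier zero_\<mm> by auto
  show iu: "inv u \<in> OL" by (rule OL_unit_inv[OF u])
  show 1: "u \<otimes> inv u = \<one>" using uc field_Units by simp
  show "inv u \<notin> \<mm>"
  proof
    assume "inv u \<in> \<mm>"
    from \<mm>_mult[OF u(1) this] show False using 1 one_not_\<mm> by simp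
  qed
qed

section \<open>Valuations relative to an element whose n-th power is \<open>P\<close> times a
  unit\<close>

context
  fixes \<omega> :: 'a and n :: nat and v :: 'a
  assumes w: "\<omega> \<in> \<mm>" "\<omega> \<noteq> \<zero>" and n0: "n > 0"
    and v: "v \<in> OL" "v \<notin> \<mm>" and wn: "\<omega> [^] n = P \<otimes> v"
begin

text \<open>\<open>k\<close> is the valuation of x normalised by giving \<open>\<omega>\<close> the
  value 1. It is a relation free of division, as only some elements of \<open>L\<close> are compared
  with powers of \<open>\<omega>\<close>; the two exponents allow negative values.\<close>

definition has_val :: "'a \<Rightarrow> int \<Rightarrow> bool" where
  "has_val x k \<longleftrightarrow> x \<in> carrier L \<and>
    (\<exists>a b u. u \<in> OL \<and> u \<notin> \<mm> \<and> \<omega> [^] (a::nat) \<otimes> x = \<omega> [^] (b::nat) \<otimes> u \<and> k = int b - int a)"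

lemma w_carrier: "\<omega> \<in> carrier L"
  using \<mm>_carrier[OF w(1)] .

lemma w_OL: "\<omega> \<in> OL"
  using w(1) by (simp add: \<mm>_iff)

lemma has_val_nonzero: "has_val x k \<Longrightarrow> x \<noteq> \<zero>"
proof
  assume "has_val x k" and x: "x = \<zero>"
  then obtain a b :: nat and u where u: "u \<in> OL" "u \<notin> \<mm>" "\<omega> [^] a \<otimes> x = \<omega> [^] b \<otimes> u"
    by (auto simp: has_val_def)
  have "\<omega> [^] b \<otimes> u = \<zero>" using u(3) w_carrier by (simp add: x)
  then have "u = \<zero>"
    using integral[of "\<omega> [^] b" u] pow_nonzero[OF w_carrier w(2)] w_carrier OL_carrier[OF u(1)] by auto
  then show False using u zero_\<mm> by simp
qed

text \<open>The term of strictly smaller valuation wins: after extracting the common power, the sum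
  is a unit plus an element of \<open>\<mm>\<close>.\<close>

lemma has_val_add:
  assumes "has_val x k" "has_val y l" "k < l"
  shows "has_val (x \<oplus> y) k"
proof -
  obtain a b :: nat and u where u: "u \<in> OL" "u \<notin> \<mm>" "\<omega> [^] a \<otimes> x = \<omega> [^] b \<otimes> u" "k = int b - int a"
      "x \<in> carrier L"
    using assms(1) by (auto simp: has_val_def)
  obtain c d :: nat and t where t: "t \<in> OL" "t \<notin> \<mm>" "\<omega> [^] c \<otimes> y = \<omega> [^] d \<otimes> t" "l = int d - int c"
      "y \<in> carrier L"
    using assms(2) by (auto simp: has_val_def)
  \<comment> \<open>\<open>Suc m\<close> is the difference l - k of the valuations, so the second
    summand keeps at least one factor \<open>\<omega>\<close>.\<close>
  define m where "m = (a + d) - (b + c) - 1"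
  have m: "a + d = (b + c) + Suc m" using assms(3) u(4) t(4) by (simp add: m_def)
  have cc: "u \<in> carrier L" "t \<in> carrier L" using u t OL_carrier by auto
  have "\<omega> [^] (a + c) \<otimes> (x \<oplus> y) = \<omega> [^] c \<otimes> (\<omega> [^] a \<otimes> x) \<oplus> \<omega> [^] a \<otimes> (\<omega> [^] c \<otimes> y)"
    using w_carrier u(5) t(5) by (simp add: nat_pow_mult[symmetric] r_distr m_ac)
  also have "\<dots> = \<omega> [^] (b + c) \<otimes> u \<oplus> \<omega> [^] (a + d) \<otimes> t"
    unfolding u(3) t(3) using w_carrier cc by (simp add: nat_pow_mult[symmetric] m_ac)
  also have "\<dots> = \<omega> [^] (b + c) \<otimes> (u \<oplus> \<omega> [^] Suc m \<otimes> t)"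
    unfolding m using w_carrier cc by (simp add: nat_pow_mult[symmetric] m_assoc r_distr)
  finally have 1: "\<omega> [^] (a + c) \<otimes> (x \<oplus> y) = \<omega> [^] (b + c) \<otimes> (u \<oplus> \<omega> [^] Suc m \<otimes> t)" .
  have "(t \<otimes> \<omega> [^] m) \<otimes> \<omega> \<in> \<mm>"
    using \<mm>_mult[OF OL_closed(4)[OF t(1) subring_pow[OF OL_subring w_OL]] w(1)] .
  then have tm: "\<omega> [^] Suc m \<otimes> t \<in> \<mm>" using w_carrier cc by (simp add: m_ac)
  then have O: "u \<oplus> \<omega> [^] Suc m \<otimes> t \<in> OL" using u(1) OL_closed(5) by (simp add: \<mm>_iff)
  have "u \<oplus> \<omega> [^] Suc m \<otimes> t \<notin> \<mm>"
  proof
    assume "u \<oplus> \<omega> [^] Suc m \<otimes> t \<in> \<mm>"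
    then have "(u \<oplus> \<omega> [^] Suc m \<otimes> t) \<ominus> \<omega> [^] Suc m \<otimes> t \<in> \<mm>" using tm \<mm>_minus by blast
    moreover have "(u \<oplus> \<omega> [^] Suc m \<otimes> t) \<ominus> \<omega> [^] Suc m \<otimes> t = u"
      using cc(1) \<mm>_carrier[OF tm] by algebra
    ultimately show False using u(2) by simp
  qed
  then show ?thesis
    unfolding has_val_def using 1 O u t
    by (intro conjI exI[of _ "a + c"] exI[of _ "b + c"] exI[of _ "u \<oplus> \<omega> [^] Suc m \<otimes> t"]) auto
qed

lemma has_val_mult_pow:
  assumes "has_val x k"
  shows "has_val (x \<otimes> \<omega> [^] (i::nat)) (k + int i)"
proof -
  obtain a b :: nat and u where u: "u \<in> OL" "u \<notin> \<mm>" "\<omega> [^] a \<otimes> x = \<omega> [^] b \<otimes> u" "k = int b - int a"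
      "x \<in> carrier L"
    using assms by (auto simp: has_val_def)
  have "\<omega> [^] a \<otimes> (x \<otimes> \<omega> [^] i) = (\<omega> [^] a \<otimes> x) \<otimes> \<omega> [^] i" using w_carrier u(5) by (simp add: m_assoc)
  also have "\<dots> = \<omega> [^] (b + i) \<otimes> u"
    unfolding u(3) using w_carrier OL_carrier[OF u(1)] by (simp add: nat_pow_mult[symmetric] m_ac)
  finally show ?thesis
    unfolding has_val_def using u w_carrier by (intro conjI exI[of _ a] exI[of _ "b + i"] exI[of _ u]) auto
qed

text \<open>Nonzero elements of \<open>KU\<close> are powers of \<open>P\<close> times units, and
  \<open>P\<close> has valuation n.\<close>

lemma KU_has_val:
  assumes x: "x \<in> KU" "x \<noteq> \<zero>"
  shows "\<exists>j. has_val x (int n * j)"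
proof -
  obtain a b :: nat and u where u: "u \<in> RU" "u \<notin> \<mm>" "P [^] a \<otimes> x = P [^] b \<otimes> u"
    using KU_valuation[OF x] by blast
  have uO: "u \<in> OL" using u RU_OL by blast
  have xc: "x \<in> carrier L" using x by (simp add: KU_def)
  note iv = unit_inv[OF v]
  have c: "u \<in> carrier L" "v \<in> carrier L" "inv v \<in> carrier L" using uO v iv OL_carrier by auto
  have wp: "\<omega> [^] (n * m) = P [^] m \<otimes> v [^] m" for m :: nat
    using wn w_carrier c by (simp add: nat_pow_pow[symmetric] nat_pow_distrib)
  have "\<omega> [^] (n * b) \<otimes> inv v [^] b = P [^] b \<otimes> (v [^] b \<otimes> inv v [^] b)"
    unfolding wp using c by (simp add: m_assoc)
  also have "v [^] b \<otimes> inv v [^] b = \<one>"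
    unfolding nat_pow_distrib[OF c(2,3), symmetric] iv(3) by simp
  finally have Pb: "P [^] b = \<omega> [^] (n * b) \<otimes> inv v [^] b" by simp
  let ?u = "inv v [^] b \<otimes> (v [^] a \<otimes> u)"
  have "\<omega> [^] (n * a) \<otimes> x = v [^] a \<otimes> (P [^] a \<otimes> x)" unfolding wp using c xc by (simp add: m_ac)
  also have "\<dots> = \<omega> [^] (n * b) \<otimes> ?u" unfolding u(3) Pb using c w_carrier by (simp add: m_ac)
  finally have *: "\<omega> [^] (n * a) \<otimes> x = \<omega> [^] (n * b) \<otimes> ?u" .
  have "?u \<in> OL \<and> ?u \<notin> \<mm>"
    using unit_mult unit_pow iv(1,2) v uO u(2) by simp
  then have "has_val x (int (n * b) - int (n * a))"
    unfolding has_val_def using xc * by blast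
  moreover have "int (n * b) - int (n * a) = int n * (int b - int a)" by (simp add: algebra_simps)
  ultimately show ?thesis by auto
qed

text \<open>The nonzero terms have valuations congruent to their exponents modulo n, hence pairwise
  different for exponents below n, and the smallest is the valuation of the sum. The bound on
  \<open>k mod int n\<close> records which exponents have occurred.\<close>

lemma KU_eval_has_val:
  assumes "set g \<subseteq> KU" "length g \<le> n"
  shows "(set g \<subseteq> {\<zero>} \<and> eval g \<omega> = \<zero>) \<or> (\<exists>k. has_val (eval g \<omega>) k \<and> k mod int n < int (length g))"
  using assms
proof (induction g)
  case (Cons a g)
  have KUc: "\<And>z. z \<in> KU \<Longrightarrow> z \<in> carrier L" by (simp add: KU_def)
  have ac: "a \<in> KU" "a \<in> carrier L" "set g \<subseteq> carrier L" using Cons.prems KUc by auto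
  have e: "eval g \<omega> \<in> carrier L" by (rule eval_in_carrier[OF ac(3) w_carrier])
  have IH: "(set g \<subseteq> {\<zero>} \<and> eval g \<omega> = \<zero>) \<or> (\<exists>k. has_val (eval g \<omega>) k \<and> k mod int n < int (length g))"
    using Cons by auto
  show ?case
  proof (cases "a = \<zero>")
    case True
    then have "eval (a # g) \<omega> = eval g \<omega>" using e w_carrier by simp
    then show ?thesis using IH True by (auto simp del: eval.simps)
  next
    case False
    then obtain j where j: "has_val a (int n * j)" using KU_has_val ac(1) by blast
    let ?m = "int n * j + int (length g)"
    have hm: "has_val (a \<otimes> \<omega> [^] length g) ?m" by (rule has_val_mult_pow[OF j])
    have lt: "length g < n" using Cons.prems by simp
    have mm: "?m mod int n = int (length g)" using lt by simp
    have ec: "eval (a # g) \<omega> = a \<otimes> \<omega> [^] length g \<oplus> eval g \<omega>" by simp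
    have mc: "a \<otimes> \<omega> [^] length g \<in> carrier L" using ac w_carrier by simp
    from IH show ?thesis
    proof
      assume "set g \<subseteq> {\<zero>} \<and> eval g \<omega> = \<zero>"
      then have "eval (a # g) \<omega> = a \<otimes> \<omega> [^] length g" using ec mc by simp
      then show ?thesis using hm mm by (intro disjI2 exI[of _ ?m]) (simp del: eval.simps)
    next
      assume "\<exists>k. has_val (eval g \<omega>) k \<and> k mod int n < int (length g)"
      then obtain k where k: "has_val (eval g \<omega>) k" "k mod int n < int (length g)" by blast
      then have "k \<noteq> ?m" using mm by auto
      then consider "k < ?m" | "?m < k" by linarith
      then show ?thesis
      proof cases
        case 1
        have "has_val (eval (a # g) \<omega>) k"
          unfolding ec using has_val_add[OF k(1) hm 1] e mc by (simp add: a_comm)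
        then show ?thesis using k(2) by (intro disjI2 exI[of _ k]) (simp del: eval.simps)
      next
        case 2
        have "has_val (eval (a # g) \<omega>) ?m" unfolding ec by (rule has_val_add[OF hm k(1) 2])
        then show ?thesis using mm by (intro disjI2 exI[of _ ?m]) (simp del: eval.simps)
      qed
    qed
  qed
qed simp

text \<open>So \<open>\<omega>\<close> has degree at least n over \<open>KU\<close>, which replaces
  irreducibility of its Eisenstein polynomial.\<close>

lemma KU_independent:
  "set g \<subseteq> KU \<Longrightarrow> length g \<le> n \<Longrightarrow> eval g \<omega> = \<zero> \<Longrightarrow> set g \<subseteq> {\<zero>}"
  using KU_eval_has_val has_val_nonzero by blast

end

text \<open>The hypotheses say that both roots of unity have exact order p^(k+1). Subtracting 1
  gives two roots of the Eisenstein polynomial F, and \<open>KU_independent\<close> makes sending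
  one to the other a well-defined map over \<open>KU\<close>.\<close>

lemma automorphism_on_p_power_roots:
  assumes z: "\<zeta> \<in> carrier L" "\<zeta> [^] (p ^ k * p) = \<one>" "\<zeta> [^] (p ^ k) \<noteq> \<one>"
    and y: "\<xi> \<in> carrier L" "\<xi> [^] (p ^ k * p) = \<one>" "\<xi> [^] (p ^ k) \<noteq> \<one>"
  shows "\<exists>\<psi>\<in>Bij (carrier L). \<psi> \<in> ring_hom L L \<and> (\<forall>a\<in>KU. \<psi> a = a) \<and> \<psi> \<zeta> = \<xi>"
proof -
  obtain F h :: "int poly" where F:
    "F * ([:1, 1:] ^ (p ^ k) - 1) = [:1, 1:] ^ (p ^ k * p) - 1"
    "Polynomial.degree F = p ^ k * (p - 1)" "Polynomial.coeff F (p ^ k * (p - 1)) = 1"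
    "F = [:0, 1:] ^ (p ^ k * (p - 1)) + of_nat p * (1 + [:0, 1:] * h)"
    using eisenstein_cyclotomic[OF prime_p] by blast
  let ?n = "p ^ k * (p - 1)"
  have n0: "?n > 0" using prime_gt_1_nat[OF prime_p] by simp
  have root: "poly_at (x \<ominus> \<one>) F = \<zero>"
    if x: "x \<in> carrier L" "x [^] (p ^ k * p) = \<one>" "x [^] (p ^ k) \<noteq> \<one>" for x
  proof -
    have c: "x \<ominus> \<one> \<in> carrier L" "\<one> \<oplus> (x \<ominus> \<one>) = x" using x(1) by (simp, algebra)
    have "poly_at (x \<ominus> \<one>) F \<otimes> (x [^] (p ^ k) \<ominus> \<one>) = x [^] (p ^ k * p) \<ominus> \<one>"
      using arg_cong[OF F(1), of "poly_at (x \<ominus> \<one>)"] c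
      by (simp add: poly_at_mult poly_at_minus_1 poly_at_power poly_at_one_plus_X)
    also have "\<dots> = \<zero>" unfolding x(2) by (simp add: a_minus_def r_neg)
    finally have "poly_at (x \<ominus> \<one>) F \<otimes> (x [^] (p ^ k) \<ominus> \<one>) = \<zero>" .
    moreover have "x [^] (p ^ k) \<ominus> \<one> \<noteq> \<zero>" using x r_right_minus_eq[of "x [^] (p ^ k)" \<one>] by auto
    ultimately show ?thesis using integral[of "poly_at (x \<ominus> \<one>) F" "x [^] (p ^ k) \<ominus> \<one>"] c x(1) by auto
  qed
  define \<omega> where "\<omega> = \<zeta> \<ominus> \<one>"
  define \<omega>' where "\<omega>' = \<xi> \<ominus> \<one>"
  have wc: "\<omega> \<in> carrier L" "\<omega>' \<in> carrier L" using z y by (auto simp: \<omega>_def \<omega>'_def)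
  have "p ^ k * p > 0" using prime_gt_0_nat[OF prime_p] by simp
  then have "\<zeta> \<in> OL" using root_of_unity_OL z by blast
  then have wO: "\<omega> \<in> OL" unfolding \<omega>_def by (intro OL_minus OL_closed(2))
  have "\<zeta> \<noteq> \<one>" using z(3) by auto
  then have w0: "\<omega> \<noteq> \<zero>" unfolding \<omega>_def using z r_right_minus_eq[of \<zeta> \<one>] by auto
  define H where "H = poly_at \<omega> h"
  have HO: "H \<in> OL" unfolding H_def by (rule poly_at_subring[OF wc(1) OL_subring wO])
  have Hc: "H \<in> carrier L" using HO OL_carrier by blast
  have "poly_at \<omega> F = \<omega> [^] ?n \<oplus> P \<otimes> (\<one> \<oplus> \<omega> \<otimes> H)"
    using wc(1) by (subst F(4)) (simp add: poly_at_add poly_at_mult poly_at_power poly_at_X poly_at_1 poly_at_of_nat poly_at_pCons H_def)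
  then have 0: "\<omega> [^] ?n \<oplus> P \<otimes> (\<one> \<oplus> \<omega> \<otimes> H) = \<zero>" using root[OF z] by (simp add: \<omega>_def)
  \<comment> \<open>Solving F = 0 for the leading term gives
    \<open>\<omega> [^] ?n = P \<otimes> v\<close>; v is a unit because it differs from -1 by a
    multiple of \<open>\<omega>\<close>.\<close>
  define v where "v = \<ominus> (\<one> \<oplus> \<omega> \<otimes> H)"
  have vO: "v \<in> OL" unfolding v_def by (intro OL_closed wO HO)
  have "\<omega> [^] ?n = \<ominus> (P \<otimes> (\<one> \<oplus> \<omega> \<otimes> H))"
    using 0 wc Hc by (intro minus_equality[symmetric]) auto
  then have wn: "\<omega> [^] ?n = P \<otimes> v" using wc Hc by (simp add: v_def r_minus)
  have "P \<otimes> v \<in> \<mm>" using \<mm>_mult[OF vO P_\<mm>] OL_carrier[OF vO] by (simp add: m_comm)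
  then have wm: "\<omega> \<in> \<mm>" using \<mm>_pow[OF wO] wn by metis
  have vm: "v \<notin> \<mm>"
  proof
    assume "v \<in> \<mm>"
    moreover have "H \<otimes> \<omega> \<in> \<mm>" by (rule \<mm>_mult[OF HO wm])
    ultimately have "\<ominus> (v \<oplus> H \<otimes> \<omega>) \<in> \<mm>" by (intro \<mm>_neg \<mm>_add)
    moreover have "\<ominus> (v \<oplus> H \<otimes> \<omega>) = \<one>" unfolding v_def using wc Hc by algebra
    ultimately show False using one_not_\<mm> by simp
  qed
  \<comment> \<open>The identity on \<open>KU\<close>; every extension of it fixes \<open>KU\<close>
    and therefore K, as required of an element of inertia.\<close>
  define G where "G = {(a, a) | a. a \<in> KU}"
  note KUr = subringE(2,3,5,6,7)[OF KU_subring]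
  have KUc: "\<And>a. a \<in> KU \<Longrightarrow> a \<in> carrier L" by (simp add: KU_def)
  have G: "AC.hom_graph G"
    unfolding AC.hom_graph_def G_def using KUc KUr K_subset_KU by auto
  let ?l = "map (\<lambda>a. \<iota> a) (rev (coeffs F))"
  have "F \<noteq> 0" using F(3) by auto
  then have len: "length ?l = Suc ?n" using F(2) by (simp add: length_coeffs)
  moreover have "hd ?l = \<one>"
    using \<open>F \<noteq> 0\<close> F(2,3) by (simp add: hd_map hd_rev last_coeffs_eq_coeff_degree)
  ultimately obtain l where l: "?l = \<one> # l" "length l = ?n" by (cases ?l) auto
  have lK: "set l \<subseteq> KU"
  proof
    fix c assume "c \<in> set l"
    then have "c \<in> set ?l" using l(1) by simp
    then show "c \<in> KU" using subring_of_integer[OF KU_subring] by auto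
  qed
  let ?f = "map (\<lambda>c. (c, c)) l"
  have ff: "map fst ?f = l" "map snd ?f = l" by (simp_all add: comp_def)
  have f: "set ?f \<subseteq> G" using lK by (auto simp: G_def)
  have e: "eval (\<one> # l) \<omega> = \<zero>" "eval (\<one> # l) \<omega>' = \<zero>"
    using root[OF z] root[OF y] poly_at_eval[OF wc(1), of F] poly_at_eval[OF wc(2), of F]
    unfolding l(1) \<omega>_def[symmetric] \<omega>'_def[symmetric] by simp_all
  have indep: "set (map fst g) \<subseteq> {\<zero>}" if "set g \<subseteq> G" "length g \<le> length ?f" "eval (map fst g) \<omega> = \<zero>" for g
  proof (rule KU_independent[OF wm w0 n0 vO vm wn])
    show "set (map fst g) \<subseteq> KU" using that(1) by (auto simp: G_def)
    show "length (map fst g) \<le> ?n" using that(2) l(2) by simp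
    show "eval (map fst g) \<omega> = \<zero>" by fact
  qed
  obtain G' where G': "AC.hom_graph G'" "G \<subseteq> G'" "(\<omega>, \<omega>') \<in> G'"
    using AC.hom_graph_extend[OF G wc f _ _ indep] e unfolding ff by blast
  obtain \<psi> where s: "\<psi> \<in> Bij (carrier L)" "\<psi> \<in> ring_hom L L" "\<forall>(a, b)\<in>G'. \<psi> a = b"
    using AC.hom_graph_automorphism[OF G'(1)] by blast
  have KUs: "\<forall>a\<in>KU. \<psi> a = a" using s(3) G'(2) by (auto simp: G_def)
  have "\<psi> \<omega> = \<omega>'" using s(3) G'(3) by auto
  moreover have "\<zeta> = \<omega> \<oplus> \<one>" "\<xi> = \<omega>' \<oplus> \<one>" unfolding \<omega>_def \<omega>'_def using z y by algebra+
  ultimately have "\<psi> \<zeta> = \<xi>"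
    using ring_hom_add[OF s(2) wc(1), of \<one>] ring_hom_one[OF s(2)] by simp
  then show ?thesis using s KUs by blast
qed

lemma automorphism_eval:
  assumes s: "\<psi> \<in> ring_hom L L" "\<forall>a\<in>K. \<psi> a = a" and x: "x \<in> carrier L" and l: "set l \<subseteq> K"
  shows "\<psi> (eval l x) = eval l (\<psi> x)"
  using l
proof (induction l)
  case Nil
  then show ?case using s(2) subringE(2)[OF K_subring] by simp
next
  case (Cons a l)
  have pw: "\<psi> (x [^] m) = \<psi> x [^] m" for m :: nat
    by (induction m) (use x ring_hom_mult[OF s(1)] ring_hom_one[OF s(1)] in auto)
  have c: "a \<in> carrier L" "set l \<subseteq> carrier L" using Cons.prems K_carrier by auto
  have e: "eval l x \<in> carrier L" by (rule eval_in_carrier[OF c(2) x])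
  have "\<psi> (eval (a # l) x) = \<psi> a \<otimes> \<psi> x [^] length l \<oplus> \<psi> (eval l x)"
    using c x e ring_hom_add[OF s(1)] ring_hom_mult[OF s(1)] pw by simp
  then show ?case using Cons s(2) by simp
qed

text \<open>Integrality is tested by polynomials over \<open>A\<close>, and \<open>A\<close> lies in
  K, so the automorphism fixes their coefficients.\<close>

lemma automorphism_OL_iff:
  assumes s: "\<psi> \<in> ring_hom L L" "\<forall>a\<in>K. \<psi> a = a" "\<psi> \<in> Bij (carrier L)" and x: "x \<in> carrier L"
  shows "\<psi> x \<in> OL \<longleftrightarrow> x \<in> OL"
proof -
  have sc: "\<psi> x \<in> carrier L" using ring_hom_closed[OF s(1) x] .
  have AK: "A \<subseteq> K" using A_subset_OK by (auto simp: OK_iff)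
  have s0: "\<psi> \<zero> = \<zero>" using s(2) subringE(2)[OF K_subring] by simp
  have "eval f (\<psi> x) = \<zero> \<longleftrightarrow> eval f x = \<zero>" if f: "f \<in> carrier (A[X])" for f
  proof -
    have fA: "set f \<subseteq> A" using f unfolding univ_poly_carrier[symmetric] polynomial_def by auto
    have e: "eval f x \<in> carrier L" using fA A_carrier by (intro eval_in_carrier x) auto
    have "\<psi> (eval f x) = eval f (\<psi> x)" using automorphism_eval[OF s(1,2) x] fA AK by auto
    moreover have "inj_on \<psi> (carrier L)" using s(3) by (auto simp: Bij_def bij_betw_def)
    then have "\<psi> (eval f x) = \<psi> \<zero> \<longleftrightarrow> eval f x = \<zero>" using e by (auto simp: inj_on_eq_iff)
    ultimately show ?thesis using s0 by simp
  qed
  then show ?thesis unfolding integral_closure_def using x sc by auto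
qed

lemma automorphism_\<mm>:
  assumes s: "\<psi> \<in> ring_hom L L" "\<forall>a\<in>K. \<psi> a = a" "\<psi> \<in> Bij (carrier L)" and x: "x \<in> \<mm>"
  shows "\<psi> x \<in> \<mm>"
proof (rule ccontr)
  have xc: "x \<in> carrier L" "x \<in> OL" using x \<mm>_carrier by (auto simp: \<mm>_iff)
  have "\<psi> x \<in> OL" using automorphism_OL_iff[OF s xc(1)] xc by simp
  moreover assume "\<psi> x \<notin> \<mm>"
  ultimately obtain y where y: "y \<in> OL" "\<psi> x \<otimes> y = \<one>" by (auto simp: \<mm>_iff)
  have b: "inj_on \<psi> (carrier L)" "\<psi> ` carrier L = carrier L" using s(3) by (auto simp: Bij_def bij_betw_def)
  then obtain y' where y': "y' \<in> carrier L" "y = \<psi> y'" using OL_carrier[OF y(1)] by blast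
  have "\<psi> (x \<otimes> y') = \<psi> \<one>" using ring_hom_mult[OF s(1) xc(1) y'(1)] ring_hom_one[OF s(1)] y y' by simp
  then have "x \<otimes> y' = \<one>" using b(1) xc y' by (simp add: inj_on_eq_iff)
  moreover have "y' \<in> OL" using automorphism_OL_iff[OF s y'(1)] y y' by simp
  ultimately show False using x by (auto simp: \<mm>_iff)
qed

lemma inertia_iff:
  "\<psi> \<in> carrier (inertia_group L Q av K) \<longleftrightarrow> \<psi> \<in> Bij (carrier L) \<and> \<psi> \<in> ring_hom L L \<and>
     (\<forall>a\<in>K. \<psi> a = a) \<and> (\<forall>x\<in>OL. \<psi> x \<ominus> x \<in> \<mm>)"
  by (auto simp: inertia_group_def galois_group_def)

lemma inertia_if_fixes_KU:
  assumes s: "\<psi> \<in> Bij (carrier L)" "\<psi> \<in> ring_hom L L" "\<forall>a\<in>KU. \<psi> a = a"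
  shows "\<psi> \<in> carrier (inertia_group L Q av K)"
proof -
  have K: "\<forall>a\<in>K. \<psi> a = a" using s(3) K_subset_KU by blast
  have "\<psi> x \<ominus> x \<in> \<mm>" if x: "x \<in> OL" for x
  proof -
    obtain z where z: "z \<in> insert \<zero> mu" "x \<ominus> z \<in> \<mm>" using residue_root_of_unity[OF x] by blast
    have "z \<in> KU" using z(1) mu_RU RU_KU subringE(2)[OF KU_subring] by blast
    then have zc: "z \<in> carrier L" "\<psi> z = z" using s(3) by (auto simp: KU_def)
    have xc: "x \<in> carrier L" using OL_carrier[OF x] .
    define d where "d = x \<ominus> z"
    have d: "d \<in> carrier L" "x = d \<oplus> z" using xc zc(1) by (simp add: d_def, simp add: d_def, algebra)
    have sd: "\<psi> d \<in> \<mm>" using automorphism_\<mm>[OF s(2) K s(1)] z(2) by (simp add: d_def)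
    have "\<psi> x = \<psi> d \<oplus> z" using ring_hom_add[OF s(2) d(1) zc(1)] zc(2) d(2) by simp
    then have "\<psi> x \<ominus> x = (\<psi> d \<oplus> z) \<ominus> (d \<oplus> z)" using d(2) by simp
    also have "\<dots> = \<psi> d \<ominus> d" using \<mm>_carrier[OF sd] zc(1) d(1) by algebra
    finally show ?thesis using \<mm>_minus[OF sd] z(2) by (simp add: d_def)
  qed
  then show ?thesis unfolding inertia_iff using s K by blast
qed

text \<open>The image of z is again in \<open>mu\<close> and congruent to z by inertia, and residues
  separate \<open>mu\<close>. This makes the character trivial modulo numbers prime to p.\<close>

lemma inertia_fixes_mu:
  assumes s: "\<psi> \<in> carrier (inertia_group L Q av K)" and z: "z \<in> mu"
  shows "\<psi> z = z"
proof -
  have s': "\<psi> \<in> ring_hom L L" "\<And>x. x \<in> OL \<Longrightarrow> \<psi> x \<ominus> x \<in> \<mm>" using s by (auto simp: inertia_iff)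
  obtain m where m: "z \<in> carrier L" "m > 0" "coprime m p" "z [^] (m::nat) = \<one>" using z by (auto simp: mu_def)
  have "\<psi> (z [^] i) = \<psi> z [^] i" for i :: nat
    by (induction i) (use m ring_hom_mult[OF s'(1)] ring_hom_one[OF s'(1)] in auto)
  then have "\<psi> z [^] m = \<one>" using m(4) ring_hom_one[OF s'(1)] by metis
  then have "\<psi> z \<in> mu" using m ring_hom_closed[OF s'(1) m(1)] by (auto simp: mu_def)
  then show ?thesis using mu_cong_eq[OF _ z s'(2)[OF mu_OL[OF z]]] by blast
qed

end

section \<open>Primitive roots of unity and the cyclotomic character\<close>

context unramified_closure
begin

lemma monic_roots_bound:
  assumes "set l \<subseteq> carrier L"
  shows "finite {x \<in> carrier L. eval (\<one> # l) x = \<zero>} \<and>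
    card {x \<in> carrier L. eval (\<one> # l) x = \<zero>} \<le> length l"
  using assms
proof (induction "length l" arbitrary: l)
  case 0
  then show ?case by simp
next
  case (Suc n)
  let ?Z = "\<lambda>l. {x \<in> carrier L. eval (\<one> # l) x = \<zero>}"
  have "l \<noteq> []" using Suc.hyps(2) by auto
  then obtain r where r: "r \<in> carrier L" "eval (\<one> # l) r = \<zero>"
    using AC.monic_root_exists[OF Suc.prems] by blast
  have "set (\<one> # l) \<subseteq> carrier L" using Suc.prems by simp
  then obtain q where q: "set q \<subseteq> carrier L" "length q = length l" "hd q = \<one>"
    "\<And>x. x \<in> carrier L \<Longrightarrow> eval (\<one> # l) x = (x \<ominus> r) \<otimes> eval q x \<oplus> eval (\<one> # l) r"
    using synthetic_division[OF r(1), of "\<one> # l"] Suc.hyps(2) by auto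
  obtain l' where l': "q = \<one> # l'" using q(2,3) Suc.hyps(2) by (cases q) auto
  have l'c: "set l' \<subseteq> carrier L" "n = length l'" using q l' Suc.hyps(2) by auto
  have IH: "finite (?Z l')" "card (?Z l') \<le> n"
    using Suc.hyps(1)[OF l'c(2,1)] l'c(2) by auto
  have "?Z l \<subseteq> insert r (?Z l')"
  proof
    fix x assume "x \<in> ?Z l"
    then have x: "x \<in> carrier L" "eval (\<one> # l) x = \<zero>" by auto
    have e: "eval q x \<in> carrier L" by (rule eval_in_carrier[OF q(1) x(1)])
    have "(x \<ominus> r) \<otimes> eval q x = \<zero>" using q(4)[OF x(1)] x(2) r e x(1) by simp
    then have "x \<ominus> r = \<zero> \<or> eval q x = \<zero>" using integral[of "x \<ominus> r" "eval q x"] e x(1) r(1) by auto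
    then show "x \<in> insert r (?Z l')"
      using x(1) r(1) r_right_minus_eq[of x r] unfolding l' by blast
  qed
  then have "finite (?Z l)" "card (?Z l) \<le> card (insert r (?Z l'))"
    using IH(1) by (auto intro: finite_subset card_mono simp del: eval.simps)
  moreover have "card (insert r (?Z l')) \<le> Suc n" using IH(2) card_insert_le_m1[of "Suc n" "?Z l'" r] by simp
  ultimately show ?case using Suc.hyps(2) by simp
qed

definition primitive_root :: "nat \<Rightarrow> 'a \<Rightarrow> bool" where
  "primitive_root n z \<longleftrightarrow> n > 0 \<and> z \<in> carrier L \<and> (\<forall>k::nat. z [^] k = \<one> \<longleftrightarrow> n dvd k)"

lemma primitive_root_pow_eq_iff:
  assumes "primitive_root n z"
  shows "z [^] (i::nat) = z [^] (j::nat) \<longleftrightarrow> i mod n = j mod n"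
proof -
  have z: "z \<in> carrier L" "n > 0" "\<And>k::nat. z [^] k = \<one> \<longleftrightarrow> n dvd k"
    using assms by (auto simp: primitive_root_def)
  have zn: "z [^] n = \<one>" using z(3) by simp
  have "z \<noteq> \<zero>"
  proof
    assume "z = \<zero>"
    then have "z [^] n = \<zero>" using z(2) by (simp add: nat_pow_zero)
    then show False using zn by simp
  qed
  then have nz: "z [^] k \<noteq> \<zero>" for k :: nat using pow_nonzero z(1) by blast
  have le: "z [^] i = z [^] j \<longleftrightarrow> i mod n = j mod n" if "i \<le> j" for i j :: nat
  proof -
    have "z [^] j = z [^] i \<otimes> z [^] (j - i)" using that z(1) by (simp add: nat_pow_mult)
    then have "z [^] i = z [^] j \<longleftrightarrow> z [^] i \<otimes> z [^] (j - i) = z [^] i \<otimes> \<one>" using z(1) by auto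
    also have "\<dots> \<longleftrightarrow> z [^] (j - i) = \<one>" using m_lcancel[OF nz, of i "z [^] (j - i)" \<one>] z(1) by simp
    also have "\<dots> \<longleftrightarrow> n dvd j - i" by (rule z(3))
    also have "\<dots> \<longleftrightarrow> j mod n = i mod n" using that by (metis mod_eq_dvd_iff_nat)
    finally show ?thesis by auto
  qed
  show ?thesis using le[of i j] le[of j i] by (cases "i \<le> j") auto
qed

text \<open>The n powers of z are distinct roots of X^n - 1, which has at most n roots.\<close>

lemma primitive_root_powers:
  assumes n: "primitive_root n z" and w: "w \<in> carrier L" "w [^] n = \<one>"
  shows "\<exists>k<n. w = z [^] k"
proof -
  have z: "z \<in> carrier L" "n > 0" "\<And>k::nat. z [^] k = \<one> \<longleftrightarrow> n dvd k"
    using n by (auto simp: primitive_root_def)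
  let ?l = "replicate (n - 1) \<zero> @ [\<ominus> \<one>]"
  let ?Z = "{x \<in> carrier L. eval (\<one> # ?l) x = \<zero>}"
  have Zi: "x \<in> ?Z \<longleftrightarrow> x \<in> carrier L \<and> x [^] n = \<one>" for x
  proof (cases "x \<in> carrier L")
    case True
    have one: "\<one> \<in> carrier L" by simp
    have "eval (\<one> # ?l) x = x [^] n \<ominus> \<one>" by (rule eval_pow_minus[OF z(2) True one])
    then show ?thesis using True r_right_minus_eq[of "x [^] n" \<one>] by (simp del: eval.simps)
  qed simp
  have "set ?l \<subseteq> carrier L" by (auto simp: set_replicate_conv_if)
  from monic_roots_bound[OF this] have Z: "finite ?Z" "card ?Z \<le> n" using z(2) by auto
  let ?S = "(\<lambda>k::nat. z [^] k) ` {..<n}"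
  have "inj_on (\<lambda>k::nat. z [^] k) {..<n}"
    by (rule inj_onI) (use primitive_root_pow_eq_iff[OF n] in auto)
  then have cS: "card ?S = n" by (simp add: card_image)
  have "?S \<subseteq> ?Z"
  proof
    fix x assume "x \<in> ?S"
    then obtain k :: nat where k: "x = z [^] k" by auto
    have "x [^] n = (z [^] n) [^] k" unfolding k using z(1) by (simp add: nat_pow_pow mult.commute)
    moreover have "z [^] n = \<one>" using z(3) by simp
    ultimately show "x \<in> ?Z" unfolding Zi using k z(1) by simp
  qed
  then have "?S = ?Z" using Z cS by (intro card_seteq) auto
  moreover have "w \<in> ?Z" unfolding Zi using w by simp
  ultimately have "w \<in> ?S" by (simp only:)
  then show ?thesis by auto
qed

lemma pow_coprime_eq_one:
  assumes x: "x \<in> carrier L" "x [^] (a::nat) = \<one>" "x [^] (b::nat) = \<one>" "coprime a b"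
  shows "x = \<one>"
proof (cases "a = 0")
  case True
  then show ?thesis using x by simp
next
  case False
  then obtain u v where uv: "a * u = b * v + 1" using bezout_nat[of a b] x(4) by auto
  have "x [^] (a * u) = \<one>" "x [^] (b * v) = \<one>" using x by (simp_all add: nat_pow_pow[symmetric])
  moreover have "x [^] (a * u) = x [^] (b * v) \<otimes> x" unfolding uv using x(1) by simp
  ultimately show ?thesis using x(1) by simp
qed

text \<open>t is a root of 1 + X + ... + X^(l-1). At 1 this polynomial has the value l, which is
  nonzero in characteristic 0.\<close>

lemma nontrivial_prime_root:
  assumes l: "Factorial_Ring.prime (l::nat)"
  shows "\<exists>t\<in>carrier L. t [^] l = \<one> \<and> t \<noteq> \<one>"
proof -
  have l1: "l > 1" using prime_gt_1_nat[OF l] .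
  then obtain m where m: "l = Suc (Suc m)" by (metis One_nat_def less_imp_Suc_add add_Suc plus_nat.add_0 add.commute)
  have "set (replicate (Suc m) \<one>) \<subseteq> carrier L" by (auto simp: set_replicate_conv_if)
  then obtain t where t: "t \<in> carrier L" "eval (replicate l \<one>) t = \<zero>"
    using AC.monic_root_exists[of "replicate (Suc m) \<one>"] unfolding m by auto
  have c: "eval (replicate k \<one>) t \<in> carrier L" for k
    using t(1) by (intro eval_in_carrier) (auto simp: set_replicate_conv_if)
  have g: "eval (replicate k \<one>) t \<otimes> (t \<ominus> \<one>) = t [^] k \<ominus> \<one>" for k
  proof (induction k)
    case 0
    then show ?case using t(1) by (simp add: a_minus_def r_neg)
  next
    case (Suc k)
    have pc: "t [^] k \<in> carrier L" using t(1) by simp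
    have "eval (replicate (Suc k) \<one>) t \<otimes> (t \<ominus> \<one>) = t [^] k \<otimes> (t \<ominus> \<one>) \<oplus> eval (replicate k \<one>) t \<otimes> (t \<ominus> \<one>)"
      using t(1) c[of k] by (simp add: l_distr)
    also have "\<dots> = t [^] Suc k \<ominus> \<one>" unfolding Suc nat_pow_Suc using t(1) pc r_one[OF pc] by algebra
    finally show ?case .
  qed
  have "t [^] l \<ominus> \<one> = \<zero>" using g[of l] t by simp
  then have "t [^] l = \<one>" using t(1) r_right_minus_eq[of "t [^] l" \<one>] by simp
  moreover have "t \<noteq> \<one>"
  proof
    assume 1: "t = \<one>"
    have "eval (replicate k \<one>) \<one> = \<iota> (int k)" for k
    proof (induction k)
      case (Suc k)
      then show ?case using of_integer_add[of 1 "int k"] by simp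
    qed simp
    then have "\<iota> (int l) = \<zero>" using t(2) 1 by simp
    then show False using l1 by simp
  qed
  ultimately show ?thesis using t(1) by blast
qed

text \<open>Induction over the prime factors: an l-th root of a primitive m-th root has order l m
  unless its m-th power is 1, and then multiplying it by a nontrivial l-th root of unity repairs
  this.\<close>

lemma primitive_root_exists: "n > 0 \<Longrightarrow> \<exists>z. primitive_root n z"
proof (induction n rule: prime_divisors_induct)
  case (unit n)
  then have "primitive_root n \<one>" by (simp add: primitive_root_def)
  then show ?case by blast
next
  case (factor l m)
  have l: "Factorial_Ring.prime l" and m0: "m > 0" using factor by auto
  obtain z where "primitive_root m z" using factor m0 by blast
  then have z: "z \<in> carrier L" "\<And>k::nat. z [^] k = \<one> \<longleftrightarrow> m dvd k" by (auto simp: primitive_root_def)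
  obtain t where t: "t \<in> carrier L" "t [^] l = \<one>" "t \<noteq> \<one>" using nontrivial_prime_root[OF l] by blast
  have l0: "l > 0" using prime_gt_0_nat[OF l] .
  have "set (replicate (l - 1) \<zero> @ [\<ominus> z]) \<subseteq> carrier L" using z(1) by (auto simp: set_replicate_conv_if)
  then obtain x where x: "x \<in> carrier L" "eval (\<one> # replicate (l - 1) \<zero> @ [\<ominus> z]) x = \<zero>"
    using AC.monic_root_exists by blast
  then have xz: "x [^] l = z" using eval_pow_minus[OF l0 x(1) z(1)] z(1) r_right_minus_eq[of "x [^] l" z] by simp
  have key: "primitive_root (l * m) y" if y: "y \<in> carrier L" "y [^] l = z" "y [^] m \<noteq> \<one>" for y
  proof -
    have ylm: "y [^] (l * m) = \<one>" using y(1,2) z by (simp add: nat_pow_pow[symmetric])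
    have "y [^] k = \<one> \<longleftrightarrow> l * m dvd k" for k :: nat
    proof
      assume yk: "y [^] k = \<one>"
      have "z [^] k = (y [^] k) [^] l" using y(1) unfolding y(2)[symmetric] by (simp add: nat_pow_pow mult.commute)
      then have "z [^] k = \<one>" using yk by simp
      then obtain j where j: "k = m * j" using z(2) by (auto elim: dvdE)
      have "l dvd j"
      proof (rule ccontr)
        assume "\<not> l dvd j"
        then have "coprime l j" using l by (simp add: prime_imp_coprime)
        moreover have "(y [^] m) [^] l = \<one>" using ylm y(1) by (simp add: nat_pow_pow mult.commute)
        moreover have "(y [^] m) [^] j = \<one>" using yk y(1) by (simp add: nat_pow_pow j)
        ultimately have "y [^] m = \<one>" using pow_coprime_eq_one y(1) by (metis nat_pow_closed)
        then show False using y(3) by simp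
      qed
      then show "l * m dvd k" using j by (simp add: mult.commute mult_dvd_mono)
    next
      assume "l * m dvd k"
      then obtain j where "k = l * m * j" by (elim dvdE)
      then show "y [^] k = \<one>" using ylm y(1) by (simp add: nat_pow_pow[symmetric])
    qed
    then show ?thesis using y(1) l0 m0 by (simp add: primitive_root_def)
  qed
  show ?case
  proof (cases "x [^] m = \<one>")
    case False
    then show ?thesis using key[OF x(1) xz] by blast
  next
    case True
    \<comment> \<open>If x and t x both failed, then t^m = 1, so l would divide m, and z^(m/l) = x^m
      = 1 would contradict the order of z.\<close>
    have "(t \<otimes> x) [^] m \<noteq> \<one>"
    proof
      assume "(t \<otimes> x) [^] m = \<one>"
      then have tm: "t [^] m = \<one>" using t(1) x(1) True by (simp add: nat_pow_distrib)
      have "l dvd m"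
      proof (rule ccontr)
        assume "\<not> l dvd m"
        then have "coprime l m" using l by (simp add: prime_imp_coprime)
        then show False using pow_coprime_eq_one[OF t(1,2) tm] t(3) by simp
      qed
      then obtain m' where m': "m = l * m'" by (elim dvdE)
      have "z [^] m' = \<one>" using True x(1) unfolding xz[symmetric] m' by (simp add: nat_pow_pow)
      then have "m dvd m'" using z(2) by simp
      then show False using m' m0 prime_gt_1_nat[OF l] by (auto dest: dvd_imp_le)
    qed
    moreover have "(t \<otimes> x) [^] l = z" using t x xz z(1) by (simp add: nat_pow_distrib)
    ultimately show ?thesis using key[of "t \<otimes> x"] t(1) x(1) by auto
  qed
qed simp

section \<open>The cyclotomic character of an automorphism\<close>

lemma ring_hom_pow:
  assumes "\<psi> \<in> ring_hom L L" "x \<in> carrier L"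
  shows "\<psi> (x [^] (n::nat)) = \<psi> x [^] n"
  by (induction n) (use assms ring_hom_mult[OF assms(1)] ring_hom_one[OF assms(1)] in auto)

text \<open>The exponent at level n is read off from a primitive root. Being reduced modulo n it is
  unique, which gives the compatibility of the levels.\<close>

lemma ring_hom_roots_of_unity:
  assumes s: "\<psi> \<in> ring_hom L L"
  shows "\<exists>a\<in>carrier Zhat. \<forall>n>0. \<forall>w\<in>carrier L. w [^] n = \<one> \<longrightarrow> \<psi> w = w [^] (a n)"
proof -
  have ex: "\<exists>k<n. \<forall>w\<in>carrier L. w [^] n = \<one> \<longrightarrow> \<psi> w = w [^] k" if n: "n > 0" for n :: nat
  proof -
    obtain z where z: "primitive_root n z" using primitive_root_exists[OF n] by blast
    have zc: "z \<in> carrier L" "z [^] n = \<one>" using z by (auto simp: primitive_root_def)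
    have sz: "\<psi> z \<in> carrier L" "\<psi> z [^] n = \<one>"
      using ring_hom_closed[OF s zc(1)] ring_hom_pow[OF s zc(1), of n] zc(2) ring_hom_one[OF s] by auto
    obtain k where k: "k < n" "\<psi> z = z [^] k" using primitive_root_powers[OF z sz] by blast
    have "\<psi> w = w [^] k" if w: "w \<in> carrier L" "w [^] n = \<one>" for w
    proof -
      obtain j :: nat where j: "w = z [^] j" using primitive_root_powers[OF z w] by blast
      then show ?thesis using ring_hom_pow[OF s zc(1), of j] k(2) zc(1) by (simp add: nat_pow_pow mult.commute)
    qed
    then show ?thesis using k(1) by blast
  qed
  have "\<exists>a0. \<forall>n::nat. n > 0 \<longrightarrow> a0 n < n \<and> (\<forall>w\<in>carrier L. w [^] n = \<one> \<longrightarrow> \<psi> w = w [^] (a0 n :: nat))"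
    by (rule choice) (use ex in blast)
  then obtain a0 :: "nat \<Rightarrow> nat" where a0: "\<And>n. n > 0 \<Longrightarrow> a0 n < n"
      "\<And>n w. n > 0 \<Longrightarrow> w \<in> carrier L \<Longrightarrow> w [^] n = \<one> \<Longrightarrow> \<psi> w = w [^] (a0 n)"
    by blast
  \<comment> \<open>No root of unity constrains level 0; the value 0 is the normalisation in
    \<open>Zhat\<close>.\<close>
  define a where "a n = (if n = 0 then 0 else a0 n)" for n
  have a: "a 0 = 0" "\<And>n. n > 0 \<Longrightarrow> a n < n"
      "\<And>n w. n > 0 \<Longrightarrow> w \<in> carrier L \<Longrightarrow> w [^] n = \<one> \<Longrightarrow> \<psi> w = w [^] (a n)"
    using a0 by (auto simp: a_def)
  have "a n mod m = a m" if mn: "m > 0" "n > 0" "m dvd n" for m n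
  proof -
    obtain z where z: "primitive_root m z" using primitive_root_exists[OF mn(1)] by blast
    have zc: "z \<in> carrier L" "z [^] m = \<one>" "z [^] n = \<one>" using z mn(3) by (auto simp: primitive_root_def)
    have "z [^] a n = z [^] a m" using a(3)[OF mn(1) zc(1,2)] a(3)[OF mn(2) zc(1,3)] by simp
    then show ?thesis using primitive_root_pow_eq_iff[OF z] a(2)[OF mn(1)] by simp
  qed
  then have "a \<in> carrier Zhat" using a(1,2) by (simp add: Zhat_def)
  then show ?thesis using a(3) by blast
qed

text \<open>Justifies the definite description: exponents come from
  \<open>ring_hom_roots_of_unity\<close>, invertibility in \<open>Zhat\<close> from the exponents of
  the inverse automorphism, and uniqueness from primitive roots.\<close>

lemma cyclotomic_character:
  assumes s: "\<psi> \<in> ring_hom L L" "\<psi> \<in> Bij (carrier L)"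
  shows cyclotomic_character_Zhat: "cyclotomic_character L \<psi> \<in> carrier Zhat"
    and cyclotomic_character_root: "n > 0 \<Longrightarrow> w \<in> carrier L \<Longrightarrow> w [^] n = \<one> \<Longrightarrow>
      \<psi> w = w [^] (cyclotomic_character L \<psi> n)"
proof -
  have b: "bij_betw \<psi> (carrier L) (carrier L)" using s(2) by (simp add: Bij_def)
  define r where "r = inv_into (carrier L) \<psi>"
  have "\<psi> \<in> ring_iso L L" using s(1) b by (simp add: ring_iso_def)
  then have r: "r \<in> ring_hom L L" unfolding r_def using ring_iso_set_sym[OF ring_axioms] by (auto simp: ring_iso_def)
  have sr: "\<psi> (r x) = x" if "x \<in> carrier L" for x
    unfolding r_def using b that by (simp add: bij_betw_inv_into_right)
  obtain a where a: "a \<in> carrier Zhat" "\<And>n w. n > 0 \<Longrightarrow> w \<in> carrier L \<Longrightarrow> w [^] n = \<one> \<Longrightarrow> \<psi> w = w [^] (a n)"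
    using ring_hom_roots_of_unity[OF s(1)] by blast
  obtain c where c: "c \<in> carrier Zhat" "\<And>n w. n > 0 \<Longrightarrow> w \<in> carrier L \<Longrightarrow> w [^] n = \<one> \<Longrightarrow> r w = w [^] (c n)"
    using ring_hom_roots_of_unity[OF r] by blast
  have ac: "(a n * c n) mod n = 1 mod n" if n: "n > 0" for n
  proof -
    obtain z where z: "primitive_root n z" using primitive_root_exists[OF n] by blast
    have zc: "z \<in> carrier L" "z [^] n = \<one>" using z by (auto simp: primitive_root_def)
    have "z = \<psi> (z [^] c n)" using sr[OF zc(1)] c(2)[OF n zc] by simp
    also have "\<dots> = z [^] (a n * c n)"
      using ring_hom_pow[OF s(1) zc(1)] a(2)[OF n zc] zc(1) by (simp add: nat_pow_pow)
    finally have "z [^] (a n * c n) = z [^] (1::nat)" using zc(1) by simp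
    then show ?thesis using primitive_root_pow_eq_iff[OF z] by blast
  qed
  have z0: "a 0 = 0" "c 0 = 0" using a(1) c(1) by (auto simp: Zhat_def)
  have "c \<otimes>\<^bsub>Zhat\<^esub> a = \<one>\<^bsub>Zhat\<^esub>" "a \<otimes>\<^bsub>Zhat\<^esub> c = \<one>\<^bsub>Zhat\<^esub>"
    using ac z0 by (auto simp: Zhat_def fun_eq_iff mult.commute)
  then have aU: "a \<in> Units Zhat" using a(1) c(1) by (auto simp: Units_def)
  have "cyclotomic_character L \<psi> = a"
    unfolding cyclotomic_character_def
  proof (rule the_equality)
    show "a \<in> Units Zhat \<and> (\<forall>n>0. \<forall>\<zeta>\<in>carrier L. \<zeta> [^] n = \<one> \<longrightarrow> \<psi> \<zeta> = \<zeta> [^] a n)"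
      using aU a(2) by blast
    fix d assume d: "d \<in> Units Zhat \<and> (\<forall>n>0. \<forall>\<zeta>\<in>carrier L. \<zeta> [^] n = \<one> \<longrightarrow> \<psi> \<zeta> = \<zeta> [^] d n)"
    then have dc: "d \<in> carrier Zhat" by (auto simp: Units_def)
    show "d = a"
    proof
      fix n
      show "d n = a n"
      proof (cases "n = 0")
        case True
        then show ?thesis using dc a(1) by (simp add: Zhat_def)
      next
        case False
        then have n: "n > 0" by simp
        obtain z where z: "primitive_root n z" using primitive_root_exists[OF n] by blast
        have zc: "z \<in> carrier L" "z [^] n = \<one>" using z by (auto simp: primitive_root_def)
        have "z [^] d n = z [^] a n" using d n zc a(2)[OF n zc] by auto
        moreover have "d n < n" "a n < n" using dc a(1) n by (auto simp: Zhat_def)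
        ultimately show ?thesis using primitive_root_pow_eq_iff[OF z] by simp
      qed
    qed
  qed
  then show "cyclotomic_character L \<psi> \<in> carrier Zhat"
    and "n > 0 \<Longrightarrow> w \<in> carrier L \<Longrightarrow> w [^] n = \<one> \<Longrightarrow> \<psi> w = w [^] (cyclotomic_character L \<psi> n)"
    using a by auto
qed

text \<open>One primitive root determines the value at level n, so later computations follow a
  single root of unity.\<close>

lemma cyclotomic_character_eqI:
  assumes s: "\<psi> \<in> ring_hom L L" "\<psi> \<in> Bij (carrier L)" and z: "primitive_root n z" and k: "\<psi> z = z [^] (k::nat)"
  shows "cyclotomic_character L \<psi> n = k mod n"
proof -
  have zc: "n > 0" "z \<in> carrier L" "z [^] n = \<one>" using z by (auto simp: primitive_root_def)
  have "z [^] k = z [^] cyclotomic_character L \<psi> n"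
    using cyclotomic_character_root[OF s zc] k by simp
  then have "k mod n = cyclotomic_character L \<psi> n mod n" using primitive_root_pow_eq_iff[OF z] by blast
  moreover have "cyclotomic_character L \<psi> n < n"
    using cyclotomic_character_Zhat[OF s] zc(1) by (simp add: Zhat_def)
  ultimately show ?thesis by simp
qed

lemma cyclotomic_character_dvd:
  assumes s: "\<psi> \<in> ring_hom L L" "\<psi> \<in> Bij (carrier L)" and "n > 0" "m dvd n"
  shows "cyclotomic_character L \<psi> n mod m = cyclotomic_character L \<psi> m"
proof -
  have "m > 0" using assms(3,4) by (simp add: dvd_pos_nat)
  then show ?thesis using cyclotomic_character_Zhat[OF s] assms(3,4) by (simp add: Zhat_def)
qed

section \<open>The cyclotomic character on the inertia group\<close>

abbreviation (input) "I \<equiv> inertia_group L Q av K"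

lemma inertia_hom: "\<psi> \<in> carrier I \<Longrightarrow> \<psi> \<in> ring_hom L L" "\<psi> \<in> carrier I \<Longrightarrow> \<psi> \<in> Bij (carrier L)"
  by (auto simp: inertia_iff)

lemma inertia_mult:
  assumes "\<psi> \<in> carrier I" "\<phi> \<in> carrier I" "x \<in> carrier L"
  shows "(\<psi> \<otimes>\<^bsub>I\<^esub> \<phi>) x = \<psi> (\<phi> x)"
  using inertia_hom(2)[OF assms(1)] inertia_hom(2)[OF assms(2)] assms(3)
  by (simp add: inertia_group_def galois_group_def BijGroup_def compose_def)

lemma cyclotomic_character_mult:
  assumes s: "\<psi> \<in> carrier I" "\<phi> \<in> carrier I" "\<psi> \<otimes>\<^bsub>I\<^esub> \<phi> \<in> carrier I" and n: "n > 0"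
  shows "cyclotomic_character L (\<psi> \<otimes>\<^bsub>I\<^esub> \<phi>) n
    = (cyclotomic_character L \<psi> n * cyclotomic_character L \<phi> n) mod n"
proof -
  obtain z where z: "primitive_root n z" using primitive_root_exists[OF n] by blast
  have zc: "z \<in> carrier L" "z [^] n = \<one>" using z by (auto simp: primitive_root_def)
  have "(\<psi> \<otimes>\<^bsub>I\<^esub> \<phi>) z = \<psi> (z [^] cyclotomic_character L \<phi> n)"
    using inertia_mult[OF s(1,2) zc(1)] cyclotomic_character_root[OF inertia_hom[OF s(2)] n zc] by simp
  also have "\<dots> = z [^] (cyclotomic_character L \<psi> n * cyclotomic_character L \<phi> n)"
    using ring_hom_pow[OF inertia_hom(1)[OF s(1)] zc(1)] cyclotomic_character_root[OF inertia_hom[OF s(1)] n zc] zc(1)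
    by (simp add: nat_pow_pow)
  finally show ?thesis by (rule cyclotomic_character_eqI[OF inertia_hom[OF s(3)] z])
qed

lemma cyclotomic_character_one:
  assumes "\<one>\<^bsub>I\<^esub> \<in> carrier I" and n: "n > 0"
  shows "cyclotomic_character L \<one>\<^bsub>I\<^esub> n = 1 mod n"
proof -
  obtain z where z: "primitive_root n z" using primitive_root_exists[OF n] by blast
  have zc: "z \<in> carrier L" using z by (auto simp: primitive_root_def)
  have "\<one>\<^bsub>I\<^esub> z = z [^] (1::nat)"
    using zc by (simp add: inertia_group_def galois_group_def BijGroup_def)
  then show ?thesis by (rule cyclotomic_character_eqI[OF inertia_hom[OF assms(1)] z])
qed

lemma cyclotomic_character_prime_to_p:
  assumes s: "\<psi> \<in> carrier I" and m: "m > 0" "coprime m p"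
  shows "cyclotomic_character L \<psi> m = 1 mod m"
proof -
  obtain z where z: "primitive_root m z" using primitive_root_exists[OF m(1)] by blast
  have zc: "z \<in> carrier L" "z [^] m = \<one>" using z by (auto simp: primitive_root_def)
  then have "z \<in> mu" using m by (auto simp: mu_def)
  then have "\<psi> z = z [^] (1::nat)" using inertia_fixes_mu[OF s] zc(1) by simp
  then show ?thesis by (rule cyclotomic_character_eqI[OF inertia_hom[OF s] z])
qed

text \<open>z and its power z^u both have exact order p^(k+1), since u is prime to p, so an
  automorphism over \<open>KU\<close> takes the one to the other.\<close>

lemma cyclotomic_character_surj:
  assumes u: "coprime u p"
  shows "\<exists>\<psi>\<in>carrier I. cyclotomic_character L \<psi> (p ^ k * p) = u mod (p ^ k * p)"
proof -
  have p0: "p > 0" using prime_gt_0_nat[OF prime_p] .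
  then have n: "p ^ k * p > 0" by simp
  obtain z where z: "primitive_root (p ^ k * p) z" using primitive_root_exists[OF n] by blast
  have zc: "z \<in> carrier L" "\<And>j::nat. z [^] j = \<one> \<longleftrightarrow> p ^ k * p dvd j" using z by (auto simp: primitive_root_def)
  have nd: "\<not> p ^ k * p dvd p ^ k * v" if v: "coprime v p" for v
  proof
    assume "p ^ k * p dvd p ^ k * v"
    then have "p dvd v" using p0 by simp
    then have "p dvd 1" using v by (metis coprime_common_divisor dvd_refl)
    then show False using prime_gt_1_nat[OF prime_p] by simp
  qed
  have z1: "z [^] (p ^ k * p) = \<one>" using zc(2)[of "p ^ k * p"] by simp
  have z2: "z [^] (p ^ k) \<noteq> \<one>" using zc(2)[of "p ^ k"] nd[of 1] by simp
  let ?y = "z [^] u"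
  have yc: "?y \<in> carrier L" using zc(1) by simp
  have "?y [^] (p ^ k * p) = (z [^] (p ^ k * p)) [^] u" using zc(1) by (simp add: nat_pow_pow mult.commute)
  then have y1: "?y [^] (p ^ k * p) = \<one>" using z1 by simp
  have y2: "?y [^] (p ^ k) \<noteq> \<one>"
  proof
    assume "?y [^] (p ^ k) = \<one>"
    then have "z [^] (p ^ k * u) = \<one>" using zc(1) by (simp add: nat_pow_pow mult.commute)
    then show False using zc(2)[of "p ^ k * u"] nd[OF u] by blast
  qed
  obtain \<psi> where s: "\<psi> \<in> Bij (carrier L)" "\<psi> \<in> ring_hom L L" "\<forall>a\<in>KU. \<psi> a = a" "\<psi> z = ?y"
    using automorphism_on_p_power_roots[OF zc(1) z1 z2 yc y1 y2] by blast
  have "\<psi> \<in> carrier I" by (rule inertia_if_fixes_KU[OF s(1-3)])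
  moreover have "cyclotomic_character L \<psi> (p ^ k * p) = u mod (p ^ k * p)"
    by (rule cyclotomic_character_eqI[OF s(2,1) z s(4)])
  ultimately show ?thesis by blast
qed

lemma cyclotomic_character_fixing:
  assumes "\<psi> \<in> fixing_roots_of_unity L p (carrier I)"
  shows "cyclotomic_character L \<psi> p = 1"
proof -
  have s: "\<psi> \<in> carrier I" "\<And>z. z \<in> carrier L \<Longrightarrow> z [^] p = \<one> \<Longrightarrow> \<psi> z = z"
    using assms by (auto simp: fixing_roots_of_unity_def)
  obtain z where z: "primitive_root p z" using primitive_root_exists prime_gt_0_nat[OF prime_p] by blast
  have zc: "z \<in> carrier L" "z [^] p = \<one>" using z by (auto simp: primitive_root_def)
  then have "\<psi> z = z [^] (1::nat)" using s(2) by simp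
  then have "cyclotomic_character L \<psi> p = 1 mod p" by (rule cyclotomic_character_eqI[OF inertia_hom[OF s(1)] z])
  then show ?thesis using prime_gt_1_nat[OF prime_p] by simp
qed

end

section \<open>Almost unramified modules with a cyclotomic submodule and trivial quotient\<close>

text \<open>Each p-th power gains a factor p: b^p - 1 = (b - 1)(1 + b + ... + b^(p-1)), and the
  second factor is a sum of p terms congruent to 1 modulo p.\<close>

lemma prime_power_dvd_pow_minus_1:
  fixes a :: int
  assumes "int p dvd a - 1"
  shows "int p ^ Suc n dvd a ^ (p ^ n) - 1"
proof (induction n)
  case 0
  then show ?case using assms by simp
next
  case (Suc n)
  define b where "b = a ^ (p ^ n)"
  have b: "int p ^ Suc n dvd b - 1" using Suc by (simp add: b_def)
  have "int p dvd b - 1" using b dvd_trans[of "int p" "int p ^ Suc n" "b - 1"] by simp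
  then have "int p dvd b ^ i - 1" for i
    using dvd_trans[of "int p" "b - 1" "b ^ i - 1"] by (metis dvd_triv_left power_diff_1_eq)
  then have "int p dvd (\<Sum>i<p. b ^ i - 1)" by (intro dvd_sum) auto
  then have "int p dvd (\<Sum>i<p. b ^ i - 1) + int p" by simp
  then have "int p dvd (\<Sum>i<p. b ^ i)" by (simp add: sum_subtractf)
  then have "int p ^ Suc n * int p dvd (b - 1) * (\<Sum>i<p. b ^ i)" using b by (rule mult_dvd_mono[rotated])
  moreover have "(b - 1) * (\<Sum>i<p. b ^ i) = b ^ p - 1" by (simp add: power_diff_1_eq)
  moreover have "b ^ p = a ^ (p ^ Suc n)" by (simp add: b_def mult.commute flip: power_mult)
  ultimately show ?case by (simp add: mult.commute)
qed

lemma sum_powers_cong: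
  fixes a :: int
  assumes "m dvd a - 1"
  shows "m dvd (\<Sum>i<n. a ^ i) - int n"
proof -
  have "m dvd a ^ i - 1" for i
    using assms dvd_trans[of m "a - 1" "a ^ i - 1"] by (metis dvd_triv_left power_diff_1_eq)
  then have "m dvd (\<Sum>i<n. a ^ i - 1)" by (intro dvd_sum) auto
  then show ?thesis by (simp add: sum_subtractf)
qed

context group_module
begin

abbreviation D :: "'g \<Rightarrow> 'm \<Rightarrow> 'm" where "D g x \<equiv> g \<odot>\<^bsub>M\<^esub> x \<ominus>\<^bsub>M\<^esub> x"

lemma act_diff:
  assumes "g \<in> carrier G" "x \<in> carrier M" "y \<in> carrier M"
  shows "g \<odot>\<^bsub>M\<^esub> (x \<ominus>\<^bsub>M\<^esub> y) = g \<odot>\<^bsub>M\<^esub> x \<ominus>\<^bsub>M\<^esub> g \<odot>\<^bsub>M\<^esub> y"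
proof -
  have "g \<odot>\<^bsub>M\<^esub> (x \<ominus>\<^bsub>M\<^esub> y) \<oplus>\<^bsub>M\<^esub> g \<odot>\<^bsub>M\<^esub> y = g \<odot>\<^bsub>M\<^esub> ((x \<ominus>\<^bsub>M\<^esub> y) \<oplus>\<^bsub>M\<^esub> y)"
    using assms by (simp add: act_add)
  also have "(x \<ominus>\<^bsub>M\<^esub> y) \<oplus>\<^bsub>M\<^esub> y = x" using assms by (simp add: M.minus_eq M.a_assoc M.l_neg)
  finally have *: "g \<odot>\<^bsub>M\<^esub> (x \<ominus>\<^bsub>M\<^esub> y) \<oplus>\<^bsub>M\<^esub> g \<odot>\<^bsub>M\<^esub> y = g \<odot>\<^bsub>M\<^esub> x" .
  then show ?thesis
    using assms act_closed[OF assms(1)] unfolding *[symmetric]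
    by (simp add: M.minus_eq M.a_assoc M.r_neg)
qed

lemma act_int_mult:
  assumes "g \<in> carrier G" "x \<in> carrier M"
  shows "g \<odot>\<^bsub>M\<^esub> ([(k::int)] \<cdot>\<^bsub>M\<^esub> x) = [k] \<cdot>\<^bsub>M\<^esub> (g \<odot>\<^bsub>M\<^esub> x)"
proof -
  have hom: "(\<lambda>x. g \<odot>\<^bsub>M\<^esub> x) \<in> hom (add_monoid M) (add_monoid M)"
    using act_closed[OF assms(1)] act_add[OF assms(1)] by (auto simp: hom_def)
  interpret group_hom "add_monoid M" "add_monoid M" "\<lambda>x. g \<odot>\<^bsub>M\<^esub> x"
    by (intro group_hom.intro group_hom_axioms.intro hom M.a_group)
  show ?thesis using hom_int_pow[of x k] assms(2) by (simp add: add_pow_def)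
qed

lemma D_closed [simp]: "g \<in> carrier G \<Longrightarrow> x \<in> carrier M \<Longrightarrow> D g x \<in> carrier M"
  by (simp add: act_closed)

lemma D_zero_iff: "g \<in> carrier G \<Longrightarrow> x \<in> carrier M \<Longrightarrow> D g x = \<zero>\<^bsub>M\<^esub> \<longleftrightarrow> g \<odot>\<^bsub>M\<^esub> x = x"
proof
  assume g: "g \<in> carrier G" and x: "x \<in> carrier M" and z: "D g x = \<zero>\<^bsub>M\<^esub>"
  have "g \<odot>\<^bsub>M\<^esub> x = D g x \<oplus>\<^bsub>M\<^esub> x"
    using act_closed[OF g x] x by (simp add: M.minus_eq M.a_assoc M.l_neg)
  then show "g \<odot>\<^bsub>M\<^esub> x = x" using z x by simp
qed (simp add: M.minus_eq M.r_neg)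

lemma D_int_mult:
  assumes "g \<in> carrier G" "x \<in> carrier M"
  shows "D g ([(k::int)] \<cdot>\<^bsub>M\<^esub> x) = [k] \<cdot>\<^bsub>M\<^esub> D g x"
  using assms act_closed[OF assms]
  by (simp add: act_int_mult M.minus_eq M.add.int_pow_mult_distrib M.a_comm M.add.int_pow_inv)

lemma int_mult_zero_left:
  assumes "y \<in> carrier M" "[(b::int)] \<cdot>\<^bsub>M\<^esub> y = \<zero>\<^bsub>M\<^esub>"
  shows "[(a * b)] \<cdot>\<^bsub>M\<^esub> y = \<zero>\<^bsub>M\<^esub>"
proof -
  have "[(a * b)] \<cdot>\<^bsub>M\<^esub> y = [a] \<cdot>\<^bsub>M\<^esub> ([b] \<cdot>\<^bsub>M\<^esub> y)"
    using assms(1) by (simp add: M.add.int_pow_pow mult.commute)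
  then show ?thesis using assms by simp
qed

lemma int_mult_coprime_zero:
  assumes y: "y \<in> carrier M" "[(a::int)] \<cdot>\<^bsub>M\<^esub> y = \<zero>\<^bsub>M\<^esub>" "[(b::int)] \<cdot>\<^bsub>M\<^esub> y = \<zero>\<^bsub>M\<^esub>" and ab: "coprime a b"
  shows "y = \<zero>\<^bsub>M\<^esub>"
proof -
  obtain u v where uv: "u * a + v * b = 1" using bezout_int[of a b] ab by auto
  have "[(u * a)] \<cdot>\<^bsub>M\<^esub> y = \<zero>\<^bsub>M\<^esub>" "[(v * b)] \<cdot>\<^bsub>M\<^esub> y = \<zero>\<^bsub>M\<^esub>"
    using y by (intro int_mult_zero_left; simp)+
  then have "[(u * a + v * b)] \<cdot>\<^bsub>M\<^esub> y = \<zero>\<^bsub>M\<^esub>" using y(1) by (simp add: M.add.int_pow_mult)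
  then show ?thesis unfolding uv using y(1) by (simp add: add_pow_int_ge)
qed

section \<open>The module argument for an abstract character modulo p^n m\<close>

context
  fixes c :: "'g \<Rightarrow> int" and p n m :: nat
  assumes p: "Factorial_Ring.prime p" and n0: "n > 0" and mp: "coprime m p"
    and cyc: "\<And>s t x. s \<in> carrier G \<Longrightarrow> t \<in> carrier G \<Longrightarrow> x \<in> carrier M \<Longrightarrow>
      t \<odot>\<^bsub>M\<^esub> D s x = [(c t)] \<cdot>\<^bsub>M\<^esub> D s x"
    and N: "\<And>x. x \<in> carrier M \<Longrightarrow> [(int (p ^ n * m))] \<cdot>\<^bsub>M\<^esub> x = \<zero>\<^bsub>M\<^esub>"
    and c_mult: "\<And>s t. s \<in> carrier G \<Longrightarrow> t \<in> carrier G \<Longrightarrow> int (p ^ n * m) dvd c (s \<otimes>\<^bsub>G\<^esub> t) - c s * c t"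
    and c_one: "int (p ^ n * m) dvd c \<one>\<^bsub>G\<^esub> - 1"
    and c_m: "\<And>s. s \<in> carrier G \<Longrightarrow> int m dvd c s - 1"
    and c_surj: "\<And>u. coprime u p \<Longrightarrow> \<exists>s\<in>carrier G. int (p ^ n) dvd c s - int u"
    and au: "almost_unramified G M"
begin

lemma N_mult: "int (p ^ n * m) dvd k \<Longrightarrow> x \<in> carrier M \<Longrightarrow> [k] \<cdot>\<^bsub>M\<^esub> x = \<zero>\<^bsub>M\<^esub>"
  using int_mult_zero_left[OF _ N] by (auto elim!: dvdE simp: mult.commute)

lemma N_cong:
  assumes "int (p ^ n * m) dvd k - l" "x \<in> carrier M"
  shows "[k] \<cdot>\<^bsub>M\<^esub> x = [l] \<cdot>\<^bsub>M\<^esub> x"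
proof -
  have "[k] \<cdot>\<^bsub>M\<^esub> x = [((k - l) + l)] \<cdot>\<^bsub>M\<^esub> x" by simp
  also have "\<dots> = [l] \<cdot>\<^bsub>M\<^esub> x"
    unfolding M.add.int_pow_mult[OF assms(2)] using N_mult[OF assms] assms(2) by simp
  finally show ?thesis .
qed

lemma D_mult:
  assumes "s \<in> carrier G" "t \<in> carrier G" "x \<in> carrier M"
  shows "D (s \<otimes>\<^bsub>G\<^esub> t) x = [(c s)] \<cdot>\<^bsub>M\<^esub> D t x \<oplus>\<^bsub>M\<^esub> D s x"
proof -
  have cl: "t \<odot>\<^bsub>M\<^esub> x \<in> carrier M" "s \<odot>\<^bsub>M\<^esub> x \<in> carrier M" "s \<odot>\<^bsub>M\<^esub> (t \<odot>\<^bsub>M\<^esub> x) \<in> carrier M"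
    using assms act_closed by auto
  have "[(c s)] \<cdot>\<^bsub>M\<^esub> D t x = s \<odot>\<^bsub>M\<^esub> (t \<odot>\<^bsub>M\<^esub> x) \<ominus>\<^bsub>M\<^esub> s \<odot>\<^bsub>M\<^esub> x"
    using cyc[OF assms(2,1,3)] act_diff[OF assms(1) cl(1) assms(3)] by simp
  then show ?thesis
    using cl assms by (simp add: act_mult M.minus_eq M.a_assoc M.r_neg1)
qed

text \<open>For the product of s and its inverse, \<open>D_mult\<close> reads 0 = c(s) (s^-1 - 1) +
  (s - 1). With c(s) = 1 on \<open>M\<close> this is the relation to which almost unramifiedness
  applies.\<close>

lemma trivial_if_c_1:
  assumes s: "s \<in> carrier G" "int (p ^ n * m) dvd c s - 1" and x: "x \<in> carrier M"
  shows "s \<odot>\<^bsub>M\<^esub> x = x"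
proof -
  let ?i = "inv\<^bsub>G\<^esub> s"
  have i: "?i \<in> carrier G" using s by simp
  have "(s \<odot>\<^bsub>M\<^esub> y \<oplus>\<^bsub>M\<^esub> ?i \<odot>\<^bsub>M\<^esub> y) \<ominus>\<^bsub>M\<^esub> ([(2::nat)] \<cdot>\<^bsub>M\<^esub> y) = \<zero>\<^bsub>M\<^esub>" if y: "y \<in> carrier M" for y
  proof -
    have cl: "s \<odot>\<^bsub>M\<^esub> y \<in> carrier M" "?i \<odot>\<^bsub>M\<^esub> y \<in> carrier M" using s i y act_closed by auto
    have "D (s \<otimes>\<^bsub>G\<^esub> ?i) y = \<zero>\<^bsub>M\<^esub>" using s y by (simp add: act_one M.minus_eq M.r_neg)
    then have "[(c s)] \<cdot>\<^bsub>M\<^esub> D ?i y \<oplus>\<^bsub>M\<^esub> D s y = \<zero>\<^bsub>M\<^esub>" using D_mult[OF s(1) i y] by simp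
    moreover have "[(c s)] \<cdot>\<^bsub>M\<^esub> D ?i y = D ?i y"
      using N_cong[OF s(2) D_closed[OF i y]] D_closed[OF i y] by (simp add: add_pow_int_ge)
    ultimately have "D ?i y \<oplus>\<^bsub>M\<^esub> D s y = \<zero>\<^bsub>M\<^esub>" by simp
    moreover have "[(2::nat)] \<cdot>\<^bsub>M\<^esub> y = y \<oplus>\<^bsub>M\<^esub> y" using y by (simp add: numeral_2_eq_2)
    ultimately show ?thesis using cl y by (simp add: M.minus_eq M.minus_add M.a_ac)
  qed
  then have "\<forall>x\<in>carrier M. D s x = \<zero>\<^bsub>M\<^esub>" using au s(1) i unfolding almost_unramified_def by blast
  then show ?thesis using D_zero_iff[OF s(1) x] x by blast
qed

lemma c_cong_mult: "int (p ^ n * m) dvd a - b \<Longrightarrow> int (p ^ n * m) dvd a' - b' \<Longrightarrow> int (p ^ n * m) dvd a * a' - b * b'"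
proof -
  assume "int (p ^ n * m) dvd a - b" "int (p ^ n * m) dvd a' - b'"
  then have "int (p ^ n * m) dvd (a - b) * a' + b * (a' - b')" by simp
  then show ?thesis by (simp add: algebra_simps)
qed

text \<open>The commutator of s and t has character 1, because the values of c commute, and so it
  acts trivially.\<close>

lemma act_commute:
  assumes s: "s \<in> carrier G" and t: "t \<in> carrier G" and x: "x \<in> carrier M"
  shows "s \<odot>\<^bsub>M\<^esub> (t \<odot>\<^bsub>M\<^esub> x) = t \<odot>\<^bsub>M\<^esub> (s \<odot>\<^bsub>M\<^esub> x)"
proof -
  let ?N = "int (p ^ n * m)" and ?i = "inv\<^bsub>G\<^esub> (t \<otimes>\<^bsub>G\<^esub> s)" and ?w = "(s \<otimes>\<^bsub>G\<^esub> t) \<otimes>\<^bsub>G\<^esub> inv\<^bsub>G\<^esub> (t \<otimes>\<^bsub>G\<^esub> s)"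
  have i: "?i \<in> carrier G" "?w \<in> carrier G" using s t by auto
  have 1: "?N dvd c ?w - c (s \<otimes>\<^bsub>G\<^esub> t) * c ?i" using c_mult[of "s \<otimes>\<^bsub>G\<^esub> t" ?i] s t i by simp
  have "?N dvd (c (s \<otimes>\<^bsub>G\<^esub> t) - c s * c t) - (c (t \<otimes>\<^bsub>G\<^esub> s) - c t * c s)"
    using c_mult[OF s t] c_mult[OF t s] by (rule dvd_diff)
  then have "?N dvd c (s \<otimes>\<^bsub>G\<^esub> t) - c (t \<otimes>\<^bsub>G\<^esub> s)" by (simp add: algebra_simps)
  then have 2: "?N dvd c (s \<otimes>\<^bsub>G\<^esub> t) * c ?i - c (t \<otimes>\<^bsub>G\<^esub> s) * c ?i" by (rule c_cong_mult) simp
  have 3: "?N dvd c \<one>\<^bsub>G\<^esub> - c (t \<otimes>\<^bsub>G\<^esub> s) * c ?i" using c_mult[of "t \<otimes>\<^bsub>G\<^esub> s" ?i] s t i by simp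
  have "?N dvd ((c ?w - c (s \<otimes>\<^bsub>G\<^esub> t) * c ?i) + (c (s \<otimes>\<^bsub>G\<^esub> t) * c ?i - c (t \<otimes>\<^bsub>G\<^esub> s) * c ?i))
      - (c \<one>\<^bsub>G\<^esub> - c (t \<otimes>\<^bsub>G\<^esub> s) * c ?i) + (c \<one>\<^bsub>G\<^esub> - 1)"
    by (rule dvd_add[OF dvd_diff[OF dvd_add[OF 1 2] 3] c_one])
  then have "?N dvd c ?w - 1" by simp
  then have w: "?w \<odot>\<^bsub>M\<^esub> ((t \<otimes>\<^bsub>G\<^esub> s) \<odot>\<^bsub>M\<^esub> x) = (t \<otimes>\<^bsub>G\<^esub> s) \<odot>\<^bsub>M\<^esub> x"
    using s t x by (intro trivial_if_c_1 i act_closed) auto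
  have "?w \<otimes>\<^bsub>G\<^esub> (t \<otimes>\<^bsub>G\<^esub> s) = s \<otimes>\<^bsub>G\<^esub> t" using s t i by (simp add: G.m_assoc)
  then have "(s \<otimes>\<^bsub>G\<^esub> t) \<odot>\<^bsub>M\<^esub> x = ?w \<odot>\<^bsub>M\<^esub> ((t \<otimes>\<^bsub>G\<^esub> s) \<odot>\<^bsub>M\<^esub> x)"
    using act_mult[OF i(2) _ x, of "t \<otimes>\<^bsub>G\<^esub> s"] s t by simp
  then show ?thesis using w s t x by (simp add: act_mult)
qed

text \<open>Expand the operators of s t and t s by \<open>D_mult\<close> and compare.\<close>

lemma D_commute:
  assumes s: "s \<in> carrier G" and t: "t \<in> carrier G" and x: "x \<in> carrier M"
  shows "[(c s - 1)] \<cdot>\<^bsub>M\<^esub> D t x = [(c t - 1)] \<cdot>\<^bsub>M\<^esub> D s x"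
proof -
  have d: "D s x \<in> carrier M" "D t x \<in> carrier M" using s t x by auto
  have e: "[(c s)] \<cdot>\<^bsub>M\<^esub> D t x \<oplus>\<^bsub>M\<^esub> D s x = [(c t)] \<cdot>\<^bsub>M\<^esub> D s x \<oplus>\<^bsub>M\<^esub> D t x"
    using D_mult[OF s t x] D_mult[OF t s x] act_commute[OF s t x] s t x by (simp add: act_mult)
  have pred: "[(k - 1)] \<cdot>\<^bsub>M\<^esub> y = [k] \<cdot>\<^bsub>M\<^esub> y \<ominus>\<^bsub>M\<^esub> y" if "y \<in> carrier M" for k :: int and y
    using M.add.int_pow_diff[OF that, of k 1] that by (simp add: M.minus_eq add_pow_int_ge)
  have cancel: "u \<ominus>\<^bsub>M\<^esub> b = v \<ominus>\<^bsub>M\<^esub> a"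
    if "u \<oplus>\<^bsub>M\<^esub> a = v \<oplus>\<^bsub>M\<^esub> b" "u \<in> carrier M" "v \<in> carrier M" "a \<in> carrier M" "b \<in> carrier M" for a b u v
  proof -
    have "u \<ominus>\<^bsub>M\<^esub> b = (u \<oplus>\<^bsub>M\<^esub> a) \<ominus>\<^bsub>M\<^esub> a \<ominus>\<^bsub>M\<^esub> b"
      using that(2-) by (simp add: M.minus_eq M.a_assoc M.r_neg)
    also have "\<dots> = (v \<ominus>\<^bsub>M\<^esub> a) \<oplus>\<^bsub>M\<^esub> (b \<oplus>\<^bsub>M\<^esub> \<ominus>\<^bsub>M\<^esub> b)"
      unfolding that(1) using that(2-) by (simp add: M.minus_eq M.a_ac)
    also have "\<dots> = v \<ominus>\<^bsub>M\<^esub> a" using that(2-) by (simp add: M.r_neg)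
    finally show ?thesis .
  qed
  show ?thesis
    unfolding pred[OF d(1)] pred[OF d(2)]
    by (rule cancel[OF e]) (use d in auto)
qed

text \<open>A multiplier prime to p can be cancelled on p-power torsion only; since p^n m kills
  \<open>M\<close>, what remains is killed by m.\<close>

lemma m_torsion:
  assumes k: "coprime k (int (p ^ n))" and y: "y \<in> carrier M" "[k] \<cdot>\<^bsub>M\<^esub> y = \<zero>\<^bsub>M\<^esub>"
  shows "[(int m)] \<cdot>\<^bsub>M\<^esub> y = \<zero>\<^bsub>M\<^esub>"
proof (rule int_mult_coprime_zero[OF _ _ _ k])
  show "[(int m)] \<cdot>\<^bsub>M\<^esub> y \<in> carrier M" using y by simp
  have "[k] \<cdot>\<^bsub>M\<^esub> ([(int m)] \<cdot>\<^bsub>M\<^esub> y) = [(int m)] \<cdot>\<^bsub>M\<^esub> ([k] \<cdot>\<^bsub>M\<^esub> y)"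
    using y(1) by (simp add: M.add.int_pow_pow mult.commute)
  then show "[k] \<cdot>\<^bsub>M\<^esub> ([(int m)] \<cdot>\<^bsub>M\<^esub> y) = \<zero>\<^bsub>M\<^esub>" using y by simp
  have "[(int (p ^ n))] \<cdot>\<^bsub>M\<^esub> ([(int m)] \<cdot>\<^bsub>M\<^esub> y) = [(int (p ^ n * m))] \<cdot>\<^bsub>M\<^esub> y"
    using y(1) by (simp add: M.add.int_pow_pow mult.commute)
  then show "[(int (p ^ n))] \<cdot>\<^bsub>M\<^esub> ([(int m)] \<cdot>\<^bsub>M\<^esub> y) = \<zero>\<^bsub>M\<^esub>" using N y(1) by simp
qed

lemma dvd_N_iff: "int (p ^ n * m) dvd k \<longleftrightarrow> int (p ^ n) dvd k \<and> int m dvd k"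
proof -
  have "coprime (int (p ^ n)) (int m)" using mp n0 by (simp add: coprime_commute)
  then show ?thesis
    using divides_mult[of "int (p ^ n)" k "int m"] by (auto intro: dvd_trans[of _ "int (p ^ n) * int m"])
qed

lemma coprime_if_cong:
  assumes "int (p ^ n) dvd k - l" "\<not> int p dvd l"
  shows "coprime k (int (p ^ n))"
proof -
  have pn: "int p dvd int (p ^ n)" using n0 by simp
  have "\<not> int p dvd k"
  proof
    assume "int p dvd k"
    moreover have "int p dvd k - l" using dvd_trans[OF pn assms(1)] .
    ultimately have "int p dvd k - (k - l)" by (rule dvd_diff)
    then show False using assms(2) by simp
  qed
  then have "coprime (int p) k" using p by (simp add: prime_imp_coprime)
  then show ?thesis by (simp add: coprime_commute)
qed

lemma D_pow:
  assumes s: "s \<in> carrier G" and x: "x \<in> carrier M"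
  shows "D (s [^]\<^bsub>G\<^esub> (j::nat)) x = [(\<Sum>i<j. c s ^ i)] \<cdot>\<^bsub>M\<^esub> D s x"
proof (induction j)
  case 0
  then show ?case using x by (simp add: act_one M.minus_eq M.r_neg add_pow_int_ge)
next
  case (Suc j)
  have d: "D s x \<in> carrier M" using s x by simp
  have "D (s [^]\<^bsub>G\<^esub> Suc j) x = D (s \<otimes>\<^bsub>G\<^esub> s [^]\<^bsub>G\<^esub> j) x" using s by (simp only: G.nat_pow_Suc2)
  also have "\<dots> = [(c s)] \<cdot>\<^bsub>M\<^esub> ([(\<Sum>i<j. c s ^ i)] \<cdot>\<^bsub>M\<^esub> D s x) \<oplus>\<^bsub>M\<^esub> D s x"
    using D_mult[OF s _ x, of "s [^]\<^bsub>G\<^esub> j"] s Suc by simp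
  also have "\<dots> = [((\<Sum>i<j. c s ^ i) * c s + 1)] \<cdot>\<^bsub>M\<^esub> D s x"
    using d by (simp add: M.add.int_pow_pow M.add.int_pow_mult add_pow_int_ge)
  also have "(\<Sum>i<j. c s ^ i) * c s + 1 = (\<Sum>i<Suc j. c s ^ i)"
    by (subst sum.lessThan_Suc_shift) (simp add: sum_distrib_left mult.commute)
  finally show ?case .
qed

lemma c_pow:
  assumes s: "s \<in> carrier G"
  shows "int (p ^ n * m) dvd c (s [^]\<^bsub>G\<^esub> (j::nat)) - c s ^ j"
proof (induction j)
  case 0
  then show ?case using c_one by simp
next
  case (Suc j)
  have "int (p ^ n * m) dvd (c (s [^]\<^bsub>G\<^esub> Suc j) - c (s [^]\<^bsub>G\<^esub> j) * c s) + (c (s [^]\<^bsub>G\<^esub> j) * c s - c s ^ j * c s)"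
    using c_mult[of "s [^]\<^bsub>G\<^esub> j" s] s c_cong_mult[OF Suc, of "c s" "c s"] by (intro dvd_add) auto
  then show ?case by (simp add: mult.commute)
qed

text \<open>Controls the part of order prime to p, where \<open>D_commute\<close> is empty because c
  is 1 modulo m. The power s^(p^n) has character 1 and acts trivially, so the geometric sum of the
  powers of c(s) kills \<open>D s x\<close>, and this sum is congruent to p^n modulo m.\<close>

lemma wild_torsion:
  assumes s: "s \<in> carrier G" "int p dvd c s - 1" and x: "x \<in> carrier M"
  shows "\<exists>k. coprime k (int m) \<and> [k] \<cdot>\<^bsub>M\<^esub> D s x = \<zero>\<^bsub>M\<^esub>"
proof -
  let ?t = "s [^]\<^bsub>G\<^esub> (p ^ n)" and ?k = "\<Sum>i<p ^ n. c s ^ i"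
  have t: "?t \<in> carrier G" using s by simp
  have "int p ^ Suc n dvd c s ^ (p ^ n) - 1" by (rule prime_power_dvd_pow_minus_1[OF s(2)])
  then have "int (p ^ n) dvd c s ^ (p ^ n) - 1"
    by (metis dvd_trans le_imp_power_dvd lessI less_imp_le of_nat_power)
  moreover have "int m dvd c s ^ (p ^ n) - 1"
    using c_m[OF s(1)] by (metis dvd_mult2 power_diff_1_eq)
  ultimately have "int (p ^ n * m) dvd c s ^ (p ^ n) - 1" by (simp only: dvd_N_iff)
  then have "int (p ^ n * m) dvd (c ?t - c s ^ (p ^ n)) + (c s ^ (p ^ n) - 1)" using c_pow[OF s(1)] by (intro dvd_add)
  then have "?t \<odot>\<^bsub>M\<^esub> x = x" using trivial_if_c_1[OF t _ x] by simp
  then have "[(?k)] \<cdot>\<^bsub>M\<^esub> D s x = \<zero>\<^bsub>M\<^esub>" using D_pow[OF s(1) x, of "p ^ n"] D_zero_iff[OF t x] by simp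
  moreover have "coprime ?k (int m)"
  proof -
    have *: "int m dvd ?k - int (p ^ n)" by (rule sum_powers_cong[OF c_m[OF s(1)]])
    have "coprime (int (p ^ n)) (int m)" using mp by (simp add: coprime_commute)
    moreover have "gcd ?k (int m) = gcd (int (p ^ n)) (int m)"
    proof -
      have "?k mod int m = int (p ^ n) mod int m" using * by (simp only: mod_eq_dvd_iff)
      then show ?thesis by (metis gcd.commute gcd_red_int)
    qed
    ultimately show ?thesis by (simp only: coprime_iff_gcd_eq_1)
  qed
  ultimately show ?thesis by blast
qed

lemma sum_zero_imp_trivial:
  assumes s: "s \<in> carrier G" and t: "t \<in> carrier G"
    and z: "\<And>x. x \<in> carrier M \<Longrightarrow> D s x \<oplus>\<^bsub>M\<^esub> D t x = \<zero>\<^bsub>M\<^esub>" and x: "x \<in> carrier M"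
  shows "s \<odot>\<^bsub>M\<^esub> x = x"
proof -
  have "(s \<odot>\<^bsub>M\<^esub> y \<oplus>\<^bsub>M\<^esub> t \<odot>\<^bsub>M\<^esub> y) \<ominus>\<^bsub>M\<^esub> ([(2::nat)] \<cdot>\<^bsub>M\<^esub> y) = \<zero>\<^bsub>M\<^esub>" if y: "y \<in> carrier M" for y
  proof -
    have cl: "s \<odot>\<^bsub>M\<^esub> y \<in> carrier M" "t \<odot>\<^bsub>M\<^esub> y \<in> carrier M" using s t y act_closed by auto
    have "[(2::nat)] \<cdot>\<^bsub>M\<^esub> y = y \<oplus>\<^bsub>M\<^esub> y" using y by (simp add: numeral_2_eq_2)
    then show ?thesis using z[OF y] cl y by (simp add: M.minus_eq M.minus_add M.a_ac)
  qed
  then have "\<forall>x\<in>carrier M. D s x = \<zero>\<^bsub>M\<^esub>" using au s t unfolding almost_unramified_def by blast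
  then show ?thesis using D_zero_iff[OF s x] x by blast
qed

lemma wild_trivial:
  assumes podd: "odd p" and s: "s \<in> carrier G" "int p dvd c s - 1" and x: "x \<in> carrier M"
  shows "s \<odot>\<^bsub>M\<^esub> x = x"
proof -
  have p3: "p \<ge> 3" using podd prime_ge_2_nat[OF p] by (cases "p = 2") auto
  have pn: "int p dvd int (p ^ n)" using n0 by simp
  have pn0: "p ^ n > 0" using prime_gt_0_nat[OF p] by simp
  \<comment> \<open>A natural number representing 2 - c(s) modulo p^n; it is 1 modulo p, hence prime
    to p and a value of the character.\<close>
  define u where "u = nat ((2 - c s) mod int (p ^ n))"
  have u: "int (p ^ n) dvd int u - (2 - c s)"
    using pn0 by (simp add: u_def mod_eq_dvd_iff[symmetric] del: of_nat_power)
  have up: "int p dvd int u - 1"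
  proof -
    have "int p dvd (int u - (2 - c s)) - (c s - 1)" using dvd_trans[OF pn u] s(2) by (rule dvd_diff)
    then show ?thesis by (simp add: algebra_simps)
  qed
  have "coprime u p"
  proof -
    have "\<not> int p dvd int u"
    proof
      assume "int p dvd int u"
      then have "int p dvd int u - (int u - 1)" using up by (rule dvd_diff)
      then show False using prime_gt_1_nat[OF p] by simp
    qed
    then have "\<not> p dvd u" by (simp add: int_dvd_int_iff)
    then show ?thesis using p by (simp add: prime_imp_coprime coprime_commute)
  qed
  then obtain k where k: "k \<in> carrier G" "int (p ^ n) dvd c k - int u" using c_surj by blast
  have kp: "int p dvd c k - 1"
  proof -
    have "int p dvd (c k - int u) + (int u - 1)" using dvd_trans[OF pn k(2)] up by (rule dvd_add)
    then show ?thesis by simp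
  qed
  have sum: "int (p ^ n * m) dvd (c s - 1) + (c k - 1)"
  proof (subst dvd_N_iff, rule conjI)
    have "int (p ^ n) dvd (c k - int u) + (int u - (2 - c s))" using k(2) u by (rule dvd_add)
    then show "int (p ^ n) dvd (c s - 1) + (c k - 1)" by (simp add: algebra_simps)
    show "int m dvd (c s - 1) + (c k - 1)" using c_m[OF s(1)] c_m[OF k(1)] by (rule dvd_add)
  qed
  \<comment> \<open>An element g of character 2 modulo p^n has c(g) - 1 equal to 1 there, so
    comparison with g loses nothing on p-power torsion. It exists because p is odd.\<close>
  have "coprime 2 p" using podd by simp
  then obtain g where g: "g \<in> carrier G" "int (p ^ n) dvd c g - int 2" using c_surj by blast
  have "int (p ^ n) dvd (c g - 1) - 1" using g(2) by simp
  moreover have "\<not> int p dvd 1" using prime_gt_1_nat[OF p] by simp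
  ultimately have cg: "coprime (c g - 1) (int (p ^ n))" by (rule coprime_if_cong)
  have "D s y \<oplus>\<^bsub>M\<^esub> D k y = \<zero>\<^bsub>M\<^esub>" if y: "y \<in> carrier M" for y
  proof -
    have d: "D s y \<in> carrier M" "D k y \<in> carrier M" "D g y \<in> carrier M" using s k g y by auto
    have add: "[a] \<cdot>\<^bsub>M\<^esub> (D s y \<oplus>\<^bsub>M\<^esub> D k y) = [a] \<cdot>\<^bsub>M\<^esub> D s y \<oplus>\<^bsub>M\<^esub> [a] \<cdot>\<^bsub>M\<^esub> D k y" for a :: int
      using d by (simp add: M.add.int_pow_mult_distrib M.a_comm)
    \<comment> \<open>By \<open>D_commute\<close> both terms become multiples of
      \<open>D g y\<close>, and the total multiplier c(s) + c(k) - 2 is 0 modulo p^n m.\<close>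
    have "[(c g - 1)] \<cdot>\<^bsub>M\<^esub> (D s y \<oplus>\<^bsub>M\<^esub> D k y) = [((c s - 1) + (c k - 1))] \<cdot>\<^bsub>M\<^esub> D g y"
      unfolding add D_commute[OF g(1) s(1) y] D_commute[OF g(1) k(1) y] using d(3) by (simp only: M.add.int_pow_mult)
    also have "\<dots> = \<zero>\<^bsub>M\<^esub>" by (rule N_mult[OF sum d(3)])
    finally have m: "[(int m)] \<cdot>\<^bsub>M\<^esub> (D s y \<oplus>\<^bsub>M\<^esub> D k y) = \<zero>\<^bsub>M\<^esub>" using d by (intro m_torsion[OF cg]) auto
    \<comment> \<open>Only m-torsion is left, and \<open>wild_torsion\<close> removes it, as both s
      and k have character 1 modulo p.\<close>
    obtain a b where ab: "coprime a (int m)" "[a] \<cdot>\<^bsub>M\<^esub> D s y = \<zero>\<^bsub>M\<^esub>" "coprime b (int m)" "[b] \<cdot>\<^bsub>M\<^esub> D k y = \<zero>\<^bsub>M\<^esub>"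
      using wild_torsion[OF s y] wild_torsion[OF k(1) kp y] by blast
    have "[(a * b)] \<cdot>\<^bsub>M\<^esub> D s y = \<zero>\<^bsub>M\<^esub>" "[(a * b)] \<cdot>\<^bsub>M\<^esub> D k y = \<zero>\<^bsub>M\<^esub>"
      using int_mult_zero_left[OF d(1) ab(2), of b] int_mult_zero_left[OF d(2) ab(4), of a] by (simp_all add: mult.commute)
    then have "[(a * b)] \<cdot>\<^bsub>M\<^esub> (D s y \<oplus>\<^bsub>M\<^esub> D k y) = \<zero>\<^bsub>M\<^esub>" by (simp add: add)
    then show ?thesis using int_mult_coprime_zero[OF _ _ m] d ab(1,3) by simp
  qed
  then show ?thesis using sum_zero_imp_trivial[OF s(1) k(1) _ x] by blast
qed

text \<open>Goodness takes the place of \<open>wild_torsion\<close>: p^n y is killed by m and hence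
  fixed by the group, so p^n kills every \<open>D s y\<close>, and it is enough to show that m kills
  what has to vanish.\<close>

lemma good_trivial:
  assumes p5: "p \<ge> 5" and good: "\<And>s x. s \<in> carrier G \<Longrightarrow> x \<in> carrier M \<Longrightarrow> [(int m)] \<cdot>\<^bsub>M\<^esub> x = \<zero>\<^bsub>M\<^esub> \<Longrightarrow> D s x = \<zero>\<^bsub>M\<^esub>"
    and t: "t \<in> carrier G" and x: "x \<in> carrier M"
  shows "t \<odot>\<^bsub>M\<^esub> x = x"
proof -
  have pn0: "p ^ n > 0" using prime_gt_0_nat[OF p] by simp
  have Dpn: "[(int (p ^ n))] \<cdot>\<^bsub>M\<^esub> D s y = \<zero>\<^bsub>M\<^esub>" if s: "s \<in> carrier G" and y: "y \<in> carrier M" for s y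
  proof -
    have "[(int m)] \<cdot>\<^bsub>M\<^esub> ([(int (p ^ n))] \<cdot>\<^bsub>M\<^esub> y) = \<zero>\<^bsub>M\<^esub>" using N[OF y] y by (simp add: M.add.int_pow_pow)
    then have "D s ([(int (p ^ n))] \<cdot>\<^bsub>M\<^esub> y) = \<zero>\<^bsub>M\<^esub>" using good[OF s] y by simp
    then show ?thesis using D_int_mult[OF s y] by simp
  qed
  have zero: "y = \<zero>\<^bsub>M\<^esub>" if "y \<in> carrier M" "[(int m)] \<cdot>\<^bsub>M\<^esub> y = \<zero>\<^bsub>M\<^esub>" "[(int (p ^ n))] \<cdot>\<^bsub>M\<^esub> y = \<zero>\<^bsub>M\<^esub>" for y
    using int_mult_coprime_zero[OF that] mp by simp
  have small: "\<not> int p dvd int i" if "0 < i" "i < 5" for i :: nat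
    using p5 that by (simp only: int_dvd_int_iff) (auto dest: dvd_imp_le)
  \<comment> \<open>p^n - 1 is the natural number that represents -1 modulo p^n.\<close>
  have "coprime (p ^ n - 1) (p ^ n)" by (rule coprime_diff_one_left_nat[OF pn0])
  then have "coprime (p ^ n - 1) p" using n0 by simp
  then obtain g where g: "g \<in> carrier G" "int (p ^ n) dvd c g - int (p ^ n - 1)" using c_surj by blast
  \<comment> \<open>Here p >= 5 excludes p = 3: the number 3 has to be a unit, so that -1 and 3 are
    both values of the character, with sum 2.\<close>
  have "\<not> p dvd 3" using p5 by (auto dest: dvd_imp_le)
  then have "coprime 3 p" using p by (simp add: prime_imp_coprime coprime_commute)
  then obtain h where h: "h \<in> carrier G" "int (p ^ n) dvd c h - int 3" using c_surj by blast
  have gm: "int (p ^ n) dvd c g + 1"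
  proof -
    have "int (p ^ n) dvd (c g - int (p ^ n - 1)) + int (p ^ n)" using g(2) by simp
    moreover have "(c g - int (p ^ n - 1)) + int (p ^ n) = c g + 1"
      using of_nat_diff[of 1 "p ^ n", where 'a = int] pn0 by linarith
    ultimately show ?thesis by simp
  qed
  have "int (p ^ n) dvd (c g - 1) - (- 2)" using gm by (simp add: add.commute)
  moreover have "\<not> int p dvd - 2" using small[of 2] by simp
  ultimately have cg: "coprime (c g - 1) (int (p ^ n))" by (rule coprime_if_cong)
  have sum: "int (p ^ n * m) dvd (c g - 1) + (c h - 1)"
  proof (subst dvd_N_iff, rule conjI)
    have "int (p ^ n) dvd (c g + 1) + (c h - int 3)" using gm h(2) by (rule dvd_add)
    then show "int (p ^ n) dvd (c g - 1) + (c h - 1)" by (simp add: algebra_simps)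
    show "int m dvd (c g - 1) + (c h - 1)" using c_m[OF g(1)] c_m[OF h(1)] by (rule dvd_add)
  qed
  have "D g y \<oplus>\<^bsub>M\<^esub> D h y = \<zero>\<^bsub>M\<^esub>" if y: "y \<in> carrier M" for y
  proof (rule zero)
    have d: "D g y \<in> carrier M" "D h y \<in> carrier M" using g h y by auto
    have add: "[a] \<cdot>\<^bsub>M\<^esub> (D g y \<oplus>\<^bsub>M\<^esub> D h y) = [a] \<cdot>\<^bsub>M\<^esub> D g y \<oplus>\<^bsub>M\<^esub> [a] \<cdot>\<^bsub>M\<^esub> D h y" for a :: int
      using d by (simp add: M.add.int_pow_mult_distrib M.a_comm)
    show "D g y \<oplus>\<^bsub>M\<^esub> D h y \<in> carrier M" using d by simp
    show "[(int (p ^ n))] \<cdot>\<^bsub>M\<^esub> (D g y \<oplus>\<^bsub>M\<^esub> D h y) = \<zero>\<^bsub>M\<^esub>"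
      unfolding add Dpn[OF g(1) y] Dpn[OF h(1) y] by simp
    have "[(c g - 1)] \<cdot>\<^bsub>M\<^esub> (D g y \<oplus>\<^bsub>M\<^esub> D h y) = [((c g - 1) + (c h - 1))] \<cdot>\<^bsub>M\<^esub> D g y"
      unfolding add D_commute[OF g(1) h(1) y] using d(1) by (simp only: M.add.int_pow_mult)
    also have "\<dots> = \<zero>\<^bsub>M\<^esub>" by (rule N_mult[OF sum d(1)])
    finally show "[(int m)] \<cdot>\<^bsub>M\<^esub> (D g y \<oplus>\<^bsub>M\<^esub> D h y) = \<zero>\<^bsub>M\<^esub>" using d by (intro m_torsion[OF cg]) auto
  qed
  then have "g \<odot>\<^bsub>M\<^esub> x = x" using sum_zero_imp_trivial[OF g(1) h(1) _ x] by blast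
  then have Dg: "D g x = \<zero>\<^bsub>M\<^esub>" using D_zero_iff[OF g(1) x] by simp
  have d: "D t x \<in> carrier M" using t x by simp
  \<comment> \<open>An arbitrary t is compared with g, which acts trivially on x; c(g) - 1 is -2
    modulo p^n, so only m-torsion is left.\<close>
  have "[(c g - 1)] \<cdot>\<^bsub>M\<^esub> D t x = \<zero>\<^bsub>M\<^esub>" using D_commute[OF g(1) t x] Dg by simp
  then have "[(int m)] \<cdot>\<^bsub>M\<^esub> D t x = \<zero>\<^bsub>M\<^esub>" by (rule m_torsion[OF cg d])
  then have "D t x = \<zero>\<^bsub>M\<^esub>" using zero[OF d] Dpn[OF t x] by blast
  then show ?thesis using D_zero_iff[OF t x] by simp
qed

end

end

section \<open>From the exact sequence to the abstract argument\<close>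

lemma int_dvd_diff_if_mod_eq:
  fixes a b k :: nat
  assumes "a mod k = b mod k"
  shows "int k dvd int a - int b"
proof -
  have "int a mod int k = int b mod int k" using assms by (metis of_nat_mod)
  then show ?thesis by (simp only: mod_eq_dvd_iff)
qed

text \<open>s x - x is killed by q because the action on the quotient is trivial, so it comes from
  some z in \<open>M'\<close>. There t acts through the character at the order of z, which divides
  N, and compatibility of the levels replaces it by the value at N.\<close>

lemma short_exact_cyclotomic_action:
  assumes ex: "short_exact I M' i M q M''" and cyc: "cyclotomic_module L I M'"
    and triv: "acts_trivially (carrier I) M'' (carrier M'')"
    and N: "\<And>x. x \<in> carrier M \<Longrightarrow> [int N] \<cdot>\<^bsub>M\<^esub> x = \<zero>\<^bsub>M\<^esub>"
    and ch: "\<And>k. k dvd N \<Longrightarrow> cyclotomic_character L t N mod k = cyclotomic_character L t k"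
    and s: "s \<in> carrier I" and t: "t \<in> carrier I" and x: "x \<in> carrier M"
  shows "t \<odot>\<^bsub>M\<^esub> (s \<odot>\<^bsub>M\<^esub> x \<ominus>\<^bsub>M\<^esub> x) = [int (cyclotomic_character L t N)] \<cdot>\<^bsub>M\<^esub> (s \<odot>\<^bsub>M\<^esub> x \<ominus>\<^bsub>M\<^esub> x)"
proof -
  interpret M': group_module I M' using ex by (simp add: short_exact_def)
  interpret M: group_module I M using ex by (simp add: short_exact_def)
  interpret M'': group_module I M'' using ex by (simp add: short_exact_def)
  have inj: "inj_on i (carrier M')" and im: "i ` carrier M' = a_kernel M M'' q"
    and i: "i \<in> gmod_hom I M' M" and q: "q \<in> gmod_hom I M M''"
    using ex by (auto simp: short_exact_def)
  interpret i: group_hom "add_monoid M'" "add_monoid M" i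
    using i by (intro group_hom.intro group_hom_axioms.intro M'.a_group M.a_group) (simp add: gmod_hom_def)
  interpret q: group_hom "add_monoid M" "add_monoid M''" q
    using q by (intro group_hom.intro group_hom_axioms.intro M.a_group M''.a_group) (simp add: gmod_hom_def)
  have ip: "i ([k] \<cdot>\<^bsub>M'\<^esub> y) = [k] \<cdot>\<^bsub>M\<^esub> i y" if "y \<in> carrier M'" for k :: int and y
    using i.hom_int_pow[of y k] that by (simp add: add_pow_def)
  have i0: "i \<zero>\<^bsub>M'\<^esub> = \<zero>\<^bsub>M\<^esub>" using i.hom_one by simp
  let ?y = "s \<odot>\<^bsub>M\<^esub> x \<ominus>\<^bsub>M\<^esub> x"
  have sx: "s \<odot>\<^bsub>M\<^esub> x \<in> carrier M" by (rule M.act_closed[OF s x])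
  have qx: "q x \<in> carrier M''" using q.hom_closed[of x] x by simp
  have "q (s \<odot>\<^bsub>M\<^esub> x) = s \<odot>\<^bsub>M''\<^esub> q x" using q s x by (simp add: gmod_hom_def)
  also have "\<dots> = q x" using triv s qx by (simp add: acts_trivially_def)
  finally have qs: "q (s \<odot>\<^bsub>M\<^esub> x) = q x" .
  have "q ?y = q (s \<odot>\<^bsub>M\<^esub> x) \<oplus>\<^bsub>M''\<^esub> q (\<ominus>\<^bsub>M\<^esub> x)"
    using q.hom_mult[of "s \<odot>\<^bsub>M\<^esub> x" "\<ominus>\<^bsub>M\<^esub> x"] sx x by (simp add: M.minus_eq)
  also have "q (\<ominus>\<^bsub>M\<^esub> x) = \<ominus>\<^bsub>M''\<^esub> q x" using q.hom_inv[of x] x by (simp add: a_inv_def)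
  finally have "q ?y = \<zero>\<^bsub>M''\<^esub>" using qs qx by (simp add: M''.r_neg)
  then have "?y \<in> a_kernel M M'' q" using sx x by (simp add: a_kernel_def kernel_def)
  then obtain z where z: "z \<in> carrier M'" "i z = ?y" using im by (metis imageE)
  define k where "k = add_ord M' z"
  have "i ([int N] \<cdot>\<^bsub>M'\<^esub> z) = \<zero>\<^bsub>M\<^esub>" unfolding ip[OF z(1)] z(2) using N sx x by simp
  then have "[int N] \<cdot>\<^bsub>M'\<^esub> z = \<zero>\<^bsub>M'\<^esub>" using inj i0 z(1) by (metis M'.add.int_pow_closed M'.zero_closed inj_onD)
  then have "[N] \<cdot>\<^bsub>M'\<^esub> z = \<zero>\<^bsub>M'\<^esub>" by (simp add: add_pow_int_ge)
  then have kN: "k dvd N" using group.pow_eq_id[OF M'.a_group, of z N] z(1) by (simp add: k_def add_pow_def)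
  have "[k] \<cdot>\<^bsub>M'\<^esub> z = \<zero>\<^bsub>M'\<^esub>" using group.pow_ord_eq_1[OF M'.a_group, of z] z(1) by (simp add: k_def add_pow_def)
  then have kz: "[int k] \<cdot>\<^bsub>M'\<^esub> z = \<zero>\<^bsub>M'\<^esub>" by (simp add: add_pow_int_ge)
  let ?a = "cyclotomic_character L t N" and ?b = "cyclotomic_character L t k"
  have ab: "int ?a = int (?a div k) * int k + int ?b"
    using ch[OF kN] by (metis div_mult_mod_eq of_nat_add of_nat_mult)
  have "[int ?a] \<cdot>\<^bsub>M'\<^esub> z = [(int (?a div k) * int k)] \<cdot>\<^bsub>M'\<^esub> z \<oplus>\<^bsub>M'\<^esub> [int ?b] \<cdot>\<^bsub>M'\<^esub> z"
    unfolding ab by (rule M'.add.int_pow_mult[OF z(1)])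
  also have "\<dots> = [int ?b] \<cdot>\<^bsub>M'\<^esub> z" using M'.int_mult_zero_left[OF z(1) kz] z(1) by simp
  finally have "[int ?a] \<cdot>\<^bsub>M'\<^esub> z = [?b] \<cdot>\<^bsub>M'\<^esub> z" by (simp add: add_pow_int_ge)
  also have "\<dots> = t \<odot>\<^bsub>M'\<^esub> z"
    using cyc t z(1) by (simp add: cyclotomic_module_def Zhat_smult_def k_def)
  finally have "i ([int ?a] \<cdot>\<^bsub>M'\<^esub> z) = t \<odot>\<^bsub>M\<^esub> i z" using i t z(1) by (simp add: gmod_hom_def)
  then show ?thesis using ip[OF z(1)] z(2) by simp
qed

theorem theorem3p6:
  fixes p :: nat
    and L :: "('a, 'b) ring_scheme"
    and Q K :: "'a set"
    and av :: "'a \<Rightarrow> real"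
    and I :: "('a \<Rightarrow> 'a) monoid"
    and M :: "('a \<Rightarrow> 'a, 'm) module"
  assumes "Factorial_Ring.prime p" and "odd p"
    and "finite_unramified_extension L Q p av K"
    and "algebraic_closure L K"
    and "I = inertia_group L Q av K"
    and "group_module I M" and "finite (carrier M)"
    and "ordinary_semistable L I M"
    and "almost_unramified I M"
  shows "acts_trivially (fixing_roots_of_unity L p (carrier I)) M (carrier M) \<and>
         (p \<ge> 5 \<and> ordinary_good L I p M \<longrightarrow> acts_trivially (carrier I) M (carrier M))"
proof -
  have "padic_numbers L Q p av" using assms(3) by (simp add: finite_unramified_extension_def)
  then interpret U: unramified_closure L Q p av K
    using assms(1-4)
    by (intro unramified_closure.intro padic_prime.intro padic_prime_axioms.intro
        unramified_closure_axioms.intro) auto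
  interpret M: group_module I M by fact
  note I = assms(5)
  have p0: "p > 0" and pu: "\<not> is_unit p" using assms(1) prime_gt_0_nat not_prime_unit by auto
  \<comment> \<open>A multiple of the order of \<open>M\<close>, with an extra factor p so that n >
    0 below; for n = 0 the modulus p^n would not see the character modulo p.\<close>
  define e where "e = p * card (carrier M)"
  have "carrier M \<noteq> {}" using M.zero_closed by blast
  then have e0: "e > 0" using assms(7) p0 by (simp add: e_def card_gt_0_iff)
  define n where "n = multiplicity p e"
  obtain m where m: "e = p ^ n * m" "\<not> p dvd m"
    unfolding n_def using multiplicity_decompose'[of e p] e0 pu by auto
  have n0: "n > 0" using m by (cases "n = 0") (auto simp: e_def)
  have mp: "coprime m p" by (subst coprime_commute) (rule prime_imp_coprime[OF assms(1) m(2)])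
  have pe: "p dvd e" by (simp add: e_def)
  have pne: "p ^ n dvd e" "m dvd e" using m(1) by auto
  have m0: "m > 0" using m(1) e0 by (cases "m = 0") auto
  define c where "c s = int (cyclotomic_character L s (p ^ n * m))" for s
  note hom = U.inertia_hom[folded I]
  have ch: "cyclotomic_character L s (p ^ n * m) mod k = cyclotomic_character L s k"
    if "s \<in> carrier I" "k dvd p ^ n * m" for s k
    using U.cyclotomic_character_dvd[OF hom[OF that(1)] _ that(2)] e0 m(1) by simp
  have N: "[int (p ^ n * m)] \<cdot>\<^bsub>M\<^esub> x = \<zero>\<^bsub>M\<^esub>" if x: "x \<in> carrier M" for x
  proof -
    have "[card (carrier M)] \<cdot>\<^bsub>M\<^esub> x = \<zero>\<^bsub>M\<^esub>"
      using group.pow_order_eq_1[OF M.a_group, of x] x by (simp add: Coset.order_def add_pow_def)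
    then have "[int (card (carrier M))] \<cdot>\<^bsub>M\<^esub> x = \<zero>\<^bsub>M\<^esub>" by (simp add: add_pow_int_ge)
    from M.int_mult_zero_left[OF x this, of "int p"] show ?thesis
      using m(1) unfolding e_def by (metis of_nat_mult)
  qed
  have cyc: "t \<odot>\<^bsub>M\<^esub> (s \<odot>\<^bsub>M\<^esub> x \<ominus>\<^bsub>M\<^esub> x) = [(c t)] \<cdot>\<^bsub>M\<^esub> (s \<odot>\<^bsub>M\<^esub> x \<ominus>\<^bsub>M\<^esub> x)"
    if "s \<in> carrier I" "t \<in> carrier I" "x \<in> carrier M" for s t x
  proof -
    obtain M' M'' :: "('a \<Rightarrow> 'a, 'm) module" and i q where
      "short_exact I M' i M q M''" "cyclotomic_module L I M'" "acts_trivially (carrier I) M'' (carrier M'')"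
      using assms(8) unfolding ordinary_semistable_def by blast
    then show ?thesis
      unfolding c_def using N ch that by (intro short_exact_cyclotomic_action) auto
  qed
  have c_mult: "int (p ^ n * m) dvd c (s \<otimes>\<^bsub>I\<^esub> t) - c s * c t" if "s \<in> carrier I" "t \<in> carrier I" for s t
  proof -
    have st: "s \<otimes>\<^bsub>I\<^esub> t \<in> carrier I" using that by simp
    have "cyclotomic_character L (s \<otimes>\<^bsub>I\<^esub> t) (p ^ n * m) mod (p ^ n * m)
        = (cyclotomic_character L s (p ^ n * m) * cyclotomic_character L t (p ^ n * m)) mod (p ^ n * m)"
      using U.cyclotomic_character_mult[folded I, OF that st, of "p ^ n * m"] e0 m(1) by simp
    from int_dvd_diff_if_mod_eq[OF this] show ?thesis by (simp only: c_def of_nat_mult)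
  qed
  have c_one: "int (p ^ n * m) dvd c \<one>\<^bsub>I\<^esub> - 1"
  proof -
    have "cyclotomic_character L \<one>\<^bsub>I\<^esub> (p ^ n * m) mod (p ^ n * m) = 1 mod (p ^ n * m)"
      using U.cyclotomic_character_one[folded I, of "p ^ n * m"] e0 m(1) by simp
    from int_dvd_diff_if_mod_eq[OF this] show ?thesis by (simp only: c_def of_nat_1)
  qed
  have c_m: "int m dvd c s - 1" if "s \<in> carrier I" for s
  proof -
    have "cyclotomic_character L s (p ^ n * m) mod m = 1 mod m"
      using ch[OF that, of m] U.cyclotomic_character_prime_to_p[folded I, OF that m0 mp] by simp
    from int_dvd_diff_if_mod_eq[OF this] show ?thesis by (simp only: c_def of_nat_1)
  qed
  have c_surj: "\<exists>s\<in>carrier I. int (p ^ n) dvd c s - int u" if u: "coprime u p" for u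
  proof -
    \<comment> \<open>Surjectivity is available for the positive powers p^k * p, so n > 0 enters
      here.\<close>
    obtain k where k: "n = Suc k" using n0 by (cases n) auto
    then have pk: "p ^ k * p = p ^ n" by simp
    obtain s where s: "s \<in> carrier I" "cyclotomic_character L s (p ^ n) = u mod (p ^ n)"
      using U.cyclotomic_character_surj[folded I, OF u, of k] unfolding pk by blast
    have "cyclotomic_character L s (p ^ n * m) mod (p ^ n) = u mod (p ^ n)"
      using ch[OF s(1), of "p ^ n"] s(2) by simp
    from int_dvd_diff_if_mod_eq[OF this] have "int (p ^ n) dvd c s - int u" by (simp only: c_def)
    then show ?thesis using s(1) by blast
  qed
  have wild: "s \<odot>\<^bsub>M\<^esub> x = x" if "s \<in> carrier I" "int p dvd c s - 1" "x \<in> carrier M" for s x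
    by (rule M.wild_trivial[where c = c, OF assms(1) n0 mp _ _ _ _ _ _ assms(9,2) that])
      (fact cyc N c_mult c_one c_m c_surj)+
  show ?thesis
  proof (intro conjI impI)
    show "acts_trivially (fixing_roots_of_unity L p (carrier I)) M (carrier M)"
      unfolding acts_trivially_def
    proof (intro ballI)
      fix s x assume s: "s \<in> fixing_roots_of_unity L p (carrier I)" and x: "x \<in> carrier M"
      have sI: "s \<in> carrier I" using s by (simp add: fixing_roots_of_unity_def)
      \<comment> \<open>I(1) enters through the value 1 at level p, and p divides the modulus p^n
        m.\<close>
      have "cyclotomic_character L s (p ^ n * m) mod p = 1 mod p"
        using ch[OF sI, of p] U.cyclotomic_character_fixing[folded I, OF s] pe m(1) prime_gt_1_nat[OF assms(1)]
        by simp
      from int_dvd_diff_if_mod_eq[OF this] have "int p dvd c s - 1" by (simp only: c_def of_nat_1)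
      then show "s \<odot>\<^bsub>M\<^esub> x = x" by (rule wild[OF sI _ x])
    qed
  next
    assume *: "p \<ge> 5 \<and> ordinary_good L I p M"
    \<comment> \<open>Elements killed by m have order prime to p, so goodness applies to
      them.\<close>
    have prime_to: "s \<odot>\<^bsub>M\<^esub> x \<ominus>\<^bsub>M\<^esub> x = \<zero>\<^bsub>M\<^esub>"
      if s: "s \<in> carrier I" and x: "x \<in> carrier M" "[int m] \<cdot>\<^bsub>M\<^esub> x = \<zero>\<^bsub>M\<^esub>" for s x
    proof -
      have "[m] \<cdot>\<^bsub>M\<^esub> x = \<zero>\<^bsub>M\<^esub>" using x(2) by (simp add: add_pow_int_ge)
      then have "add_ord M x dvd m" using group.pow_eq_id[OF M.a_group, of x m] x(1) by (simp add: add_pow_def)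
      then have "coprime p (add_ord M x)"
        by (rule coprime_divisors[OF dvd_refl]) (rule prime_imp_coprime[OF assms(1) m(2)])
      then have "x \<in> prime_to_part p M" using x(1) by (simp add: prime_to_part_def)
      then have "s \<odot>\<^bsub>M\<^esub> x = x" using * s by (auto simp: ordinary_good_def acts_trivially_def)
      then show ?thesis using M.D_zero_iff[OF s x(1)] by simp
    qed
    have "t \<odot>\<^bsub>M\<^esub> x = x" if "t \<in> carrier I" "x \<in> carrier M" for t x
      by (rule M.good_trivial[where c = c, OF assms(1) n0 mp _ _ _ _ _ _ assms(9) _ _ that])
        (fact cyc N c_mult c_one c_m c_surj *[THEN conjunct1] prime_to)+
    then show "acts_trivially (carrier I) M (carrier M)"
      unfolding acts_trivially_def by blast
  qed
qed

end
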